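(* Suppose $E$ is an ordered Banach space, $\mathcal{A}$ is a $C^*$-algebra, $S$ is a weakly compact operator, $T$ is an operator, and one of the following holds: (1) $E$ is generating, and $0 \leq T \leq S : E \to \mathcal{A}^\star$. (2) $E$ is normal, and $0 \leq T \leq S : \mathcal{A} \to E$. Then $T$ is weakly compact.
   Context: An ordered Banach space (OBS) is a real Banach space $Z$ with a norm-closed convex cone $Z_+$ which is proper: $Z_+\cap(-Z_+)=\{0\}$. It is generating if $Z_+-Z_+=Z$, and normal if there is a constant $N$ such that $\|z\|\le N(\|a\|+\|b\|)$ whenever $a\le z\le b$. $C^*$-algebras carry their usual positive cones, and the dual $\mathcal{A}^\star$ carries the cone of positive functionals; they are ordered Banach spaces through their self-adjoint (hermitian) parts, and operators between them and real OBSs are understood as real-linear operators accordingly. Operators are bounded linear maps; $T\ge 0$ means that $T$ maps positive elements to positive elements, and $T\le S$ means $S-T\ge 0$. *)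

theory Defs
  imports "HOL-Analysis.Analysis"
begin

section \<open>C*-algebras\<close>

class complex_normed_vector = real_normed_vector +
  fixes scaleC :: "complex \<Rightarrow> 'a \<Rightarrow> 'a"  (infixr \<open>*\<^sub>C\<close> 75)
  assumes scaleC_add_right: "c *\<^sub>C (x + y) = c *\<^sub>C x + c *\<^sub>C y"
    and scaleC_add_left: "(c + d) *\<^sub>C x = c *\<^sub>C x + d *\<^sub>C x"
    and scaleC_scaleC: "c *\<^sub>C d *\<^sub>C x = (c * d) *\<^sub>C x"
    and scaleC_of_real: "complex_of_real r *\<^sub>C x = r *\<^sub>R x"
    and norm_scaleC: "norm (c *\<^sub>C x) = cmod c * norm x"

text \<open>No unit is assumed.\<close>

class cstar_algebra = complex_normed_vector + real_normed_algebra + banach +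
  fixes star :: "'a \<Rightarrow> 'a"
  assumes mult_scaleC_left: "(c *\<^sub>C x) * y = c *\<^sub>C (x * y)"
    and mult_scaleC_right: "x * (c *\<^sub>C y) = c *\<^sub>C (x * y)"
    and star_add: "star (x + y) = star x + star y"
    and star_scaleC: "star (c *\<^sub>C x) = cnj c *\<^sub>C star x"
    and star_mult: "star (x * y) = star y * star x"
    and star_star: "star (star x) = x"
    and cstar_identity: "norm (star x * x) = (norm x)\<^sup>2"

instantiation complex :: cstar_algebra
begin

definition scaleC_complex :: "complex \<Rightarrow> complex \<Rightarrow> complex"
  where "scaleC_complex c x = c * x"

definition star_complex :: "complex \<Rightarrow> complex"
  where "star_complex = cnj"

instance
  by standard
    (simp_all add: scaleC_complex_def star_complex_def algebra_simps norm_mult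
      power2_eq_square scaleR_conv_of_real)

end

definition positive_elements :: "'a::cstar_algebra set"
  where "positive_elements = {star x * x | x. True}"

lemma star_scaleR: "star (r *\<^sub>R x) = r *\<^sub>R star (x::'a::cstar_algebra)"
  by (metis complex_cnj_complex_of_real scaleC_of_real star_scaleC)

lemma star_zero: "star (0::'a::cstar_algebra) = 0"
  by (metis scaleR_zero_left star_scaleR)

lemma star_minus: "star (- x) = - star (x::'a::cstar_algebra)"
  by (metis scaleR_minus1_left star_scaleR)

lemma star_diff: "star (x - y) = star x - star (y::'a::cstar_algebra)"
  by (metis diff_conv_add_uminus star_add star_minus)

lemma norm_star: "norm (star x) = norm (x::'a::cstar_algebra)"
proof -
  have le: "norm y \<le> norm (star y)" for y :: 'a
  proof (cases "y = 0")
    case False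
    have "norm y * norm y \<le> norm (star y) * norm y"
      by (metis cstar_identity norm_mult_ineq power2_eq_square)
    with False show ?thesis by simp
  qed simp
  from le[of x] le[of "star x"] show ?thesis by (simp add: star_star)
qed

lemma bounded_linear_star: "bounded_linear (star :: 'a::cstar_algebra \<Rightarrow> 'a)"
  by (rule bounded_linear_intro[of _ 1]) (simp_all add: star_add star_scaleR norm_star)


section \<open>The self-adjoint part of a C*-algebra\<close>

typedef (overloaded) 'a self_adjoint = "{x::'a::cstar_algebra. star x = x}"
  morphisms sa_elem Abs_self_adjoint
  by (rule exI[of _ 0]) (simp add: star_zero)

setup_lifting type_definition_self_adjoint

instantiation self_adjoint :: (cstar_algebra) real_normed_vector
begin

lift_definition zero_self_adjoint :: "'a self_adjoint" is 0
  by (rule star_zero)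
lift_definition plus_self_adjoint :: "'a self_adjoint \<Rightarrow> 'a self_adjoint \<Rightarrow> 'a self_adjoint" is "(+)"
  by (simp add: star_add)
lift_definition minus_self_adjoint :: "'a self_adjoint \<Rightarrow> 'a self_adjoint \<Rightarrow> 'a self_adjoint" is "(-)"
  by (simp add: star_diff)
lift_definition uminus_self_adjoint :: "'a self_adjoint \<Rightarrow> 'a self_adjoint" is uminus
  by (simp add: star_minus)
lift_definition scaleR_self_adjoint :: "real \<Rightarrow> 'a self_adjoint \<Rightarrow> 'a self_adjoint" is scaleR
  by (simp add: star_scaleR)
lift_definition norm_self_adjoint :: "'a self_adjoint \<Rightarrow> real" is norm .
lift_definition dist_self_adjoint :: "'a self_adjoint \<Rightarrow> 'a self_adjoint \<Rightarrow> real" is dist .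
definition sgn_self_adjoint :: "'a self_adjoint \<Rightarrow> 'a self_adjoint"
  where "sgn_self_adjoint x = scaleR (inverse (norm x)) x"
definition uniformity_self_adjoint :: "('a self_adjoint \<times> 'a self_adjoint) filter"
  where "uniformity_self_adjoint = (INF e\<in>{0<..}. principal {(x, y). dist x y < e})"
definition open_self_adjoint :: "'a self_adjoint set \<Rightarrow> bool"
  where "open_self_adjoint U =
    (\<forall>x\<in>U. eventually (\<lambda>(x', y). x' = x \<longrightarrow> y \<in> U) uniformity)"

instance
  by (standard;
      (simp only: sgn_self_adjoint_def uniformity_self_adjoint_def open_self_adjoint_def; fail)?;
      transfer;
      simp add: algebra_simps dist_norm norm_triangle_ineq)

end

instance self_adjoint :: (cstar_algebra) banach
proof
  fix X :: "nat \<Rightarrow> 'a self_adjoint"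
  assume "Cauchy X"
  then have "Cauchy (\<lambda>n. sa_elem (X n))"
    unfolding Cauchy_def by (simp add: dist_self_adjoint.rep_eq)
  then obtain l where l: "(\<lambda>n. sa_elem (X n)) \<longlonglongrightarrow> l"
    using Cauchy_convergent_iff convergent_def by blast
  have "(\<lambda>n. star (sa_elem (X n))) \<longlonglongrightarrow> star l"
    by (rule bounded_linear.tendsto[OF bounded_linear_star l])
  moreover have "star (sa_elem (X n)) = sa_elem (X n)" for n
    using sa_elem[of "X n"] by simp
  ultimately have "star l = l"
    using l LIMSEQ_unique by simp
  then have "sa_elem (Abs_self_adjoint l) = l"
    by (simp add: Abs_self_adjoint_inverse)
  then have "X \<longlonglongrightarrow> Abs_self_adjoint l"
    using l unfolding lim_sequentially by (simp add: dist_self_adjoint.rep_eq)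
  then show "convergent X"
    by (auto simp: convergent_def)
qed

definition self_adjoint_cone :: "'a::cstar_algebra self_adjoint set"
  where "self_adjoint_cone = {a. sa_elem a \<in> positive_elements}"


section \<open>The hermitian part of the dual of a C*-algebra\<close>

text \<open>
  The dual consists of the bounded complex-linear functionals. The norm of
  \<^typ>\<open>'a \<Rightarrow>\<^sub>L complex\<close>, restricted to them, is the usual dual norm.
\<close>

typedef (overloaded) 'a hermitian_dual =
  "{f :: 'a::cstar_algebra \<Rightarrow>\<^sub>L complex.
      (\<forall>c x. blinfun_apply f (c *\<^sub>C x) = c * blinfun_apply f x) \<and>
      (\<forall>x. blinfun_apply f (star x) = cnj (blinfun_apply f x))}"
  morphisms functional Abs_hermitian_dual
  by (rule exI[of _ 0]) simp

setup_lifting type_definition_hermitian_dual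

instantiation hermitian_dual :: (cstar_algebra) real_normed_vector
begin

lift_definition zero_hermitian_dual :: "'a hermitian_dual" is 0
  by simp
lift_definition plus_hermitian_dual :: "'a hermitian_dual \<Rightarrow> 'a hermitian_dual \<Rightarrow> 'a hermitian_dual"
  is "(+)"
  by (simp add: blinfun.add_left distrib_left)
lift_definition minus_hermitian_dual :: "'a hermitian_dual \<Rightarrow> 'a hermitian_dual \<Rightarrow> 'a hermitian_dual"
  is "(-)"
  by (simp add: blinfun.diff_left right_diff_distrib)
lift_definition uminus_hermitian_dual :: "'a hermitian_dual \<Rightarrow> 'a hermitian_dual" is uminus
  by (simp add: blinfun.minus_left)
lift_definition scaleR_hermitian_dual :: "real \<Rightarrow> 'a hermitian_dual \<Rightarrow> 'a hermitian_dual" is scaleR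
  by (simp add: blinfun.scaleR_left)
lift_definition norm_hermitian_dual :: "'a hermitian_dual \<Rightarrow> real" is norm .
lift_definition dist_hermitian_dual :: "'a hermitian_dual \<Rightarrow> 'a hermitian_dual \<Rightarrow> real" is dist .
definition sgn_hermitian_dual :: "'a hermitian_dual \<Rightarrow> 'a hermitian_dual"
  where "sgn_hermitian_dual x = scaleR (inverse (norm x)) x"
definition uniformity_hermitian_dual :: "('a hermitian_dual \<times> 'a hermitian_dual) filter"
  where "uniformity_hermitian_dual = (INF e\<in>{0<..}. principal {(x, y). dist x y < e})"
definition open_hermitian_dual :: "'a hermitian_dual set \<Rightarrow> bool"
  where "open_hermitian_dual U =
    (\<forall>x\<in>U. eventually (\<lambda>(x', y). x' = x \<longrightarrow> y \<in> U) uniformity)"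

instance
  by (standard;
      (simp only: sgn_hermitian_dual_def uniformity_hermitian_dual_def open_hermitian_dual_def; fail)?;
      transfer;
      simp add: algebra_simps dist_norm norm_triangle_ineq)

end

instance hermitian_dual :: (cstar_algebra) banach
proof
  fix X :: "nat \<Rightarrow> 'a hermitian_dual"
  assume "Cauchy X"
  then have "Cauchy (\<lambda>n. functional (X n))"
    unfolding Cauchy_def by (simp add: dist_hermitian_dual.rep_eq)
  then obtain l where l: "(\<lambda>n. functional (X n)) \<longlonglongrightarrow> l"
    using Cauchy_convergent_iff convergent_def by blast
  have lim: "(\<lambda>n. blinfun_apply (functional (X n)) x) \<longlonglongrightarrow> blinfun_apply l x" for x
    by (intro tendsto_intros l)
  have X: "blinfun_apply (functional (X n)) (c *\<^sub>C x) = c * blinfun_apply (functional (X n)) x"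
    "blinfun_apply (functional (X n)) (star x) = cnj (blinfun_apply (functional (X n)) x)" for n c x
    using functional[of "X n"] by auto
  have "blinfun_apply l (c *\<^sub>C x) = c * blinfun_apply l x" for c x
    using LIMSEQ_unique[OF lim[of "c *\<^sub>C x"]] tendsto_mult_left[OF lim[of x], of c]
    by (simp add: X)
  moreover have "blinfun_apply l (star x) = cnj (blinfun_apply l x)" for x
    using LIMSEQ_unique[OF lim[of "star x"]] tendsto_cnj[OF lim[of x]]
    by (simp add: X)
  ultimately have "functional (Abs_hermitian_dual l) = l"
    by (simp add: Abs_hermitian_dual_inverse)
  then have "X \<longlonglongrightarrow> Abs_hermitian_dual l"
    using l unfolding lim_sequentially by (simp add: dist_hermitian_dual.rep_eq)
  then show "convergent X"
    by (auto simp: convergent_def)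
qed

text \<open>
  Positive functionals are hermitian, so this is the cone of all positive functionals.
\<close>

definition positive_functionals :: "'a::cstar_algebra hermitian_dual set"
  where "positive_functionals =
    {f. \<forall>a\<in>positive_elements. blinfun_apply (functional f) a \<in> \<real>\<^sub>\<ge>\<^sub>0}"


section \<open>Ordered Banach spaces\<close>

text \<open>
  The order is given by its positive cone \<open>P\<close>; \<open>a \<le> b\<close> means \<open>b - a \<in> P\<close>.
\<close>

definition ordered_banach_space :: "'e::banach set \<Rightarrow> bool"
  where "ordered_banach_space P \<longleftrightarrow>
    closed P \<and> convex_cone P \<and> P \<inter> uminus ` P = {0}"

definition generating_cone :: "'e::banach set \<Rightarrow> bool"
  where "generating_cone P \<longleftrightarrow> {a - b | a b. a \<in> P \<and> b \<in> P} = UNIV"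

definition normal_cone :: "'e::banach set \<Rightarrow> bool"
  where "normal_cone P \<longleftrightarrow>
    (\<exists>N. \<forall>a z b. z - a \<in> P \<and> b - z \<in> P \<longrightarrow> norm z \<le> N * (norm a + norm b))"

definition positive_operator ::
  "'x::real_normed_vector set \<Rightarrow> 'y::real_normed_vector set \<Rightarrow> ('x \<Rightarrow>\<^sub>L 'y) \<Rightarrow> bool"
  where "positive_operator P Q T \<longleftrightarrow> (\<forall>x\<in>P. blinfun_apply T x \<in> Q)"

definition operator_le ::
  "'x::real_normed_vector set \<Rightarrow> 'y::real_normed_vector set \<Rightarrow> ('x \<Rightarrow>\<^sub>L 'y) \<Rightarrow> ('x \<Rightarrow>\<^sub>L 'y) \<Rightarrow> bool"
  where "operator_le P Q T S \<longleftrightarrow> positive_operator P Q (S - T)"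


section \<open>Weakly compact operators\<close>

definition weak_topology :: "'y::real_normed_vector topology"
  where "weak_topology =
    topology_generated_by {blinfun_apply f -` U | (f :: 'y \<Rightarrow>\<^sub>L real) U. open U}"

definition weakly_compact_operator :: "('x::real_normed_vector \<Rightarrow>\<^sub>L 'y::real_normed_vector) \<Rightarrow> bool"
  where "weakly_compact_operator T \<longleftrightarrow>
    compactin weak_topology (weak_topology closure_of (blinfun_apply T ` cball 0 1))"

end

theory Submission
  imports Defs
begin

text \<open>
  Write \<open>X\<close> for the self-adjoint part of the algebra. The hermitian part of the dual is isomorphic to
  the real dual of \<open>X\<close>, so the two statements concern operators into \<open>X\<^sup>*\<close> and operators on \<open>X\<close>.

  Both follow from a description of weak compactness by absolute continuity. If a weakly compact
  family of positive functionals on \<open>X\<close> is given, then for each \<open>\<epsilon>\<close> there is a single positive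
  functional \<open>\<phi>\<close> such that all members of the family are at most \<open>\<epsilon>\<close> at those squares from the open
  unit ball at which \<open>\<phi>\<close> is small enough (\<open>weakly_compact_dual_absolutely_continuous\<close>; for operators
  on \<open>X\<close> the analogue is \<open>weakly_compact_absolutely_continuous\<close>). Otherwise there are functionals
  \<open>f\<^sub>i\<close> and squares \<open>h\<^sub>i\<^sup>2\<close> with \<open>f\<^sub>i\<close> large at \<open>h\<^sub>i\<^sup>2\<close> and all earlier \<open>f\<^sub>j\<close> very small there. With
  \<open>s = h\<^sub>n\<^sup>2 + \<dots> + h\<^sub>m\<^sup>2\<close> the bounded elements \<open>s (1 + s)\<inverse>\<close> lie below \<open>s\<close> and above half of each summand
  (\<open>bounded_majorant\<close>), and they lead to iterated limits that cannot be interchanged, against weak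
  compactness.

  Absolute continuity on squares is an order property, so it passes from \<open>S\<close> to \<open>T\<close>. In the first
  case this uses that differences of bounded elements of a generating cone are dense in a ball
  (\<open>generating_cone_dense_ball\<close>), in the second that a normal cone has enough positive functionals
  (\<open>normal_cone_positive_functionals\<close>). Since each self-adjoint \<open>v\<close> is nearly a difference of two
  squares that are controlled by \<open>v\<^sup>2\<close> (\<open>approximate_difference_of_squares\<close>), the estimate becomes:
  the values of \<open>T\<close> at \<open>v\<close> in the unit ball are small when \<open>\<phi> (v\<^sup>2)\<close> is small.

  Conversely such an estimate gives weak compactness, because \<open>\<phi> (v\<^sup>2)\<close> is a quadratic form. For an
  operator on \<open>X\<close>, convex combinations of a net that almost minimize the form are Cauchy by the
  parallelogram law (\<open>parallelogram_weak_limit\<close>). For an operator into \<open>X\<^sup>*\<close>, each value \<open>T x\<close> is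
  within \<open>\<epsilon>\<close> of a functional \<open>w \<mapsto> \<kappa> \<phi> ((u w + w u) / 2)\<close> with \<open>u\<close> in the unit ball
  (\<open>approximate_jordan_functional\<close>), and these form a relatively weakly compact set by the same
  criterion.

  No spectral theory is used. Positivity enters only through the values of positive functionals on
  elements \<open>b\<^sup>* b\<close>.
\<close>

section \<open>Square roots and quasi-inverses in a C*-algebra\<close>

lemma mult_commute_mult:
  fixes u v z :: "'a::semigroup_mult"
  assumes "u * z = z * u" "v * z = z * v"
  shows "u * v * z = z * (u * v)"
proof -
  have "u * v * z = u * (z * v)"
    by (simp add: mult.assoc assms(2))
  also have "\<dots> = z * (u * v)"
    by (simp flip: mult.assoc add: assms(1))
  finally show ?thesis .
qed

text \<open>
  The self-adjoint elements that commute with everything that commutes with \<open>w\<close>. This closed set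
  is kept invariant by the two fixed-point iterations below, so their limits are self-adjoint and
  commute with whatever is needed.
\<close>

definition bicommutant_sa :: "'a::cstar_algebra \<Rightarrow> 'a set"
  where "bicommutant_sa w = {v. star v = v \<and> (\<forall>z. w * z = z * w \<longrightarrow> v * z = z * v)}"

lemma closed_bicommutant_sa: "closed (bicommutant_sa (w::'a::cstar_algebra))"
proof -
  have "closed {v::'a. star v = v}"
    by (intro closed_Collect_eq bounded_linear.continuous_on[OF bounded_linear_star] continuous_intros)
  moreover have "closed {v::'a. v * z = z * v}" for z
    by (intro closed_Collect_eq continuous_intros)
  moreover have "bicommutant_sa w = {v. star v = v} \<inter> (\<Inter>z\<in>{z. w * z = z * w}. {v. v * z = z * v})"
    by (auto simp: bicommutant_sa_def)
  ultimately show ?thesis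
    by auto
qed

text \<open>
  The algebra need not have a unit. Elements \<open>1 - w\<close> of the unitization are represented by \<open>w\<close>,
  and \<open>(1 - w) b\<close> by \<open>b - w b\<close>. In this sense \<open>1 - w'\<close> below is a square root of \<open>1 - w\<close>.
\<close>

lemma quasi_sqrt:
  fixes w :: "'a::cstar_algebra"
  assumes w: "star w = w" "norm w < 1"
  obtains w' where "star w' = w'" "w' + w' - w' * w' = w" "\<And>z. w * z = z * w \<Longrightarrow> w' * z = z * w'"
proof -
  define q where "q = norm w"
  \<comment> \<open>the smaller root of \<open>(q + \<rho>\<^sup>2) / 2 = \<rho>\<close>: the iteration maps the ball of this radius to itself\<close>
  define \<rho> where "\<rho> = 1 - sqrt (1 - q)"
  have q: "0 \<le> q" "q < 1" using w by (auto simp: q_def)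
  have \<rho>: "0 \<le> \<rho>" "\<rho> < 1" using q by (auto simp: \<rho>_def)
  have \<rho>2: "q + \<rho>\<^sup>2 = 2 * \<rho>"
    using q by (simp add: \<rho>_def power2_eq_square algebra_simps)
  let ?S = "bicommutant_sa w \<inter> cball 0 \<rho>"
  let ?f = "\<lambda>v. (1/2) *\<^sub>R (w + v * v)"
  have "\<exists>!v\<in>?S. ?f v = v"
  proof (rule Banach_fix[OF _ _ \<rho>])
    show "complete ?S"
      by (simp add: complete_eq_closed closed_bicommutant_sa closed_Int)
    have "0 \<in> ?S"
      using \<rho> by (simp add: bicommutant_sa_def star_zero)
    then show "?S \<noteq> {}" by blast
    show "?f ` ?S \<subseteq> ?S"
    proof safe
      fix v assume v: "v \<in> bicommutant_sa w" "v \<in> cball 0 \<rho>"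
      have "v * v * z = z * (v * v)" if "w * z = z * w" for z
      proof -
        have "v * z = z * v"
          using v(1) that by (simp add: bicommutant_sa_def)
        then show ?thesis
          by (rule mult_commute_mult[rotated]) fact
      qed
      moreover have "star v = v"
        using v(1) by (simp add: bicommutant_sa_def)
      ultimately show "?f v \<in> bicommutant_sa w"
        using w(1) unfolding bicommutant_sa_def
        by (simp add: star_scaleR star_add star_mult distrib_left distrib_right)
      have "norm (v * v) \<le> \<rho>\<^sup>2"
        using v(2) norm_mult_ineq[of v v] mult_mono[of "norm v" \<rho> "norm v" \<rho>] \<rho>
        by (simp add: power2_eq_square)
      then have "norm (w + v * v) \<le> 2 * \<rho>"
        using norm_triangle_ineq[of w "v * v"] \<rho>2 by (simp add: q_def)
      then show "?f v \<in> cball 0 \<rho>"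
        by simp
    qed
    fix v u assume "v \<in> ?S" "u \<in> ?S"
    then have n: "norm v \<le> \<rho>" "norm u \<le> \<rho>" by auto
    have "v * v - u * u = v * (v - u) + (v - u) * u"
      by (simp add: algebra_simps)
    also have "norm \<dots> \<le> norm v * norm (v - u) + norm (v - u) * norm u"
      by (rule norm_triangle_le) (intro add_mono norm_mult_ineq)
    also have "\<dots> \<le> \<rho> * norm (v - u) + norm (v - u) * \<rho>"
      using n \<rho>(1) by (intro add_mono mult_mono) auto
    finally have "norm (v * v - u * u) \<le> 2 * \<rho> * norm (v - u)"
      by simp
    moreover have "?f v - ?f u = (1/2) *\<^sub>R (v * v - u * u)"
      by (simp add: scaleR_diff_right scaleR_add_right)
    ultimately show "dist (?f v) (?f u) \<le> \<rho> * dist v u"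
      by (simp add: dist_norm)
  qed
  then obtain v where v: "v \<in> bicommutant_sa w" "?f v = v" by auto
  have "v + v = 2 *\<^sub>R ?f v"
    by (subst v(2)) (simp add: scaleR_2)
  then have "v + v - v * v = w"
    by simp
  moreover have "star v = v" "w * z = z * w \<Longrightarrow> v * z = z * v" for z
    using v(1) by (simp_all add: bicommutant_sa_def)
  ultimately show thesis
    by (intro that[of v])
qed

lemma scaleC_diff_left: "(c - d) *\<^sub>C x = c *\<^sub>C x - d *\<^sub>C (x::'a::complex_normed_vector)"
  using scaleC_add_left[of "c - d" d x] by simp

text \<open>
  Let \<open>k\<close> be the square root of \<open>1 - h\<^sup>2\<close>. The elements \<open>h + \<i> k\<close> and \<open>h - \<i> k\<close> of the unitization
  are unitary, so their difference shows that \<open>k\<close> is a contraction, and therefore so is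
  \<open>1 - h\<^sup>2 = k\<^sup>2\<close>. This replaces all spectral theory.
\<close>

lemma norm_one_minus_square_le:
  fixes h b :: "'a::cstar_algebra"
  assumes h: "star h = h" "norm h < 1"
  shows "norm (b - h * h * b) \<le> norm b"
proof -
  have hh: "star (h * h) = h * h" "norm (h * h) < 1"
    using h norm_mult_ineq[of h h] mult_strict_mono[of "norm h" 1 "norm h" 1]
    by (auto simp: star_mult)
  obtain w where w: "star w = w" "w + w - w * w = h * h" "\<And>z. h * h * z = z * (h * h) \<Longrightarrow> w * z = z * w"
    by (rule quasi_sqrt[OF hh]) (rule that)
  have wh: "w * h = h * w"
    by (rule w(3)) (simp add: mult.assoc)
  define k where "k = (\<lambda>c. c - w * c)"
  have kk: "k (k c) = c - h * h * c" for c
    unfolding w(2)[symmetric] by (simp add: k_def algebra_simps)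
  have hk: "h * k c = k (h * c)" for c
  proof -
    have "h * (w * c) = w * (h * c)"
      by (simp flip: mult.assoc add: wh)
    then show ?thesis
      by (simp add: k_def right_diff_distrib)
  qed
  have star_k: "star (k c) * d = star c * k d" for c d
    by (simp add: k_def star_mult star_diff w(1) left_diff_distrib right_diff_distrib mult.assoc)
  have isom: "norm (h * c + s *\<^sub>C k c) = norm c" if s: "cnj s * s = 1" "cnj s = - s" for c s
  proof -
    let ?u = "h * c + s *\<^sub>C k c"
    have "star ?u * ?u = star c * (h * (h * c)) + s *\<^sub>C (star c * (h * k c))
        + cnj s *\<^sub>C (star (k c) * (h * c)) + (cnj s * s) *\<^sub>C (star (k c) * k c)"
      by (simp add: star_add star_scaleC star_mult h(1) distrib_left distrib_right mult_scaleC_left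
          mult_scaleC_right mult.assoc scaleC_add_right scaleC_scaleC mult.commute[of s])
    also have "\<dots> = star c * (h * (h * c)) + (s + cnj s) *\<^sub>C (star c * (h * k c))
        + (cnj s * s) *\<^sub>C (star c * k (k c))"
      by (simp add: star_k hk scaleC_add_left)
    also have "\<dots> = star c * (h * (h * c)) + 0 *\<^sub>R (star c * (h * k c)) + 1 *\<^sub>R (star c * k (k c))"
      using s by (simp flip: scaleC_of_real)
    also have "\<dots> = star c * c"
      by (simp add: kk algebra_simps)
    finally have "(norm ?u)\<^sup>2 = (norm c)\<^sup>2"
      by (simp flip: cstar_identity)
    then show ?thesis by simp
  qed
  have contr: "norm (k c) \<le> norm c" for c
  proof -
    have "(h * c + \<i> *\<^sub>C k c) - (h * c + (- \<i>) *\<^sub>C k c) = (\<i> - (- \<i>)) *\<^sub>C k c"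
      by (simp only: scaleC_diff_left) simp
    then have "2 * norm (k c) = norm ((h * c + \<i> *\<^sub>C k c) - (h * c + (- \<i>) *\<^sub>C k c))"
      by (simp add: norm_scaleC norm_mult)
    also have "\<dots> \<le> norm c + norm c"
      using isom[of "\<i>" c] isom[of "- \<i>" c] norm_triangle_ineq4[of "h * c + \<i> *\<^sub>C k c" "h * c + (- \<i>) *\<^sub>C k c"]
      by simp
    finally show ?thesis by simp
  qed
  show ?thesis
    using contr[of b] contr[of "k b"] by (simp add: kk)
qed

lemma norm_scaled_minus_square_le:
  fixes h b :: "'a::cstar_algebra"
  assumes h: "star h = h" and t: "(norm h)\<^sup>2 < t"
  shows "norm (t *\<^sub>R b - h * h * b) \<le> t * norm b"
proof -
  have t0: "0 < t" using t by (meson le_less_trans zero_le_power2)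
  define g where "g = (1 / sqrt t) *\<^sub>R h"
  have "norm h < sqrt t"
    using t by (simp add: real_less_rsqrt)
  then have "star g = g" "norm g < 1"
    using h t0 by (auto simp: g_def star_scaleR)
  then have "norm (b - g * g * b) \<le> norm b"
    by (rule norm_one_minus_square_le)
  moreover have "t *\<^sub>R b - h * h * b = t *\<^sub>R (b - g * g * b)"
    using t0 by (simp add: g_def scaleR_diff_right)
  ultimately show ?thesis
    using t0 by simp
qed

text \<open>
  For a sum of squares \<open>s\<close> the element \<open>1 + s\<close> of the unitization has a contractive inverse,
  written \<open>1 - y\<close>. The reason is that \<open>t - s\<close> has norm at most \<open>t\<close> for large \<open>t\<close>, so that
  \<open>y\<close> is the fixed point of the contraction \<open>y \<mapsto> (s + (t - s) y) / (1 + t)\<close>.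
\<close>

lemma quasi_inverse:
  fixes h :: "'i \<Rightarrow> 'a::cstar_algebra"
  assumes I: "finite I" and h: "\<And>i. i \<in> I \<Longrightarrow> star (h i) = h i"
  defines "s \<equiv> \<Sum>i\<in>I. h i * h i"
  obtains y where "star y = y" "y + s * y = s" "\<And>z. s * z = z * s \<Longrightarrow> y * z = z * y"
    "\<And>b. norm (b - y * b) \<le> norm b"
proof -
  define t where "t = (\<Sum>i\<in>I. (norm (h i))\<^sup>2 + 1)"
  have t0: "0 \<le> t" unfolding t_def by (intro sum_nonneg) simp
  have ts: "norm (t *\<^sub>R b - s * b) \<le> t * norm b" for b
  proof -
    have "t *\<^sub>R b - s * b = (\<Sum>i\<in>I. ((norm (h i))\<^sup>2 + 1) *\<^sub>R b - h i * h i * b)"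
      by (simp add: t_def s_def sum_subtractf scaleR_sum_left sum_distrib_right)
    also have "norm \<dots> \<le> (\<Sum>i\<in>I. ((norm (h i))\<^sup>2 + 1) * norm b)"
      by (intro sum_norm_le norm_scaled_minus_square_le h) auto
    also have "\<dots> = t * norm b"
      by (simp add: t_def sum_distrib_right)
    finally show ?thesis .
  qed
  have s_sa: "star s = s"
  proof -
    have "star s = (\<Sum>i\<in>I. star (h i * h i))"
      unfolding s_def by (rule linear_sum[OF bounded_linear.linear[OF bounded_linear_star]])
    then show ?thesis by (simp add: s_def star_mult h)
  qed
  let ?S = "bicommutant_sa s"
  let ?f = "\<lambda>y. (1 / (1 + t)) *\<^sub>R (s + (t *\<^sub>R y - s * y))"
  have "\<exists>!y\<in>?S. ?f y = y"
  proof (rule Banach_fix[of ?S "t / (1 + t)"])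
    show "complete ?S"
      by (simp add: complete_eq_closed closed_bicommutant_sa)
    have "0 \<in> ?S"
      by (simp add: bicommutant_sa_def star_zero)
    then show "?S \<noteq> {}" by blast
    show "0 \<le> t / (1 + t)" "t / (1 + t) < 1" using t0 by auto
    show "?f ` ?S \<subseteq> ?S"
    proof safe
      fix y assume y: "y \<in> ?S"
      have "s * y * z = z * (s * y)" if "s * z = z * s" for z
      proof -
        have "y * z = z * y"
          using y that by (simp add: bicommutant_sa_def)
        with that show ?thesis
          by (rule mult_commute_mult)
      qed
      moreover have yc: "y * z = z * y" if "s * z = z * s" for z
        using y that by (simp add: bicommutant_sa_def)
      moreover have y_sa: "star y = y"
        using y by (simp add: bicommutant_sa_def)
      moreover have "star (s * y) = s * y"
        using yc[of s] by (simp add: star_mult s_sa y_sa)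
      ultimately show "?f y \<in> ?S"
        unfolding bicommutant_sa_def
        by (simp add: star_scaleR star_add star_diff s_sa distrib_left distrib_right
            left_diff_distrib right_diff_distrib)
    qed
    fix u v assume "u \<in> ?S" "v \<in> ?S"
    have "?f u - ?f v = (1 / (1 + t)) *\<^sub>R (t *\<^sub>R (u - v) - s * (u - v))"
      by (simp add: algebra_simps)
    then have "dist (?f u) (?f v) = (1 / (1 + t)) * norm (t *\<^sub>R (u - v) - s * (u - v))"
      using t0 by (simp add: dist_norm)
    also have "\<dots> \<le> (1 / (1 + t)) * (t * norm (u - v))"
      using t0 by (intro mult_left_mono ts) auto
    finally show "dist (?f u) (?f v) \<le> t / (1 + t) * dist u v"
      by (simp add: dist_norm)
  qed
  then obtain y where y: "y \<in> ?S" "?f y = y" by auto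
  have "(1 + t) *\<^sub>R y = (1 + t) *\<^sub>R ?f y"
    by (simp only: y(2))
  also have "\<dots> = s + (t *\<^sub>R y - s * y)"
    using t0 by simp
  finally have ys: "y + s * y = s"
    by (simp add: algebra_simps)
  have "norm (b - y * b) \<le> norm b" for b
  proof -
    let ?r = "b - y * b"
    have "?r + s * ?r = b + s * b - (y + s * y) * b"
      by (simp add: algebra_simps)
    then have "?r + s * ?r = b"
      by (simp add: ys)
    then have "(1 + t) *\<^sub>R ?r = b + (t *\<^sub>R ?r - s * ?r)"
      by (simp add: scaleR_add_left)
    then have "(1 + t) * norm ?r = norm (b + (t *\<^sub>R ?r - s * ?r))"
      using t0 by (metis abs_of_nonneg add_nonneg_nonneg norm_scaleR zero_le_one)
    also have "\<dots> \<le> norm b + t * norm ?r"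
      using ts by (intro norm_triangle_le) simp
    finally show ?thesis
      by (simp add: algebra_simps)
  qed
  moreover have "star y = y" "s * z = z * s \<Longrightarrow> y * z = z * y" for z
    using y(1) by (simp_all add: bicommutant_sa_def)
  ultimately show thesis
    using ys by (intro that[of y])
qed

section \<open>Positive functionals on squares\<close>

text \<open>
  Linear functionals, not assumed bounded, that are nonnegative on all \<open>b\<^sup>* b\<close>.
\<close>

definition positive_linear :: "('a::cstar_algebra \<Rightarrow> real) \<Rightarrow> bool"
  where "positive_linear F \<longleftrightarrow> linear F \<and> (\<forall>b. 0 \<le> F (star b * b))"

lemma positive_linear_contraction:
  assumes F: "positive_linear F" and w: "star w = w" "norm w < 1"
  shows "F (star b * w * b) \<le> F (star b * b)"
proof -
  interpret F: linear F using F by (simp add: positive_linear_def)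
  obtain w' where w': "star w' = w'" "w' + w' - w' * w' = w"
    using quasi_sqrt[OF w] by metis
  have "star (b - w' * b) * (b - w' * b) = star b * b - star b * (w' + w' - w' * w') * b"
    by (simp add: star_diff star_mult w'(1) algebra_simps)
  then have "0 \<le> F (star b * b - star b * w * b)"
    using F unfolding w'(2) positive_linear_def by metis
  then show ?thesis by (simp add: F.diff)
qed

lemma quasi_inverse_sum:
  fixes h :: "'i \<Rightarrow> 'a::cstar_algebra"
  assumes "finite I" and h: "\<And>i. i \<in> I \<Longrightarrow> star (h i) = h i"
    and s: "s = (\<Sum>i\<in>I. h i * h i)"
    and y: "star y = y" "y + s * y = s" "y * s = s * y"
  shows "s - y = star y * y + (\<Sum>i\<in>I. star (h i * y) * (h i * y))"
proof -
  have "(\<Sum>i\<in>I. star (h i * y) * (h i * y)) = (\<Sum>i\<in>I. y * (h i * h i) * y)"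
    by (intro sum.cong refl) (simp add: star_mult h y(1) mult.assoc)
  also have "\<dots> = y * s * y"
    by (simp add: s sum_distrib_left sum_distrib_right)
  finally have "star y * y + (\<Sum>i\<in>I. star (h i * y) * (h i * y)) = y * (y + s * y)"
    by (simp add: y(1) distrib_left mult.assoc)
  also have "\<dots> = s * y"
    by (simp only: y(2,3))
  also have "\<dots> = s - y"
    by (metis add_diff_cancel_left' y(2))
  finally show ?thesis by simp
qed

lemma quasi_inverse_square:
  fixes h :: "'a::cstar_algebra"
  assumes h: "star h = h" and y: "star y = y" "y + h * h * y = h * h" "y * h = h * y"
  shows "star (h - h * y) * (h - h * y) = y - y * y"
    and "star (h - h * y) * (h * h * (h * h)) * (h - h * y) = h * h - y - y * y"
proof -
  define x where "x = h * h"
  have xy: "x * y = x - y" using y(2) by (simp add: x_def eq_diff_eq add.commute)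
  have yx: "y * x = x - y"
  proof -
    have "x * y = y * x"
      unfolding x_def by (rule mult_commute_mult) (rule y(3)[symmetric])+
    then show ?thesis by (simp add: xy)
  qed
  have b: "star (h - h * y) = h - h * y"
    by (simp add: star_diff star_mult h y)
  have hh: "h * c * h = x * c" if "c * h = h * c" for c
    using that by (simp add: x_def mult.assoc)
  have "(h - h * y) * (h - h * y) = x - x * y - h * y * h + h * y * h * y"
    by (simp add: x_def algebra_simps)
  also have "\<dots> = x - x * y - x * y + x * y * y"
    using hh[OF y(3)] by simp
  also have "\<dots> = y - y * y"
    by (simp add: xy left_diff_distrib)
  finally have *: "(h - h * y) * (h - h * y) = y - y * y" .
  then show "star (h - h * y) * (h - h * y) = y - y * y"
    by (simp only: b)
  have bx: "x * x * (h - h * y) = (h - h * y) * (x * x)"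
  proof -
    have "h * y * x = h * (x * y)"
      by (simp only: mult.assoc xy yx)
    also have "\<dots> = x * (h * y)"
      by (simp add: x_def mult.assoc)
    finally have "x * (h - h * y) = (h - h * y) * x"
      by (simp add: algebra_simps) (simp add: x_def mult.assoc)
    then show ?thesis
      by (intro mult_commute_mult)
  qed
  have xyy: "x * (y * y) = x - y - y * y"
    by (simp add: xy left_diff_distrib flip: mult.assoc)
  have "(h - h * y) * (x * x) * (h - h * y) = x * (x * (y - y * y))"
    unfolding bx[symmetric] *[symmetric] by (simp only: mult.assoc)
  also have "\<dots> = x - y - y * y"
    by (simp add: right_diff_distrib xy xyy)
  finally show "star (h - h * y) * (h * h * (h * h)) * (h - h * y) = h * h - y - y * y"
    by (simp only: b flip: x_def)
qed

text \<open>
  Inversion reverses the order: if \<open>x \<le> s = x + d\<close>, then \<open>z = 1 - (1 + x)\<inverse>\<close> is below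
  \<open>y = 1 - (1 + s)\<inverse>\<close>, because \<open>y - z = p (1 + x) p + (1 - y) d (1 - y)\<close> with \<open>p = y - z\<close>.
\<close>

lemma quasi_inverse_diff:
  fixes s :: "'a::cstar_algebra"
  assumes sx: "s = x + d"
    and y: "y + s * y = s" "y * s = s * y"
    and z: "z + x * z = x" "z * x = x * z"
  shows "y - z = (y - z) * (y - z) + (y - z) * x * (y - z) + (d - d * y - y * d + y * d * y)"
proof -
  let ?p = "y - z"
  have p: "?p + x * ?p = d - d * y"
  proof -
    have "?p + x * ?p = (y + s * y) - d * y - (z + x * z)"
      by (simp add: sx algebra_simps)
    also have "\<dots> = s - d * y - x"
      by (simp only: y(1) z(1))
    finally show ?thesis by (simp add: sx)
  qed
  have zz: "z + z * x = x" using z by simp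
  have "?p * ?p + ?p * x * ?p + (d - d * y - y * d + y * d * y)
      = ?p * (?p + x * ?p) + (d - d * y) - y * (d - d * y)"
    by (simp add: algebra_simps)
  also have "\<dots> = (d - d * y) - z * (?p + x * ?p)"
    unfolding p by (simp add: algebra_simps)
  also have "\<dots> = (d - d * y) - (z + z * x) * ?p"
    by (simp add: algebra_simps)
  also have "\<dots> = ?p"
    unfolding zz p[symmetric] by simp
  finally show ?thesis by simp
qed

lemma quasi_inverse_single:
  fixes h :: "'a::cstar_algebra"
  assumes h: "star h = h"
  obtains y where "star y = y" "y + h * h * y = h * h"
    "\<And>z. h * h * z = z * (h * h) \<Longrightarrow> y * z = z * y" "\<And>b. norm (b - y * b) \<le> norm b"
proof -
  have sum: "(\<Sum>i\<in>{()}. h * h) = h * h" by simp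
  show thesis
    by (rule quasi_inverse[of "{()}" "\<lambda>_. h", unfolded sum]) (simp, rule h, rule that)
qed

text \<open>
  With \<open>s\<close> the sum of the squares, \<open>y = s (1 + s)\<inverse>\<close> is bounded, below \<open>s\<close>, and above half of each
  summand. It serves as a bounded substitute for the supremum of the summands. The bounds are only
  needed after applying positive functionals, so sums of elements \<open>b\<^sup>* b\<close> need not be of this form
  again.
\<close>

lemma bounded_majorant:
  fixes h :: "'i \<Rightarrow> 'a::cstar_algebra"
  assumes I: "finite I" and h: "\<And>i. i \<in> I \<Longrightarrow> star (h i) = h i" "\<And>i. i \<in> I \<Longrightarrow> norm (h i) < 1"
  obtains y where "star y = y" "norm y \<le> 2"
    "\<And>F. positive_linear F \<Longrightarrow> F y \<le> (\<Sum>i\<in>I. F (h i * h i))"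
    "\<And>F i. positive_linear F \<Longrightarrow> i \<in> I \<Longrightarrow> F (h i * h i) \<le> 2 * F y"
proof -
  define s where "s = (\<Sum>i\<in>I. h i * h i)"
  obtain y where y: "star y = y" "y + s * y = s" "\<And>z. s * z = z * s \<Longrightarrow> y * z = z * y"
    "\<And>b. norm (b - y * b) \<le> norm b"
    unfolding s_def by (rule quasi_inverse[OF I h(1)]) (assumption, rule that[unfolded s_def])
  have ys: "y * s = s * y" by (rule y(3)) simp
  have "norm (y * y) \<le> 2 * norm y"
    using y(4)[of y] norm_triangle_ineq4[of y "y - y * y"] by simp
  then have ny: "norm y \<le> 2"
    using cstar_identity[of y] y(1) by (cases "y = 0") (auto simp: power2_eq_square)
  show thesis
  proof (rule that[OF y(1) ny])
    fix F :: "'a \<Rightarrow> real" assume F: "positive_linear F"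
    interpret F: linear F using F by (simp add: positive_linear_def)
    have Fpos: "0 \<le> F (star b * b)" for b using F by (simp add: positive_linear_def)
    have "F (s - y) = F (star y * y) + (\<Sum>i\<in>I. F (star (h i * y) * (h i * y)))"
      using arg_cong[OF quasi_inverse_sum[OF I h(1) s_def y(1,2) ys], of F]
      by (simp add: F.add F.sum del: F.diff)
    then have "0 \<le> F (s - y)"
      by (simp add: Fpos sum_nonneg)
    then show "F y \<le> (\<Sum>i\<in>I. F (h i * h i))"
      by (simp add: F.diff s_def F.sum)
    fix i assume i: "i \<in> I"
    define x where "x = h i * h i"
    define d where "d = (\<Sum>j\<in>I - {i}. h j * h j)"
    have sx: "s = x + d"
      unfolding s_def x_def d_def by (rule sum.remove[OF I i])
    obtain z where z: "star z = z" "z + x * z = x" "\<And>c. x * c = c * x \<Longrightarrow> z * c = c * z"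
      unfolding x_def by (rule quasi_inverse_single[OF h(1)[OF i]]) (rule that[unfolded x_def])
    have zx: "z * x = x * z" and zh: "z * h i = h i * z"
      by (rule z(3), simp add: x_def mult.assoc)+
    have "0 \<le> F (y - z)"
    proof -
      have a: "(y - z) * (y - z) = star (y - z) * (y - z)"
        "(y - z) * x * (y - z) = star (h i * (y - z)) * (h i * (y - z))"
        by (simp_all add: star_diff star_mult y(1) z(1) h(1)[OF i] x_def mult.assoc)
      have "d - d * y - y * d + y * d * y
          = (\<Sum>j\<in>I - {i}. h j * h j - h j * h j * y - y * (h j * h j) + y * (h j * h j) * y)"
        by (simp add: d_def sum_distrib_left sum_distrib_right sum.distrib sum_subtractf)
      also have "\<dots> = (\<Sum>j\<in>I - {i}. star (h j - h j * y) * (h j - h j * y))"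
        by (intro sum.cong refl) (simp add: star_diff star_mult h(1) y(1) algebra_simps)
      finally have dd: "d - d * y - y * d + y * d * y
          = (\<Sum>j\<in>I - {i}. star (h j - h j * y) * (h j - h j * y))" .
      have "y - z = star (y - z) * (y - z) + star (h i * (y - z)) * (h i * (y - z))
          + (\<Sum>j\<in>I - {i}. star (h j - h j * y) * (h j - h j * y))"
        using quasi_inverse_diff[OF sx y(2) ys z(2) zx] unfolding a dd .
      from arg_cong[OF this, of F] have "F (y - z) = F (star (y - z) * (y - z)) + F (star (h i * (y - z)) * (h i * (y - z)))
          + (\<Sum>j\<in>I - {i}. F (star (h j - h j * y) * (h j - h j * y)))"
        by (simp only: F.add F.sum)
      then show ?thesis
        by (simp only: Fpos sum_nonneg add_nonneg_nonneg)
    qed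
    moreover have "F x \<le> 2 * F z"
    proof -
      have nx: "norm (x * x) < 1"
      proof -
        have "norm x < 1"
          using norm_mult_ineq[of "h i" "h i"] h(2)[OF i] mult_strict_mono[of "norm (h i)" 1 "norm (h i)" 1]
          by (simp add: x_def)
        then show ?thesis
          using norm_mult_ineq[of x x] mult_strict_mono[of "norm x" 1 "norm x" 1] by simp
      qed
      have "star (x * x) = x * x"
        by (simp add: x_def star_mult h(1)[OF i] mult.assoc)
      from positive_linear_contraction[OF F this nx, of "h i - h i * z"]
      have "F (x - z - z * z) \<le> F (z - z * z)"
        unfolding x_def quasi_inverse_square[OF h(1)[OF i] z(1) z(2)[unfolded x_def] zh] .
      then show ?thesis
        by (simp add: F.diff)
    qed
    ultimately show "F (h i * h i) \<le> 2 * F y"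
      by (simp add: F.diff x_def)
  qed
qed

text \<open>
  With \<open>y = v\<^sup>2 (v\<^sup>2 + t\<^sup>2)\<inverse>\<close> one has \<open>v y = ((v + y) / 2)\<^sup>2 - ((v - y) / 2)\<^sup>2\<close>, and \<open>v - v y\<close> is small.
  This approximate decomposition into a difference of two squares, each controlled by \<open>v\<^sup>2\<close>,
  takes the place of the Jordan decomposition into positive and negative parts.
\<close>

lemma approximate_difference_of_squares:
  fixes v :: "'a::cstar_algebra"
  assumes v: "star v = v" "norm v \<le> 1" and t: "0 < t"
  obtains a b where "star a = a" "star b = b" "norm a \<le> 3/2" "norm b \<le> 3/2"
    "norm (v - (a * a - b * b)) \<le> 2 * t"
    "\<And>F. positive_linear F \<Longrightarrow> F (a * a) \<le> (1 + 1 / t\<^sup>2) * F (v * v)"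
    "\<And>F. positive_linear F \<Longrightarrow> F (b * b) \<le> (1 + 1 / t\<^sup>2) * F (v * v)"
proof -
  define h where "h = (1 / t) *\<^sub>R v"
  define s where "s = h * h"
  have h: "star h = h" by (simp add: h_def star_scaleR v)
  have v_h: "v = t *\<^sub>R h" using t by (simp add: h_def)
  obtain y where y: "star y = y" "y + s * y = s" "\<And>z. s * z = z * s \<Longrightarrow> y * z = z * y"
    "\<And>b. norm (b - y * b) \<le> norm b"
    unfolding s_def by (rule quasi_inverse_single[OF h]) (rule that[unfolded s_def])
  have ys: "y * s = s * y" and yh: "y * h = h * y"
    by (rule y(3), simp add: s_def mult.assoc)+
  have "norm (y * y) \<le> 2 * norm y"
    using y(4)[of y] norm_triangle_ineq4[of y "y - y * y"] by simp
  then have ny: "norm y \<le> 2"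
    using cstar_identity[of y] y(1) by (cases "y = 0") (auto simp: power2_eq_square)
  note sq = quasi_inverse_square(1)[OF h y(1) y(2)[unfolded s_def] yh]
  have "(norm (h - h * y))\<^sup>2 \<le> 2"
    unfolding cstar_identity[symmetric] sq using y(4)[of y] ny by simp
  also have "\<dots> \<le> 2\<^sup>2" by simp
  finally have "norm (h - h * y) \<le> 2"
    by (rule power2_le_imp_le) simp
  then have nv: "norm (v - v * y) \<le> 2 * t"
    using t by (simp add: v_h flip: scaleR_diff_right)
  have yv: "y * v = v * y"
    by (simp add: v_h yh)
  have Fy: "F (y * y) \<le> F (v * v) / t\<^sup>2" and F0: "0 \<le> F (v * v)" "0 \<le> F (y * y)"
    if F: "positive_linear F" for F
  proof -
    interpret F: linear F using F by (simp add: positive_linear_def)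
    have Fpos: "0 \<le> F (star b * b)" for b using F by (simp add: positive_linear_def)
    show "0 \<le> F (v * v)" "0 \<le> F (y * y)" using Fpos[of v] Fpos[of y] by (simp_all add: v(1) y(1))
    have "0 \<le> F (y - y * y)" unfolding sq[symmetric] by (rule Fpos)
    moreover have "0 \<le> F (s - y)"
      using quasi_inverse_sum[of "{()}" "\<lambda>_. h", OF _ _ _ y(1,2) ys] h Fpos
      by (simp add: s_def F.add del: F.diff)
    moreover have "F s = F (v * v) / t\<^sup>2"
      by (simp add: s_def h_def F.scaleR power2_eq_square)
    ultimately show "F (y * y) \<le> F (v * v) / t\<^sup>2"
      by (simp add: F.diff)
  qed
  define a where "a = (1/2) *\<^sub>R (v + y)"
  define b where "b = (1/2) *\<^sub>R (v - y)"
  have ab: "a * a = (1/4) *\<^sub>R (v * v + y * y) + (1/2) *\<^sub>R (v * y)"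
    "b * b = (1/4) *\<^sub>R (v * v + y * y) - (1/2) *\<^sub>R (v * y)"
    by (simp_all add: a_def b_def algebra_simps yv flip: scaleR_add_left)
  have sum_sq: "a * a + b * b = (1/2) *\<^sub>R (v * v + y * y)"
    by (simp add: ab flip: scaleR_add_left)
  have sa: "star a = a" "star b = b"
    by (simp_all add: a_def b_def star_scaleR star_add star_diff v(1) y(1))
  have est: "F (a * a) \<le> (1 + 1 / t\<^sup>2) * F (v * v) \<and> F (b * b) \<le> (1 + 1 / t\<^sup>2) * F (v * v)"
    if F: "positive_linear F" for F
  proof -
    interpret F: linear F using F by (simp add: positive_linear_def)
    have "0 \<le> F (a * a)" "0 \<le> F (b * b)"
      using F sa unfolding positive_linear_def by metis+
    moreover have "F (a * a) + F (b * b) = (F (v * v) + F (y * y)) / 2"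
      using arg_cong[OF sum_sq, of F] by (simp add: F.add F.scaleR)
    ultimately show ?thesis
      using Fy[OF F] F0[OF F] by (simp add: algebra_simps)
  qed
  show thesis
  proof (rule that[OF sa])
    show "norm a \<le> 3/2" "norm b \<le> 3/2"
      using norm_triangle_ineq[of v y] norm_triangle_ineq4[of v y] v ny by (simp_all add: a_def b_def)
    have "a * a - b * b = v * y"
      by (simp add: ab flip: scaleR_add_left)
    then show "norm (v - (a * a - b * b)) \<le> 2 * t"
      using nv by simp
  qed (use est in auto)
qed

section \<open>Functionals on the self-adjoint part\<close>

text \<open>The Jordan product, which makes sense inside the self-adjoint part.\<close>

lift_definition jordan :: "'a::cstar_algebra self_adjoint \<Rightarrow> 'a self_adjoint \<Rightarrow> 'a self_adjoint"
  is "\<lambda>v w. (1/2) *\<^sub>R (v * w + w * v)"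
  by (simp add: star_scaleR star_add star_mult add.commute)

abbreviation sqr :: "'a::cstar_algebra self_adjoint \<Rightarrow> 'a self_adjoint"
  where "sqr v \<equiv> jordan v v"

text \<open>The projection of the algebra onto its self-adjoint part.\<close>

lift_definition real_part :: "'a::cstar_algebra \<Rightarrow> 'a self_adjoint"
  is "\<lambda>a. (1/2) *\<^sub>R (a + star a)"
  by (simp add: star_scaleR star_add star_star add.commute)

text \<open>The positive elements of the dual of the self-adjoint part.\<close>

definition cone_functional :: "('a::cstar_algebra self_adjoint \<Rightarrow>\<^sub>L real) \<Rightarrow> bool"
  where "cone_functional f \<longleftrightarrow> positive_operator self_adjoint_cone {0..} f"

lemma sa_elem_sqr: "sa_elem (sqr v) = sa_elem v * sa_elem v"
  by transfer (simp flip: scaleR_2)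

lemma norm_jordan_le: "norm (jordan v w) \<le> norm v * norm w"
proof transfer
  fix v w :: 'a
  have "norm (v * w + w * v) \<le> norm v * norm w + norm w * norm v"
    by (intro norm_triangle_le add_mono norm_mult_ineq)
  then show "norm ((1 / 2) *\<^sub>R (v * w + w * v)) \<le> norm v * norm w"
    by simp
qed

lemma bounded_bilinear_jordan: "bounded_bilinear jordan"
proof
  show "\<exists>K. \<forall>v w::'a self_adjoint. norm (jordan v w) \<le> norm v * norm w * K"
    by (rule exI[of _ 1]) (simp add: norm_jordan_le)
qed (transfer; simp add: algebra_simps)+

interpretation jordan: bounded_bilinear jordan
  by (rule bounded_bilinear_jordan)

lemma jordan_commute: "jordan v w = jordan w v"
  by transfer (simp add: add.commute)

lemma sqr_add: "sqr (v + w) = sqr v + sqr w + 2 *\<^sub>R jordan v w"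
  by (simp add: jordan.add_left jordan.add_right jordan_commute[of w v] scaleR_2)

lemma sqr_diff: "sqr (v - w) = sqr v + sqr w - 2 *\<^sub>R jordan v w"
  by (simp add: jordan.diff_left jordan.diff_right jordan_commute[of w v] scaleR_2)

lemma sqr_scaleR: "sqr (c *\<^sub>R v) = (c * c) *\<^sub>R sqr v"
  by (simp add: jordan.scaleR_left jordan.scaleR_right)

lemma sqr_in_cone: "sqr v \<in> self_adjoint_cone"
  using sa_elem[of v] by (auto simp: self_adjoint_cone_def positive_elements_def sa_elem_sqr intro!: exI[of _ "sa_elem v"])

lemma cone_functional_sqr: "cone_functional f \<Longrightarrow> 0 \<le> f (sqr v)"
  using sqr_in_cone[of v] by (simp add: cone_functional_def positive_operator_def)

lemma real_part_sa_elem: "real_part (sa_elem v) = v"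
proof transfer
  fix v :: 'a assume "star v = v"
  then show "(1 / 2) *\<^sub>R (v + star v) = v" by (simp flip: scaleR_2)
qed

lemma norm_real_part_le: "norm (real_part a) \<le> norm a"
proof transfer
  fix v :: 'a
  have "norm (v + star v) \<le> norm v + norm v"
    using norm_triangle_ineq[of v "star v"] by (simp add: norm_star)
  then show "norm ((1 / 2) *\<^sub>R (v + star v)) \<le> norm v" by simp
qed

lemma bounded_linear_real_part: "bounded_linear (real_part :: 'a::cstar_algebra \<Rightarrow> _)"
proof (rule bounded_linear_intro[of _ 1])
  fix v w :: 'a and r :: real
  show "real_part (v + w) = real_part v + real_part w"
    by transfer (simp add: star_add algebra_simps)
  show "real_part (r *\<^sub>R v) = r *\<^sub>R real_part v"
    by transfer (simp add: star_scaleR algebra_simps)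
  show "norm (real_part v) \<le> norm v * 1"
    by (simp add: norm_real_part_le)
qed

lemma positive_linear_cone_functional:
  assumes "cone_functional f"
  shows "positive_linear (\<lambda>a. f (real_part a))"
  unfolding positive_linear_def
proof (intro conjI allI)
  show "linear (\<lambda>a. f (real_part a))"
    by (rule bounded_linear.linear) (intro bounded_linear_compose[OF blinfun.bounded_linear_right bounded_linear_real_part])
  fix b :: 'a
  have "sa_elem (real_part (star b * b)) = star b * b"
    by (simp add: real_part.rep_eq star_mult star_star flip: scaleR_2)
  then have "real_part (star b * b) \<in> self_adjoint_cone"
    by (auto simp: self_adjoint_cone_def positive_elements_def)
  then show "0 \<le> f (real_part (star b * b))"
    using assms by (simp add: cone_functional_def positive_operator_def)
qed

lemma sa_elem_exists: "star a = a \<Longrightarrow> \<exists>v. sa_elem v = a"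
  by (rule exI[of _ "Abs_self_adjoint a"]) (simp add: Abs_self_adjoint_inverse)

lemma sqr_bounded_majorant:
  fixes h :: "'i \<Rightarrow> 'a::cstar_algebra self_adjoint"
  assumes I: "finite I" and h: "\<And>i. i \<in> I \<Longrightarrow> norm (h i) < 1"
  obtains y where "norm y \<le> 2"
    "\<And>f. cone_functional f \<Longrightarrow> f y \<le> (\<Sum>i\<in>I. f (sqr (h i)))"
    "\<And>f i. cone_functional f \<Longrightarrow> i \<in> I \<Longrightarrow> f (sqr (h i)) \<le> 2 * f y"
proof -
  have 1: "star (sa_elem (h i)) = sa_elem (h i)" if "i \<in> I" for i
    using sa_elem[of "h i"] by simp
  have 2: "norm (sa_elem (h i)) < 1" if "i \<in> I" for i
    using h[OF that] by (simp add: norm_self_adjoint.rep_eq)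
  obtain y where y: "star y = y" "norm y \<le> 2"
    "\<And>F. positive_linear F \<Longrightarrow> F y \<le> (\<Sum>i\<in>I. F (sa_elem (h i) * sa_elem (h i)))"
    "\<And>F i. positive_linear F \<Longrightarrow> i \<in> I \<Longrightarrow> F (sa_elem (h i) * sa_elem (h i)) \<le> 2 * F y"
    by (rule bounded_majorant[OF I 1 2]) (assumption, assumption, rule that)
  obtain v where v: "sa_elem v = y" using sa_elem_exists[OF y(1)] by blast
  show thesis
  proof (rule that[of v])
    show "norm v \<le> 2" using y(2) v by (simp add: norm_self_adjoint.rep_eq)
    fix f :: "'a self_adjoint \<Rightarrow>\<^sub>L real" assume f: "cone_functional f"
    note F = positive_linear_cone_functional[OF f]
    show "f v \<le> (\<Sum>i\<in>I. f (sqr (h i)))"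
      using y(3)[OF F] by (simp add: real_part_sa_elem flip: v sa_elem_sqr)
    fix i assume "i \<in> I"
    from y(4)[OF F this] show "f (sqr (h i)) \<le> 2 * f v"
      by (simp add: real_part_sa_elem flip: v sa_elem_sqr)
  qed
qed

lemma sqr_approximate_difference:
  fixes v :: "'a::cstar_algebra self_adjoint"
  assumes v: "norm v \<le> 1" and t: "0 < t"
  obtains a b where "norm a \<le> 3/2" "norm b \<le> 3/2" "norm (v - (sqr a - sqr b)) \<le> 2 * t"
    "\<And>f. cone_functional f \<Longrightarrow> f (sqr a) \<le> (1 + 1 / t\<^sup>2) * f (sqr v)"
    "\<And>f. cone_functional f \<Longrightarrow> f (sqr b) \<le> (1 + 1 / t\<^sup>2) * f (sqr v)"
proof -
  have 1: "star (sa_elem v) = sa_elem v" using sa_elem[of v] by simp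
  have 2: "norm (sa_elem v) \<le> 1" using v by (simp add: norm_self_adjoint.rep_eq)
  obtain a b where ab: "star a = a" "star b = b" "norm a \<le> 3/2" "norm b \<le> 3/2"
    "norm (sa_elem v - (a * a - b * b)) \<le> 2 * t"
    "\<And>F. positive_linear F \<Longrightarrow> F (a * a) \<le> (1 + 1 / t\<^sup>2) * F (sa_elem v * sa_elem v)"
    "\<And>F. positive_linear F \<Longrightarrow> F (b * b) \<le> (1 + 1 / t\<^sup>2) * F (sa_elem v * sa_elem v)"
    by (rule approximate_difference_of_squares[OF 1 2 t]) (rule that)
  obtain a' b' where ab': "sa_elem a' = a" "sa_elem b' = b"
    using sa_elem_exists ab(1,2) by metis
  show thesis
  proof (rule that[of a' b'])
    show "norm a' \<le> 3/2" "norm b' \<le> 3/2"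
      using ab ab' by (simp_all add: norm_self_adjoint.rep_eq)
    show "norm (v - (sqr a' - sqr b')) \<le> 2 * t"
      using ab(5) ab' by (simp add: norm_self_adjoint.rep_eq minus_self_adjoint.rep_eq sa_elem_sqr)
    fix f :: "'a self_adjoint \<Rightarrow>\<^sub>L real" assume f: "cone_functional f"
    note F = positive_linear_cone_functional[OF f]
    show "f (sqr a') \<le> (1 + 1 / t\<^sup>2) * f (sqr v)" "f (sqr b') \<le> (1 + 1 / t\<^sup>2) * f (sqr v)"
      using ab(6)[OF F] ab(7)[OF F] by (simp_all add: real_part_sa_elem flip: ab' sa_elem_sqr)
  qed
qed

text \<open>
  If \<open>R\<close> is small on the squares on which \<open>\<phi>\<close> is small, then \<open>R v\<close> is small whenever \<open>\<phi> (v\<^sup>2)\<close> is.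
\<close>

lemma bound_from_squares:
  fixes R :: "'a::cstar_algebra self_adjoint \<Rightarrow>\<^sub>L 'z::real_normed_vector"
  assumes \<phi>: "cone_functional \<phi>"
    and R: "\<And>h. norm h < 1 \<Longrightarrow> \<phi> (sqr h) \<le> \<delta> \<Longrightarrow> norm (R (sqr h)) \<le> \<epsilon>"
    and v: "norm v \<le> 1" and t: "0 < t" and \<phi>v: "(1 + 1 / t\<^sup>2) * \<phi> (sqr v) \<le> \<delta>"
  shows "norm (R v) \<le> 8 * \<epsilon> + 2 * t * norm R"
proof -
  obtain a b where ab: "norm a \<le> 3/2" "norm b \<le> 3/2" "norm (v - (sqr a - sqr b)) \<le> 2 * t"
    "\<And>f. cone_functional f \<Longrightarrow> f (sqr a) \<le> (1 + 1 / t\<^sup>2) * f (sqr v)"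
    "\<And>f. cone_functional f \<Longrightarrow> f (sqr b) \<le> (1 + 1 / t\<^sup>2) * f (sqr v)"
    by (rule sqr_approximate_difference[OF v t]) (rule that)
  have *: "norm (R (sqr c)) \<le> 4 * \<epsilon>" if c: "norm c \<le> 3/2" "\<phi> (sqr c) \<le> (1 + 1 / t\<^sup>2) * \<phi> (sqr v)" for c
  proof -
    \<comment> \<open>halving brings \<open>c\<close>, of norm at most \<open>3/2\<close>, into the open unit ball\<close>
    let ?h = "(1/2) *\<^sub>R c"
    have "norm (R (sqr ?h)) \<le> \<epsilon>"
    proof (rule R)
      show "norm ?h < 1" using c by simp
      have "\<phi> (sqr ?h) \<le> \<phi> (sqr c)"
        using cone_functional_sqr[OF \<phi>, of c] by (simp add: sqr_scaleR blinfun.scaleR_right)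
      then show "\<phi> (sqr ?h) \<le> \<delta>" using c \<phi>v by linarith
    qed
    then show ?thesis
      by (simp add: sqr_scaleR blinfun.scaleR_right)
  qed
  have "norm (R (v - (sqr a - sqr b))) \<le> norm R * (2 * t)"
    by (rule order_trans[OF norm_blinfun mult_left_mono[OF ab(3) norm_ge_zero]])
  moreover have "R v = R (v - (sqr a - sqr b)) + (R (sqr a) - R (sqr b))"
    by (simp add: blinfun.diff_right)
  then have "norm (R v) \<le> norm (R (v - (sqr a - sqr b))) + norm (R (sqr a) - R (sqr b))"
    by (simp only: norm_triangle_ineq)
  moreover have "norm (R (sqr a) - R (sqr b)) \<le> norm (R (sqr a)) + norm (R (sqr b))"
    by (rule norm_triangle_ineq4)
  ultimately show ?thesis
    using *[OF ab(1) ab(4)[OF \<phi>]] *[OF ab(2) ab(5)[OF \<phi>]] by (simp add: mult.commute[of "norm R"])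
qed

section \<open>Filters, weak topology and weakly compact operators\<close>

text \<open>
  Compactness is used through refinements of filters, which play the role of subnets.
\<close>

lemma compact_refinement:
  assumes C: "compact C" and F: "F \<noteq> bot" "eventually (\<lambda>i. u i \<in> C) F"
  obtains G x where "G \<le> F" "G \<noteq> bot" "x \<in> C" "(u \<longlongrightarrow> x) G"
proof -
  have "filtermap u F \<noteq> bot" "eventually (\<lambda>x. x \<in> C) (filtermap u F)"
    using F by (simp_all add: filtermap_bot_iff eventually_filtermap)
  then obtain x where x: "x \<in> C" "inf (nhds x) (filtermap u F) \<noteq> bot"
    using C unfolding compact_filter by blast
  let ?G = "inf F (filtercomap u (nhds x))"
  have "?G \<noteq> bot"
  proof
    assume "?G = bot"
    then have "eventually (\<lambda>_. False) ?G" by simp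
    then obtain P Q where PQ: "eventually P F" "eventually Q (nhds x)" "\<And>i. P i \<Longrightarrow> \<not> Q (u i)"
      unfolding eventually_inf eventually_filtercomap by blast
    have "eventually (\<lambda>z. \<not> Q z) (filtermap u F)"
      unfolding eventually_filtermap using PQ(1) by (rule eventually_mono) (rule PQ(3))
    with PQ(2) have "eventually (\<lambda>_. False) (inf (nhds x) (filtermap u F))"
      unfolding eventually_inf by blast
    with x(2) show False by (simp add: eventually_False)
  qed
  moreover have "(u \<longlongrightarrow> x) ?G"
    unfolding filterlim_iff_le_filtercomap by simp
  ultimately show thesis
    using x(1) that by (meson inf_le1)
qed

lemma compact_box: "compact (PiE UNIV (\<lambda>j. {- c j .. c j :: real}))"
  using compactin_PiE[of "\<lambda>_. euclidean" UNIV "\<lambda>j. {- c j .. c j}"]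
  by (simp add: euclidean_product_topology)

lemma closed_box: "closed (PiE UNIV (\<lambda>j. {- c j .. c j :: real}))"
proof -
  have "PiE UNIV (\<lambda>j. {- c j .. c j}) = (\<Inter>j. {x. - c j \<le> x j} \<inter> {x. x j \<le> c j})"
    by (auto simp: PiE_def Pi_def)
  moreover have "closed {x. - c j \<le> x j}" "closed {x. x j \<le> c j}" for j
    by (intro closed_Collect_le continuous_intros continuous_on_product_coordinates)+
  ultimately show ?thesis
    by (auto intro!: closed_Int)
qed

lemma tendsto_coordinate:
  fixes u :: "'i \<Rightarrow> 'j \<Rightarrow> real"
  shows "(u \<longlongrightarrow> x) G \<Longrightarrow> ((\<lambda>i. u i j) \<longlongrightarrow> x j) G"
  using continuous_on_tendsto_compose[OF continuous_on_product_coordinates, of u x G j] by simp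

lemma pointwise_refinement:
  fixes u :: "'i \<Rightarrow> 'j \<Rightarrow> real"
  assumes F: "F \<noteq> bot" "eventually (\<lambda>i. \<forall>j. \<bar>u i j\<bar> \<le> c j) F"
  obtains G L where "G \<le> F" "G \<noteq> bot" "\<And>j. ((\<lambda>i. u i j) \<longlongrightarrow> L j) G"
proof -
  have "eventually (\<lambda>i. u i \<in> PiE UNIV (\<lambda>j. {- c j .. c j})) F"
    using F(2) by (rule eventually_mono) (auto simp: abs_le_iff minus_le_iff)
  from compact_refinement[OF compact_box F(1) this] that show thesis
    by (metis tendsto_coordinate)
qed

text \<open>The Banach--Alaoglu theorem.\<close>

lemma bounded_functionals_refinement:
  fixes \<eta> :: "'i \<Rightarrow> 'z::real_normed_vector \<Rightarrow>\<^sub>L real"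
  assumes F: "F \<noteq> bot" "eventually (\<lambda>i. norm (\<eta> i) \<le> c) F"
  obtains G L where "G \<le> F" "G \<noteq> bot" "\<And>z. ((\<lambda>i. \<eta> i z) \<longlongrightarrow> blinfun_apply L z) G"
    "norm L \<le> c"
proof -
  have "eventually (\<lambda>i. \<forall>z. \<bar>\<eta> i z\<bar> \<le> c * norm z) F"
    using F(2)
  proof (rule eventually_mono, intro allI)
    fix i z assume "norm (\<eta> i) \<le> c"
    then show "\<bar>\<eta> i z\<bar> \<le> c * norm z"
      using norm_blinfun[of "\<eta> i" z] mult_right_mono[of "norm (\<eta> i)" c "norm z"] by simp
  qed
  note bd = this
  from pointwise_refinement[OF F(1) bd]
  obtain G L where G: "G \<le> F" "G \<noteq> bot" "\<And>z. ((\<lambda>i. \<eta> i z) \<longlongrightarrow> L z) G"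
    by metis
  have L_le: "\<bar>L x\<bar> \<le> c * norm x" for x
  proof -
    have "eventually (\<lambda>i. \<bar>\<eta> i x\<bar> \<le> c * norm x) G"
      using filter_leD[OF G(1) bd] by (rule eventually_mono) simp
    from tendsto_upperbound[OF tendsto_rabs[OF G(3)] this G(2)] show ?thesis .
  qed
  have bl: "bounded_linear L"
  proof (rule bounded_linear_intro[of _ c])
    fix x y :: 'z and r :: real
    show "L (x + y) = L x + L y"
      using tendsto_unique[OF G(2) G(3)[of "x + y"]] tendsto_add[OF G(3) G(3), of x y]
      by (simp add: blinfun.add_right)
    show "L (r *\<^sub>R x) = r *\<^sub>R L x"
      using tendsto_unique[OF G(2) G(3)[of "r *\<^sub>R x"]] tendsto_scaleR[OF tendsto_const G(3), of r x]
      by (simp add: blinfun.scaleR_right)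
    show "norm (L x) \<le> norm x * c"
      using L_le[of x] by (simp add: mult.commute)
  qed
  obtain i where "norm (\<eta> i) \<le> c"
    using eventually_happens'[OF F] by blast
  then have "0 \<le> c"
    using norm_ge_zero order_trans by blast
  then have "norm (Blinfun L) \<le> c"
    by (rule norm_blinfun_bound) (simp add: bounded_linear_Blinfun_apply[OF bl] L_le)
  then show thesis
    using that[OF G(1,2), of "Blinfun L"] G(3) by (simp add: bounded_linear_Blinfun_apply[OF bl])
qed

text \<open>
  The family of all values of bounded functionals at a point. The weak topology is the one induced
  by this map from the product topology.
\<close>

definition weak_coordinates :: "'y::real_normed_vector \<Rightarrow> ('y \<Rightarrow>\<^sub>L real) \<Rightarrow> real"
  where "weak_coordinates z = (\<lambda>e. e z)"

lemma topspace_weak_topology: "topspace (weak_topology :: 'y::real_normed_vector topology) = UNIV"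
proof -
  have "UNIV = blinfun_apply (0 :: 'y \<Rightarrow>\<^sub>L real) -` UNIV" by simp
  then have "UNIV \<in> {blinfun_apply f -` U | (f :: 'y \<Rightarrow>\<^sub>L real) U. open U}"
    using open_UNIV by blast
  then show ?thesis
    unfolding weak_topology_def topology_generated_by_topspace by blast
qed

lemma continuous_map_weak_coordinates: "continuous_map weak_topology euclidean weak_coordinates"
proof -
  have "continuous_map weak_topology euclidean (\<lambda>z. weak_coordinates z e)" for e :: "'a \<Rightarrow>\<^sub>L real"
    unfolding continuous_map_def
  proof (intro conjI allI impI)
    fix U :: "real set" assume "openin euclidean U"
    then have "openin weak_topology (blinfun_apply e -` U)"
      unfolding weak_topology_def by (intro topology_generated_by_Basis) auto
    then show "openin weak_topology {x \<in> topspace weak_topology. weak_coordinates x e \<in> U}"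
      by (simp add: topspace_weak_topology weak_coordinates_def vimage_def)
  qed simp
  then show ?thesis
    by (simp add: continuous_map_componentwise_UNIV flip: euclidean_product_topology)
qed

lemma openin_weak_topologyD:
  assumes "openin (weak_topology :: 'y::real_normed_vector topology) U"
  shows "\<exists>V. open V \<and> U = weak_coordinates -` V"
  using assms unfolding weak_topology_def openin_topology_generated_by_iff
proof induction
  case Empty
  show ?case by (rule exI[of _ "{}"]) simp
next
  case (Int a b)
  then obtain V W where "open V" "a = weak_coordinates -` V" "open W" "b = weak_coordinates -` W" by blast
  then show ?case by (intro exI[of _ "V \<inter> W"]) auto
next
  case (UN K)
  then obtain V where "\<And>k. k \<in> K \<Longrightarrow> open (V k) \<and> k = weak_coordinates -` V k" by metis
  then show ?case by (intro exI[of _ "\<Union>k\<in>K. V k"]) auto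
next
  case (Basis s)
  then obtain e U where "s = blinfun_apply (e :: 'y \<Rightarrow>\<^sub>L real) -` U" "open U" by auto
  moreover have "open ((\<lambda>x::('y \<Rightarrow>\<^sub>L real) \<Rightarrow> real. x e) -` U)"
    using \<open>open U\<close> continuous_on_product_coordinates by (rule open_vimage)
  ultimately show ?case
    by (intro exI[of _ "(\<lambda>x. x e) -` U"]) (auto simp: weak_coordinates_def)
qed

lemma weakly_compact_refinement:
  fixes S :: "'x::real_normed_vector \<Rightarrow>\<^sub>L 'y::real_normed_vector"
  assumes S: "weakly_compact_operator S" and F: "F \<noteq> bot"
    and ev: "eventually (\<lambda>z. z \<in> weak_topology closure_of (S ` cball 0 1)) F"
  obtains G w where "G \<le> F" "G \<noteq> bot" "w \<in> weak_topology closure_of (S ` cball 0 1)"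
    "\<And>e :: 'y \<Rightarrow>\<^sub>L real. (e \<longlongrightarrow> e w) G"
proof -
  let ?K = "weak_topology closure_of (blinfun_apply S ` cball 0 1)"
  have "compact (weak_coordinates ` ?K)"
    using image_compactin[OF S[unfolded weakly_compact_operator_def] continuous_map_weak_coordinates]
    by simp
  moreover have "eventually (\<lambda>z. weak_coordinates z \<in> weak_coordinates ` ?K) F"
    using ev by (rule eventually_mono) blast
  ultimately obtain G x where G: "G \<le> F" "G \<noteq> bot" "x \<in> weak_coordinates ` ?K" "(weak_coordinates \<longlongrightarrow> x) G"
    using compact_refinement[OF _ F] by metis
  then obtain w where w: "w \<in> ?K" "x = weak_coordinates w" by blast
  have "(e \<longlongrightarrow> e w) G" for e :: "'y \<Rightarrow>\<^sub>L real"
    using tendsto_coordinate[OF G(4), of e] by (simp add: w weak_coordinates_def)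
  with G w that show thesis by blast
qed

lemma subset_weak_closure: "K \<subseteq> weak_topology closure_of K"
  by (rule closure_of_subset) (simp add: topspace_weak_topology)

text \<open>
  For weak compactness it suffices that every pointwise limit, as a function on the dual, of points
  in the image of the ball is the evaluation at some point of the space.
\<close>

lemma weakly_compactI:
  fixes T :: "'x::real_normed_vector \<Rightarrow>\<^sub>L 'y::real_normed_vector"
  assumes lim: "\<And>F (\<Psi> :: ('y \<Rightarrow>\<^sub>L real) \<Rightarrow> real). F \<noteq> bot \<Longrightarrow> eventually (\<lambda>x. norm x \<le> 1) F \<Longrightarrow>
      (\<And>e. ((\<lambda>x. blinfun_apply e (T x)) \<longlongrightarrow> \<Psi> e) F) \<Longrightarrow> \<exists>w. \<forall>e. \<Psi> e = blinfun_apply e w"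
  shows "weakly_compact_operator T"
proof -
  let ?K = "blinfun_apply T ` cball 0 1"
  let ?C = "closure (weak_coordinates ` ?K)"
  let ?B = "PiE UNIV (\<lambda>e :: 'y \<Rightarrow>\<^sub>L real. {- (norm e * norm T) .. norm e * norm T})"
  have "weak_coordinates ` ?K \<subseteq> ?B"
  proof clarsimp
    fix x :: 'x assume x: "norm x \<le> 1"
    have "\<bar>e (T x)\<bar> \<le> norm e * norm T" for e :: "'y \<Rightarrow>\<^sub>L real"
    proof -
      have "\<bar>e (T x)\<bar> \<le> norm e * norm (T x)"
        using norm_blinfun[of e "T x"] by simp
      also have "norm (T x) \<le> norm T"
        using norm_blinfun[of T x] x mult_left_le[of "norm x" "norm T"] by simp
      finally show ?thesis by (simp add: mult_left_mono)
    qed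
    then show "weak_coordinates (T x) \<in> ?B"
      by (auto simp: weak_coordinates_def abs_le_iff minus_le_iff)
  qed
  then have CB: "?C \<subseteq> ?B"
    by (rule closure_minimal) (rule closed_box)
  have "compact (?B \<inter> ?C)"
    by (rule compact_Int_closed[OF compact_box closed_closure])
  then have compC: "compact ?C"
    by (simp only: inf_absorb2[OF CB])
  have rangeC: "\<exists>w. \<Psi> = weak_coordinates w" if \<Psi>: "\<Psi> \<in> ?C" for \<Psi>
  proof -
    let ?u = "\<lambda>x. weak_coordinates (T x)"
    let ?F = "inf (filtercomap ?u (nhds \<Psi>)) (principal (cball 0 1))"
    have "?F \<noteq> bot"
    proof
      assume "?F = bot"
      then have "eventually (\<lambda>_. False) ?F" by simp
      then have "\<exists>Q. eventually Q (nhds \<Psi>) \<and> (\<forall>x. Q (?u x) \<longrightarrow> x \<notin> cball 0 1)"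
        unfolding eventually_inf_principal eventually_filtercomap by auto
      then obtain V where V: "open V" "\<Psi> \<in> V" "\<And>x. ?u x \<in> V \<Longrightarrow> x \<notin> cball 0 1"
        unfolding eventually_nhds by metis
      then have "V \<inter> weak_coordinates ` ?K = {}" by auto
      then have "V \<inter> ?C = {}" using V(1) by (simp add: open_Int_closure_eq_empty)
      with V(2) \<Psi> show False by blast
    qed
    moreover have "eventually (\<lambda>x. norm x \<le> 1) ?F"
      by (simp add: eventually_inf_principal)
    moreover have "((\<lambda>x. e (T x)) \<longlongrightarrow> \<Psi> e) ?F" for e :: "'y \<Rightarrow>\<^sub>L real"
    proof -
      have "(?u \<longlongrightarrow> \<Psi>) ?F"
        unfolding filterlim_iff_le_filtercomap by simp
      from tendsto_coordinate[OF this, of e] show ?thesis by (simp add: weak_coordinates_def)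
    qed
    ultimately have "\<exists>w. \<forall>e. \<Psi> e = blinfun_apply e w"
      by (intro lim[of ?F \<Psi>])
    then obtain w where "\<forall>e. \<Psi> e = blinfun_apply e w" ..
    then show ?thesis
      by (intro exI[of _ w]) (auto simp: weak_coordinates_def)
  qed
  let ?D = "weak_coordinates -` ?C"
  have "compactin weak_topology ?D"
    unfolding compactin_def
  proof (intro conjI allI impI)
    show "?D \<subseteq> topspace weak_topology" by (simp add: topspace_weak_topology)
    fix \<U> :: "'y set set"
    assume \<U>: "Ball \<U> (openin weak_topology) \<and> ?D \<subseteq> \<Union>\<U>"
    then obtain V where V: "\<And>U. U \<in> \<U> \<Longrightarrow> open (V U) \<and> U = weak_coordinates -` V U"
      using openin_weak_topologyD by metis
    have "?C \<subseteq> (\<Union>U\<in>\<U>. V U)"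
    proof
      fix \<Psi> assume \<Psi>: "\<Psi> \<in> ?C"
      then obtain w where w: "\<Psi> = weak_coordinates w" using rangeC by blast
      with \<Psi> have "w \<in> ?D" by simp
      then obtain U where "U \<in> \<U>" "w \<in> U" using \<U> by blast
      then show "\<Psi> \<in> (\<Union>U\<in>\<U>. V U)" using V[of U] w by auto
    qed
    then obtain \<V> where "\<V> \<subseteq> \<U>" "finite \<V>" "?C \<subseteq> (\<Union>U\<in>\<V>. V U)"
      using compactE_image[OF compC, of \<U> V] V by blast
    moreover have "?D \<subseteq> \<Union>\<V>"
    proof
      fix w assume "w \<in> ?D"
      then obtain U where "U \<in> \<V>" "weak_coordinates w \<in> V U" using calculation(3) by auto
      then show "w \<in> \<Union>\<V>" using V[of U] calculation(1) by auto
    qed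
    ultimately show "\<exists>\<F>. finite \<F> \<and> \<F> \<subseteq> \<U> \<and> ?D \<subseteq> \<Union>\<F>" by blast
  qed
  moreover have "weak_topology closure_of ?K \<subseteq> ?D"
  proof (rule closure_of_minimal)
    show "?K \<subseteq> ?D" using closure_subset by fastforce
    show "closedin weak_topology ?D"
      using closedin_continuous_map_preimage[OF continuous_map_weak_coordinates, of ?C]
      by (simp add: topspace_weak_topology vimage_def)
  qed
  ultimately show ?thesis
    unfolding weakly_compact_operator_def
    by (rule closed_compactin) (rule closedin_closure_of)
qed

lemma weakly_compact_operator_compose:
  fixes S :: "'x::real_normed_vector \<Rightarrow>\<^sub>L 'y::real_normed_vector" and B :: "'y \<Rightarrow>\<^sub>L 'z::real_normed_vector"
  assumes S: "weakly_compact_operator S"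
  shows "weakly_compact_operator (B o\<^sub>L S)"
proof (rule weakly_compactI)
  fix F and \<Psi> :: "('z \<Rightarrow>\<^sub>L real) \<Rightarrow> real"
  assume F: "F \<noteq> bot" "eventually (\<lambda>x::'x. norm x \<le> 1) F"
    and \<Psi>: "\<And>e. ((\<lambda>x. blinfun_apply e ((B o\<^sub>L S) x)) \<longlongrightarrow> \<Psi> e) F"
  have "eventually (\<lambda>z. z \<in> weak_topology closure_of (S ` cball 0 1)) (filtermap S F)"
    unfolding eventually_filtermap using F(2)
    by (rule eventually_mono) (use subset_weak_closure[of "S ` cball 0 1"] in auto)
  moreover have "filtermap S F \<noteq> bot"
    using F(1) by (simp add: filtermap_bot_iff)
  ultimately obtain G w where G: "G \<le> filtermap S F" "G \<noteq> bot" "\<And>e :: 'y \<Rightarrow>\<^sub>L real. (e \<longlongrightarrow> e w) G"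
    using weakly_compact_refinement[OF S] by metis
  have "\<Psi> e = blinfun_apply e (B w)" for e
  proof -
    have "((e o\<^sub>L B) \<longlongrightarrow> \<Psi> e) (filtermap S F)"
      using \<Psi>[of e] by (simp add: filterlim_filtermap)
    then have "((e o\<^sub>L B) \<longlongrightarrow> \<Psi> e) G"
      by (rule tendsto_mono[OF G(1)])
    with G(2) G(3)[of "e o\<^sub>L B"] show ?thesis
      using tendsto_unique by fastforce
  qed
  then show "\<exists>w. \<forall>e. \<Psi> e = blinfun_apply e w" by blast
qed

text \<open>
  A function on the dual that is a limit of evaluations, uniformly on the unit ball, is itself an
  evaluation. The hypothesis on the norm holds in every space by the Hahn--Banach theorem; for a
  dual space it is elementary (\<open>norming_evaluations\<close> below).
\<close>

lemma evaluation_limit: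
  fixes \<Psi> :: "('y::banach \<Rightarrow>\<^sub>L real) \<Rightarrow> real"
  assumes norming: "\<And>(y::'y) c. 0 \<le> c \<Longrightarrow> (\<And>e :: 'y \<Rightarrow>\<^sub>L real. \<bar>blinfun_apply e y\<bar> \<le> c * norm e) \<Longrightarrow> norm y \<le> c"
    and approx: "\<And>\<epsilon>. 0 < \<epsilon> \<Longrightarrow> \<exists>w. \<forall>e :: 'y \<Rightarrow>\<^sub>L real. \<bar>\<Psi> e - blinfun_apply e w\<bar> \<le> \<epsilon> * norm e"
  shows "\<exists>w. \<forall>e. \<Psi> e = blinfun_apply e w"
proof -
  obtain w where w: "\<bar>\<Psi> e - blinfun_apply e (w n)\<bar> \<le> inverse (real (Suc n)) * norm e" for n e
    using approx[of "inverse (real (Suc n))" for n] by (metis inverse_positive_iff_positive of_nat_0_less_iff zero_less_Suc)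
  have dist: "norm (w m - w n) \<le> inverse (real (Suc m)) + inverse (real (Suc n))" for m n
  proof (rule norming)
    show "0 \<le> inverse (real (Suc m)) + inverse (real (Suc n))" by simp
    fix e :: "'y \<Rightarrow>\<^sub>L real"
    show "\<bar>e (w m - w n)\<bar> \<le> (inverse (real (Suc m)) + inverse (real (Suc n))) * norm e"
      using w[of e m] w[of e n] unfolding blinfun.diff_right distrib_right by linarith
  qed
  have inv: "(\<lambda>n. inverse (real (Suc n))) \<longlonglongrightarrow> 0"
    by (rule LIMSEQ_inverse_real_of_nat)
  have "Cauchy w"
  proof (rule metric_CauchyI)
    fix \<epsilon> :: real assume "0 < \<epsilon>"
    then have "eventually (\<lambda>n. inverse (real (Suc n)) < \<epsilon> / 2) sequentially"
      using inv by (intro order_tendstoD) auto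
    then obtain N where N: "\<And>n. N \<le> n \<Longrightarrow> inverse (real (Suc n)) < \<epsilon> / 2"
      unfolding eventually_sequentially by blast
    show "\<exists>M. \<forall>m\<ge>M. \<forall>n\<ge>M. dist (w m) (w n) < \<epsilon>"
    proof (intro exI[of _ N] allI impI)
      fix m n assume "N \<le> m" "N \<le> n"
      then show "dist (w m) (w n) < \<epsilon>"
        using N[of m] N[of n] dist[of m n] unfolding dist_norm by linarith
    qed
  qed
  then obtain z where z: "w \<longlonglongrightarrow> z"
    using Cauchy_convergent_iff convergent_def by blast
  have "\<Psi> e = blinfun_apply e z" for e
  proof -
    have "(\<lambda>n. inverse (real (Suc n)) * norm e) \<longlonglongrightarrow> 0"
      using tendsto_mult_left_zero[OF inv, of "norm e"] by simp
    then have "(\<lambda>n. \<Psi> e - blinfun_apply e (w n)) \<longlonglongrightarrow> 0"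
      by (rule Lim_null_comparison[rotated]) (use w in auto)
    moreover have "(\<lambda>n. \<Psi> e - blinfun_apply e (w n)) \<longlonglongrightarrow> \<Psi> e - blinfun_apply e z"
      by (intro tendsto_intros z)
    ultimately show ?thesis
      using LIMSEQ_unique by fastforce
  qed
  then show ?thesis by blast
qed

section \<open>Sublinear functionals\<close>

text \<open>
  Subadditive and positively homogeneous functionals. Homogeneity is only required as an inequality;
  equality follows.
\<close>

definition sublinear :: "('x::real_vector \<Rightarrow> real) \<Rightarrow> bool"
  where "sublinear p \<longleftrightarrow> (\<forall>x y. p (x + y) \<le> p x + p y) \<and> (\<forall>c x. 0 < c \<longrightarrow> p (c *\<^sub>R x) \<le> c * p x)"

lemma sublinear_add: "sublinear p \<Longrightarrow> p (x + y) \<le> p x + p y"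
  by (simp add: sublinear_def)

lemma sublinear_scaleR_le: "sublinear p \<Longrightarrow> 0 < c \<Longrightarrow> p (c *\<^sub>R x) \<le> c * p x"
  by (simp add: sublinear_def)

lemma sublinear_scaleR:
  assumes p: "sublinear p" and c: "0 < c"
  shows "p (c *\<^sub>R x) = c * p x"
proof (rule antisym)
  show "p (c *\<^sub>R x) \<le> c * p x" using p c by (rule sublinear_scaleR_le)
  have "p (inverse c *\<^sub>R (c *\<^sub>R x)) \<le> inverse c * p (c *\<^sub>R x)"
    using p c by (intro sublinear_scaleR_le) auto
  then show "c * p x \<le> p (c *\<^sub>R x)"
    using c by (simp add: field_simps)
qed

lemma sublinear_zero: "sublinear p \<Longrightarrow> p 0 = 0"
  using sublinear_scaleR[of p 2 0] by simp

lemma sublinear_minus: "sublinear p \<Longrightarrow> - p (- x) \<le> p x"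
  using sublinear_add[of p x "- x"] sublinear_zero[of p] by simp

lemma sublinear_inf:
  fixes q :: "'i \<Rightarrow> 'x::real_vector \<Rightarrow> real"
  assumes I: "I \<noteq> {}" and lb: "\<And>i x. i \<in> I \<Longrightarrow> b x \<le> q i x"
    and add: "\<And>i j x y. i \<in> I \<Longrightarrow> j \<in> I \<Longrightarrow> \<exists>k\<in>I. q k (x + y) \<le> q i x + q j y"
    and scale: "\<And>i c x. i \<in> I \<Longrightarrow> 0 < c \<Longrightarrow> \<exists>k\<in>I. q k (c *\<^sub>R x) \<le> c * q i x"
  shows "sublinear (\<lambda>x. INF i\<in>I. q i x)"
  unfolding sublinear_def
proof (intro conjI allI impI)
  have bdd: "bdd_below ((\<lambda>i. q i x) ` I)" for x
    using lb by (intro bdd_belowI2) auto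
  fix x y :: 'x and c :: real
  have le: "(INF i\<in>I. q i (x + y)) \<le> q i x + q j y" if ij: "i \<in> I" "j \<in> I" for i j
  proof -
    obtain k where "k \<in> I" "q k (x + y) \<le> q i x + q j y" using add[OF ij] by blast
    then show ?thesis using cINF_lower[OF bdd, of k "x + y"] by linarith
  qed
  have "(INF i\<in>I. q i (x + y)) - q j y \<le> (INF i\<in>I. q i x)" if "j \<in> I" for j
    by (rule cINF_greatest[OF I]) (use le that in \<open>simp add: algebra_simps\<close>)
  then have "(INF i\<in>I. q i (x + y)) - (INF i\<in>I. q i x) \<le> (INF i\<in>I. q i y)"
    by (intro cINF_greatest[OF I]) (simp add: algebra_simps)
  then show "(INF i\<in>I. q i (x + y)) \<le> (INF i\<in>I. q i x) + (INF i\<in>I. q i y)"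
    by linarith
  assume c: "0 < c"
  have "(INF i\<in>I. q i (c *\<^sub>R x)) / c \<le> (INF i\<in>I. q i x)"
  proof (rule cINF_greatest[OF I])
    fix i assume "i \<in> I"
    then obtain k where "k \<in> I" "q k (c *\<^sub>R x) \<le> c * q i x" using scale c by blast
    then have "(INF i\<in>I. q i (c *\<^sub>R x)) \<le> c * q i x"
      using cINF_lower[OF bdd, of k "c *\<^sub>R x"] by linarith
    then show "(INF i\<in>I. q i (c *\<^sub>R x)) / c \<le> q i x"
      using c by (simp add: field_simps)
  qed
  then show "(INF i\<in>I. q i (c *\<^sub>R x)) \<le> c * (INF i\<in>I. q i x)"
    using c by (simp add: field_simps)
qed

text \<open>
  The modification is \<open>r x = inf\<^sub>t (p (x + t a) - t p a)\<close>, the infimum over \<open>t \<ge> 0\<close>. A linear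
  functional below it agrees with \<open>p\<close> at \<open>a\<close>.
\<close>

lemma sublinear_directional:
  fixes p :: "'x::real_vector \<Rightarrow> real"
  assumes p: "sublinear p"
  obtains r where "sublinear r" "\<And>x. r x \<le> p x" "r (- a) \<le> - p a"
proof -
  define q where "q = (\<lambda>t x. p (x + t *\<^sub>R a) - t * p a)"
  define r where "r = (\<lambda>x. INF t\<in>{0..}. q t x)"
  have lb: "- p (- x) \<le> q t x" if "t \<in> {0..}" for t x
  proof -
    have "t * p a = p (t *\<^sub>R a)"
      using that sublinear_scaleR[OF p, of t a] sublinear_zero[OF p] by (cases "t = 0") auto
    then show ?thesis
      using sublinear_add[OF p, of "x + t *\<^sub>R a" "- x"] by (simp add: q_def)
  qed
  have bdd: "bdd_below ((\<lambda>t. q t x) ` {0..})" for x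
    using lb by (intro bdd_belowI2) auto
  have "sublinear r"
    unfolding r_def
  proof (rule sublinear_inf[where b = "\<lambda>x. - p (- x)"])
    fix i j :: real and x y :: 'x assume ij: "i \<in> {0..}" "j \<in> {0..}"
    have "p (x + y + (i + j) *\<^sub>R a) \<le> p (x + i *\<^sub>R a) + p (y + j *\<^sub>R a)"
      using sublinear_add[OF p, of "x + i *\<^sub>R a" "y + j *\<^sub>R a"] by (simp add: algebra_simps)
    then have "q (i + j) (x + y) \<le> q i x + q j y"
      by (simp add: q_def algebra_simps)
    then show "\<exists>k\<in>{0..}. q k (x + y) \<le> q i x + q j y"
      using ij by (intro bexI[of _ "i + j"]) auto
  next
    fix i c :: real and x :: 'x assume ic: "i \<in> {0..}" "0 < c"
    have "q (c * i) (c *\<^sub>R x) = c * q i x"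
      using sublinear_scaleR[OF p ic(2), of "x + i *\<^sub>R a"] by (simp add: q_def algebra_simps)
    then show "\<exists>k\<in>{0..}. q k (c *\<^sub>R x) \<le> c * q i x"
      using ic by (intro bexI[of _ "c * i"]) auto
  qed (use lb in auto)
  moreover have "r x \<le> p x" for x
    using cINF_lower[OF bdd, of 0 x] by (simp add: r_def q_def)
  moreover have "r (- a) \<le> - p a"
    using cINF_lower[OF bdd, of 1 "- a"] sublinear_zero[OF p] by (simp add: r_def q_def)
  ultimately show thesis by (rule that)
qed

text \<open>
  The Hahn--Banach theorem. By Zorn's lemma there is a minimal sublinear functional below \<open>p\<close>. It
  is linear, since it coincides with its directional modifications.
\<close>

lemma linear_below_sublinear:
  fixes p :: "'x::real_vector \<Rightarrow> real"
  assumes p: "sublinear p"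
  obtains l where "linear l" "\<And>x. l x \<le> p x"
proof -
  define A where "A = {q. sublinear q \<and> q \<le> p}"
  define R where "R = (\<lambda>q r :: 'x \<Rightarrow> real. r \<le> q)"
  have "\<exists>m\<in>A. \<forall>a\<in>A. R m a \<longrightarrow> a = m"
  proof (rule predicate_Zorn)
    show "partial_order_on A (relation_of R A)"
      by (rule partial_order_on_relation_ofI) (auto simp: R_def)
    fix C assume C: "C \<in> Chains (relation_of R A)"
    then have CA: "C \<subseteq> A" and tot: "\<And>q r. q \<in> C \<Longrightarrow> r \<in> C \<Longrightarrow> q \<le> r \<or> r \<le> q"
      unfolding Chains_def relation_of_def R_def by blast+
    show "\<exists>u\<in>A. \<forall>a\<in>C. R a u"
    proof (cases "C = {}")
      case True
      then show ?thesis using p by (auto simp: A_def)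
    next
      case False
      have lb: "- p (- x) \<le> q x" if "q \<in> C" for q x
      proof -
        have "sublinear q" "q (- x) \<le> p (- x)" using that CA by (auto simp: A_def le_fun_def)
        then show ?thesis using sublinear_minus[of q x] by linarith
      qed
      let ?u = "\<lambda>x. INF q\<in>C. q x"
      have bdd: "bdd_below ((\<lambda>q. q x) ` C)" for x
        using lb by (intro bdd_belowI2) auto
      have u_le: "?u \<le> q" if "q \<in> C" for q
        using that by (auto simp: le_fun_def intro: cINF_lower[OF bdd])
      have "sublinear ?u"
      proof (rule sublinear_inf[where q = "\<lambda>q. q" and b = "\<lambda>x. - p (- x)"])
        fix q r :: "'x \<Rightarrow> real" and x y :: 'x assume qr: "q \<in> C" "r \<in> C"
        then have "sublinear q" "sublinear r" using CA by (auto simp: A_def)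
        then have *: "q (x + y) \<le> q x + q y" "r (x + y) \<le> r x + r y" by (simp_all add: sublinear_add)
        from tot[OF qr] show "\<exists>k\<in>C. k (x + y) \<le> q x + r y"
        proof
          assume "q \<le> r"
          then have "q y \<le> r y" by (simp add: le_fun_def)
          with * qr show ?thesis by (intro bexI[of _ q]) auto
        next
          assume "r \<le> q"
          then have "r x \<le> q x" by (simp add: le_fun_def)
          with * qr show ?thesis by (intro bexI[of _ r]) auto
        qed
      next
        fix q :: "'x \<Rightarrow> real" and c :: real and x :: 'x assume "q \<in> C" "0 < c"
        then show "\<exists>k\<in>C. k (c *\<^sub>R x) \<le> c * q x"
          using CA by (intro bexI[of _ q] sublinear_scaleR_le) (auto simp: A_def)
      qed (use False lb in auto)
      moreover obtain q0 where "q0 \<in> C" using False by blast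
      then have "?u \<le> p" using u_le[of q0] CA by (auto simp: A_def)
      ultimately show ?thesis using u_le by (auto simp: A_def R_def)
    qed
  qed
  then obtain m where m: "sublinear m" "m \<le> p" and min: "\<And>r. sublinear r \<Longrightarrow> r \<le> m \<Longrightarrow> r = m"
    unfolding A_def R_def by (metis (mono_tags, lifting) mem_Collect_eq order_trans)
  have minus: "m (- x) = - m x" for x
  proof (rule antisym)
    obtain r where r: "sublinear r" "\<And>z. r z \<le> m z" "r (- x) \<le> - m x"
      by (rule sublinear_directional[OF m(1), of x]) blast
    then have "r = m" by (intro min) (auto simp: le_fun_def)
    with r(3) show "m (- x) \<le> - m x" by simp
    show "- m x \<le> m (- x)" using sublinear_minus[OF m(1), of "- x"] by simp
  qed
  have "m (x + y) = m x + m y" for x y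
    using sublinear_add[OF m(1), of x y] sublinear_add[OF m(1), of "x + y" "- y"] minus[of y] by simp
  moreover have "m (c *\<^sub>R x) = c * m x" for c x
  proof -
    consider "c > 0" | "c = 0" | "c < 0" by linarith
    then show ?thesis
    proof cases
      case 3
      then have "m ((- c) *\<^sub>R x) = - c * m x" by (intro sublinear_scaleR[OF m(1)]) simp
      then show ?thesis using minus[of "c *\<^sub>R x"] by simp
    qed (simp_all add: sublinear_scaleR[OF m(1)] sublinear_zero[OF m(1)])
  qed
  ultimately have "linear m" by (intro linearI) auto
  with m(2) show thesis by (intro that[of m]) (auto simp: le_fun_def)
qed

section \<open>Normal and generating cones\<close>

text \<open>
  On a normal cone the positive functionals of norm at most \<open>1\<close> determine the norm up to a constant.
  The functional comes from the Hahn--Banach theorem applied to the distance to the negative cone.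
\<close>

lemma normal_cone_positive_functionals:
  fixes P :: "'e::banach set"
  assumes P: "convex_cone P" and N: "normal_cone P"
  obtains C where "1 \<le> C" "\<And>a b. a \<in> P \<Longrightarrow> b - a \<in> P \<Longrightarrow> norm a \<le> C * norm b"
    "\<And>a. a \<in> P \<Longrightarrow> \<exists>e :: 'e \<Rightarrow>\<^sub>L real. norm e \<le> 1 \<and> (\<forall>b\<in>P. 0 \<le> blinfun_apply e b) \<and> norm a \<le> C * blinfun_apply e a"
proof -
  obtain N0 where N0: "\<And>a z b. z - a \<in> P \<Longrightarrow> b - z \<in> P \<Longrightarrow> norm z \<le> N0 * (norm a + norm b)"
    using N unfolding normal_cone_def by blast
  define C where "C = max 1 N0"
  have C: "1 \<le> C" "N0 \<le> C" by (auto simp: C_def)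
  have mono: "norm a \<le> C * norm b" if "a \<in> P" "b - a \<in> P" for a b
  proof -
    have "norm a \<le> N0 * (norm (0::'e) + norm b)" using that by (intro N0) auto
    also have "\<dots> \<le> C * norm b" using C by (simp add: mult_right_mono)
    finally show ?thesis .
  qed
  define p where "p = (\<lambda>z. INF b\<in>P. norm (z + b))"
  have bdd: "bdd_below ((\<lambda>b. norm (z + b)) ` P)" for z
    by (intro bdd_belowI2[of _ 0]) auto
  have P0: "0 \<in> P" "P \<noteq> {}"
    using convex_cone_contains_0[OF P] by auto
  have p: "sublinear p"
    unfolding p_def
  proof (rule sublinear_inf[where b = "\<lambda>_. 0"])
    fix b c x y :: 'e assume "b \<in> P" "c \<in> P"
    then show "\<exists>k\<in>P. norm (x + y + k) \<le> norm (x + b) + norm (y + c)"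
      using norm_triangle_ineq[of "x + b" "y + c"] convex_cone_add[OF P, of b c]
      by (intro bexI[of _ "b + c"]) (auto simp: algebra_simps)
  next
    fix b x :: 'e and c :: real assume "b \<in> P" "0 < c"
    then show "\<exists>k\<in>P. norm (c *\<^sub>R x + k) \<le> c * norm (x + b)"
      using convex_cone_scaleR[OF P, of c b]
      by (intro bexI[of _ "c *\<^sub>R b"]) (auto simp flip: scaleR_add_right)
  qed (use P0 in auto)
  have p_norm: "p z \<le> norm z" for z
    using cINF_lower[OF bdd P0(1), of z] by (simp add: p_def)
  have p_neg: "p (- b) \<le> 0" if "b \<in> P" for b
    using cINF_lower[OF bdd that, of "- b"] by (simp add: p_def)
  have p_pos: "norm a \<le> C * p a" if "a \<in> P" for a
  proof -
    have "norm a / C \<le> p a"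
      unfolding p_def
    proof (rule cINF_greatest[OF P0(2)])
      fix b assume "b \<in> P"
      then show "norm a / C \<le> norm (a + b)"
        using mono[of a "a + b"] that C by (simp add: field_simps)
    qed
    then show ?thesis using C by (simp add: field_simps)
  qed
  have "\<exists>e :: 'e \<Rightarrow>\<^sub>L real. norm e \<le> 1 \<and> (\<forall>b\<in>P. 0 \<le> blinfun_apply e b) \<and> norm a \<le> C * blinfun_apply e a" if a: "a \<in> P" for a
  proof -
    obtain r where r: "sublinear r" "\<And>x. r x \<le> p x" "r (- a) \<le> - p a"
      by (rule sublinear_directional[OF p, of a]) blast
    obtain l where l: "linear l" "\<And>x. l x \<le> r x"
      by (rule linear_below_sublinear[OF r(1)]) blast
    interpret l: linear l by fact
    have lp: "l x \<le> p x" for x using l(2) r(2) order_trans by blast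
    have ln: "norm (l x) \<le> norm x" for x
      using lp[of x] lp[of "- x"] p_norm[of x] p_norm[of "- x"] by (simp add: l.neg)
    then have bl: "bounded_linear l"
      by (intro bounded_linear_intro[of _ 1]) (auto simp: l.add l.scale)
    have "norm (Blinfun l) \<le> 1"
      by (rule norm_blinfun_bound) (auto simp: bounded_linear_Blinfun_apply[OF bl] ln[simplified])
    moreover have "0 \<le> l b" if "b \<in> P" for b
      using lp[of "- b"] p_neg[OF that] by (simp add: l.neg)
    moreover have "p a \<le> l a"
      using l(2)[of "- a"] r(3) by (simp add: l.neg)
    then have "norm a \<le> C * l a"
      using p_pos[OF a] C by (meson mult_left_mono order_trans zero_le_one)
    ultimately show ?thesis
      by (intro exI[of _ "Blinfun l"]) (simp add: bounded_linear_Blinfun_apply[OF bl])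
  qed
  with C(1) mono show thesis by (intro that[of C]) auto
qed

text \<open>
  If the cone is generating, the differences of positive elements of the unit ball have a closure
  that contains a ball around \<open>0\<close>, by Baire's theorem.
\<close>

lemma generating_cone_dense_ball:
  fixes P :: "'e::banach set"
  assumes P: "convex_cone P" and gen: "generating_cone P"
  obtains r where "0 < r" "cball 0 r \<subseteq> closure {a - b | a b. a \<in> P \<and> b \<in> P \<and> norm a \<le> 1 \<and> norm b \<le> 1}"
proof -
  define D where "D = {a - b | a b. a \<in> P \<and> b \<in> P \<and> norm a \<le> 1 \<and> norm b \<le> 1}"
  let ?D = "\<lambda>n::nat. (\<lambda>x. real (Suc n) *\<^sub>R x) ` closure D"
  have "\<exists>n. interior (?D n) \<noteq> {}"
  proof (rule ccontr)
    assume "\<nexists>n. interior (?D n) \<noteq> {}"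
    then have empty: "interior (?D n) = {}" for n by blast
    have cl: "closed (?D n)" for n by (intro closed_scaling closed_closure)
    have "euclidean interior_of \<Union>(range ?D) = {}"
    proof (rule Met_TC.metric_Baire_category_alt[where 'a = 'e, unfolded mtopology_is_euclidean])
      show "Met_TC.mcomplete TYPE('e)"
        by (simp add: complete_UNIV)
      fix T assume "T \<in> range ?D"
      then obtain n where "T = ?D n" by blast
      then show "closedin euclidean T \<and> euclidean interior_of T = {}"
        using cl[of n] empty[of n] by simp
    qed simp
    moreover have "\<Union>(range ?D) = UNIV"
    proof -
      have "x \<in> \<Union>(range ?D)" for x :: 'e
      proof -
        obtain a b where ab: "x = a - b" "a \<in> P" "b \<in> P"
          using gen unfolding generating_cone_def by blast
        obtain n :: nat where n: "max (norm a) (norm b) \<le> real n"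
          using real_arch_simple by blast
        let ?c = "inverse (real (Suc n))"
        have "?c *\<^sub>R x = ?c *\<^sub>R a - ?c *\<^sub>R b" by (simp add: ab scaleR_diff_right)
        moreover have "?c *\<^sub>R a \<in> P" "?c *\<^sub>R b \<in> P"
          using ab by (auto intro!: convex_cone_scaleR[OF P])
        moreover have "norm (?c *\<^sub>R a) \<le> 1" "norm (?c *\<^sub>R b) \<le> 1"
          using n by (auto simp: field_simps)
        ultimately have "?c *\<^sub>R x \<in> D" unfolding D_def by blast
        then have "?c *\<^sub>R x \<in> closure D" using closure_subset by blast
        moreover have "x = real (Suc n) *\<^sub>R (?c *\<^sub>R x)" by simp
        ultimately show ?thesis by blast
      qed
      then show ?thesis by blast
    qed
    ultimately show False by simp
  qed
  then obtain n x where "x \<in> interior (?D n)" by blast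
  then obtain \<rho> where \<rho>: "0 < \<rho>" "cball x \<rho> \<subseteq> ?D n"
    by (meson mem_interior_cball)
  have convD: "convex (closure D)"
  proof (rule convex_closure)
    have "convex ((\<lambda>(a, b). a - b) ` ((P \<inter> cball 0 1) \<times> (P \<inter> cball 0 1)))"
      using P by (intro convex_linear_image convex_Times convex_Int convex_cball)
        (auto simp: convex_cone_def intro!: linearI simp: algebra_simps)
    moreover have "(\<lambda>(a, b). a - b) ` ((P \<inter> cball 0 1) \<times> (P \<inter> cball 0 1)) = D"
      by (force simp: D_def)
    ultimately show "convex D" by simp
  qed
  have symD: "- z \<in> closure D" if "z \<in> closure D" for z
  proof -
    have "uminus ` D \<subseteq> D" unfolding D_def by force
    then have "uminus ` closure D \<subseteq> closure D"
      using closure_subset by (intro image_closure_subset continuous_intros) auto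
    then show ?thesis using that by blast
  qed
  define k where "k = real (Suc n)"
  have k: "0 < k" by (simp add: k_def)
  have "cball 0 (\<rho> / k) \<subseteq> closure D"
  proof
    fix z :: 'e assume z: "z \<in> cball 0 (\<rho> / k)"
    have in_D: "inverse (k) *\<^sub>R y \<in> closure D" if y: "y \<in> cball x \<rho>" for y
    proof -
      obtain d where "d \<in> closure D" "y = k *\<^sub>R d"
        using \<rho>(2) y unfolding k_def by blast
      then show ?thesis using k by simp
    qed
    let ?z = "k *\<^sub>R z"
    have nz: "norm ?z \<le> \<rho>" using z k by (simp add: field_simps)
    have 1: "inverse (k) *\<^sub>R (x + ?z) \<in> closure D"
      by (rule in_D) (use nz in \<open>simp add: dist_norm\<close>)
    have 2: "- (inverse (k) *\<^sub>R (x - ?z)) \<in> closure D"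
      by (intro symD in_D) (use nz in \<open>simp add: dist_norm\<close>)
    have "(1/2) *\<^sub>R (inverse (k) *\<^sub>R (x + ?z)) + (1/2) *\<^sub>R (- (inverse (k) *\<^sub>R (x - ?z))) \<in> closure D"
      using convexD[OF convD 1 2, of "1/2" "1/2"] by simp
    moreover have "(1/2) *\<^sub>R (inverse (k) *\<^sub>R (x + ?z)) + (1/2) *\<^sub>R (- (inverse (k) *\<^sub>R (x - ?z))) = z"
      using k by (simp add: scaleR_add_right scaleR_diff_right flip: scaleR_add_left)
    ultimately show "z \<in> closure D" by simp
  qed
  moreover have "0 < \<rho> / k" using \<rho>(1) k by simp
  ultimately show thesis using that unfolding D_def by blast
qed

section \<open>A parallelogram criterion for weak compactness\<close>

text \<open>
  In a convex set that is bounded for a quadratic form, elements of almost minimal size lie close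
  together, by the parallelogram law. An operator that is uniformly continuous with respect to the
  quadratic form on the unit ball is therefore weakly compact: convex combinations of tails with
  almost minimal size have convergent images, and their limit is the weak limit.
\<close>

lemma parallelogram_weak_limit:
  fixes q :: "'x::real_normed_vector \<Rightarrow> real" and R :: "'x \<Rightarrow>\<^sub>L 'y::banach" and u :: "'i \<Rightarrow> 'x"
    and \<Psi> :: "('y \<Rightarrow>\<^sub>L real) \<Rightarrow> real"
  assumes q0: "\<And>v. 0 \<le> q v" and par: "\<And>v w. q (v + w) + q (v - w) = 2 * q v + 2 * q w"
    and half: "\<And>v. q ((1/2) *\<^sub>R v) = q v / 4" and qc: "\<And>v. norm v \<le> 1 \<Longrightarrow> q v \<le> c"
    and R: "\<And>\<epsilon>. 0 < \<epsilon> \<Longrightarrow> \<exists>\<delta>>0. \<forall>v. norm v \<le> 1 \<longrightarrow> q v \<le> \<delta> \<longrightarrow> norm (R v) \<le> \<epsilon>"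
    and F: "F \<noteq> bot" "eventually (\<lambda>i. norm (u i) \<le> 1) F"
    and lim: "\<And>e. ((\<lambda>i. blinfun_apply e (R (u i))) \<longlongrightarrow> \<Psi> e) F"
  shows "\<exists>w. \<forall>e. \<Psi> e = blinfun_apply e w"
proof -
  \<comment> \<open>\<open>H Q\<close> is the convex hull of a tail, \<open>m Q\<close> its least size, and \<open>M\<close> the supremum of these sizes\<close>
  define H where "H = (\<lambda>Q. convex hull (u ` {i. Q i \<and> norm (u i) \<le> 1}))"
  define m where "m = (\<lambda>Q. INF v\<in>H Q. q v)"
  define M where "M = (SUP Q\<in>{Q. eventually Q F}. m Q)"
  have H_ne: "H Q \<noteq> {}" if "eventually Q F" for Q
  proof -
    have "eventually (\<lambda>i. Q i \<and> norm (u i) \<le> 1) F" using that F(2) by (rule eventually_conj)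
    then have "\<exists>i. Q i \<and> norm (u i) \<le> 1" using F(1) eventually_happens' by blast
    then show ?thesis by (auto simp: H_def)
  qed
  have H_ball: "norm v \<le> 1" if "v \<in> H Q" for v Q
  proof -
    have "H Q \<subseteq> cball 0 1" unfolding H_def by (rule hull_minimal) auto
    with that show ?thesis by auto
  qed
  have H_mono: "H Q \<subseteq> H Q'" if "\<And>i. Q i \<Longrightarrow> Q' i" for Q Q'
    unfolding H_def using that by (intro hull_mono) auto
  have bdd: "bdd_below (q ` H Q)" for Q
    using q0 by (intro bdd_belowI2[of _ 0]) auto
  have m_le: "m Q \<le> q v" if "v \<in> H Q" for Q v
    unfolding m_def using bdd that by (rule cINF_lower)
  have m_c: "m Q \<le> c" if ev: "eventually Q F" for Q
  proof -
    obtain v where "v \<in> H Q" using H_ne[OF ev] by blast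
    then show ?thesis using m_le[of v Q] qc[OF H_ball, of v Q] by linarith
  qed
  have bddM: "bdd_above (m ` {Q. eventually Q F})"
    using m_c by (intro bdd_aboveI2[of _ _ c]) auto
  have m_M: "m Q \<le> M" if "eventually Q F" for Q
    unfolding M_def using that by (intro cSUP_upper bddM) auto
  have nearly: "\<exists>v\<in>H Q. q v \<le> M + \<eta>" if Q: "eventually Q F" and \<eta>: "0 < \<eta>" for Q \<eta>
  proof -
    have "m Q < M + \<eta>" using m_M[OF Q] \<eta> by linarith
    then obtain v where "v \<in> H Q" "q v < M + \<eta>"
      unfolding m_def using cINF_less_iff[OF H_ne[OF Q] bdd] by blast
    then show ?thesis by (intro bexI[of _ v]) auto
  qed
  define \<eta> where "\<eta> = (\<lambda>n. inverse (real (Suc n)))"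
  have \<eta>: "0 < \<eta> n" for n by (simp add: \<eta>_def)
  have \<eta>_mono: "\<eta> n \<le> \<eta> k" if "k \<le> n" for k n using that by (simp add: \<eta>_def field_simps)
  have \<eta>_lim: "\<eta> \<longlonglongrightarrow> 0" unfolding \<eta>_def by (rule LIMSEQ_inverse_real_of_nat)
  have "\<exists>Q. eventually Q F \<and> M - \<eta> n < m Q" for n
  proof -
    have "M - \<eta> n < M" using \<eta>[of n] by simp
    moreover have "{Q. eventually Q F} \<noteq> {}" using eventually_True by blast
    ultimately show ?thesis
      unfolding M_def using less_cSUP_iff[OF _ bddM, of "M - \<eta> n"] unfolding M_def by auto
  qed
  then obtain Q0 where Q0: "\<And>n. eventually (Q0 n) F" "\<And>n. M - \<eta> n < m (Q0 n)" by metis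
  define Q where "Q = (\<lambda>n i. \<forall>k\<in>{..n}. Q0 k i)"
  have Q: "eventually (Q n) F" for n
    unfolding Q_def using Q0(1) by (intro eventually_ball_finite) auto
  have Q_mono: "H (Q n) \<subseteq> H (Q k)" if "k \<le> n" for k n
    using that by (intro H_mono) (auto simp: Q_def)
  have mQ: "M - \<eta> n < q v" if "v \<in> H (Q n)" for n v
  proof -
    have "H (Q n) \<subseteq> H (Q0 n)" by (intro H_mono) (simp add: Q_def)
    then show ?thesis using that m_le[of v "Q0 n"] Q0(2)[of n] by force
  qed
  have close: "norm (v - z) \<le> 2 \<and> q (v - z) \<le> 8 * \<eta> n"
    if v: "v \<in> H (Q n)" "q v \<le> M + \<eta> n" and z: "z \<in> H (Q n)" "q z \<le> M + \<eta> n" for v z n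
  proof -
    have "(1/2) *\<^sub>R v + (1/2) *\<^sub>R z \<in> H (Q n)"
      using v(1) z(1) unfolding H_def by (intro convexD[OF convex_convex_hull]) auto
    then have "M - \<eta> n < q ((1/2) *\<^sub>R (v + z))"
      by (intro mQ) (simp add: scaleR_add_right)
    then have "4 * (M - \<eta> n) < q (v + z)"
      by (simp add: half)
    moreover have "q (v - z) = 2 * q v + 2 * q z - q (v + z)"
      using par[of v z] by (simp only: eq_diff_eq add.commute)
    ultimately have "q (v - z) \<le> 8 * \<eta> n"
      using v(2) z(2) unfolding right_diff_distrib by linarith
    moreover have "norm (v - z) \<le> 2"
      using norm_triangle_ineq4[of v z] H_ball[OF v(1)] H_ball[OF z(1)] by linarith
    ultimately show ?thesis by blast
  qed
  have uniform: "\<exists>N. \<forall>v\<in>H (Q N). \<forall>z\<in>H (Q N). q v \<le> M + \<eta> N \<longrightarrow> q z \<le> M + \<eta> N \<longrightarrow> norm (R v - R z) \<le> \<epsilon>"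
    if \<epsilon>: "0 < \<epsilon>" for \<epsilon>
  proof -
    obtain \<delta> where \<delta>: "0 < \<delta>" "\<And>v. norm v \<le> 1 \<Longrightarrow> q v \<le> \<delta> \<Longrightarrow> norm (R v) \<le> \<epsilon> / 2"
      using R[of "\<epsilon> / 2"] \<epsilon> by auto
    have "eventually (\<lambda>n. \<eta> n < \<delta> / 2) sequentially"
      using \<eta>_lim \<delta>(1) by (intro order_tendstoD) auto
    then obtain N where N: "\<eta> N < \<delta> / 2" unfolding eventually_sequentially by blast
    have "norm (R v - R z) \<le> \<epsilon>"
      if "v \<in> H (Q N)" "z \<in> H (Q N)" "q v \<le> M + \<eta> N" "q z \<le> M + \<eta> N" for v z
    proof -
      have "norm (R ((1/2) *\<^sub>R (v - z))) \<le> \<epsilon> / 2"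
        using close[of v N z] that N by (intro \<delta>(2)) (auto simp: half)
      then show ?thesis by (simp add: blinfun.scaleR_right blinfun.diff_right)
    qed
    then show ?thesis by blast
  qed
  have "\<exists>v\<in>H (Q n). q v \<le> M + \<eta> n" for n
    by (rule nearly[OF Q \<eta>])
  then obtain V where V: "\<And>n. V n \<in> H (Q n)" "\<And>n. q (V n) \<le> M + \<eta> n"
    by metis
  have V': "V n \<in> H (Q N)" "q (V n) \<le> M + \<eta> N" if "N \<le> n" for n N
    using V[of n] Q_mono[OF that] \<eta>_mono[OF that] by auto
  have "Cauchy (\<lambda>n. R (V n))"
  proof (rule metric_CauchyI)
    fix \<epsilon> :: real assume "0 < \<epsilon>"
    then obtain N where N: "\<And>v z. v \<in> H (Q N) \<Longrightarrow> z \<in> H (Q N) \<Longrightarrow> q v \<le> M + \<eta> N \<Longrightarrow> q z \<le> M + \<eta> N \<Longrightarrow>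
        norm (R v - R z) \<le> \<epsilon> / 2"
      using uniform[of "\<epsilon> / 2"] by auto
    show "\<exists>K. \<forall>m\<ge>K. \<forall>n\<ge>K. dist (R (V m)) (R (V n)) < \<epsilon>"
    proof (intro exI[of _ N] allI impI)
      fix k n assume "N \<le> k" "N \<le> n"
      then have "norm (R (V k) - R (V n)) \<le> \<epsilon> / 2" by (intro N V')
      then show "dist (R (V k)) (R (V n)) < \<epsilon>" using \<open>0 < \<epsilon>\<close> by (simp add: dist_norm)
    qed
  qed
  then obtain w where w: "(\<lambda>n. R (V n)) \<longlonglongrightarrow> w"
    using Cauchy_convergent_iff convergent_def by blast
  have "\<Psi> e = blinfun_apply e w" for e
  proof -
    have bound: "\<bar>blinfun_apply e w - \<Psi> e\<bar> \<le> (norm e + 1) * \<epsilon>" if \<epsilon>: "0 < \<epsilon>" for \<epsilon>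
    proof -
      obtain N where N: "\<And>v z. v \<in> H (Q N) \<Longrightarrow> z \<in> H (Q N) \<Longrightarrow> q v \<le> M + \<eta> N \<Longrightarrow> q z \<le> M + \<eta> N \<Longrightarrow>
          norm (R v - R z) \<le> \<epsilon>"
        using uniform[OF \<epsilon>] by blast
      \<comment> \<open>an almost minimal \<open>z\<close> in a smaller tail, on which \<open>e\<close> is already close to its limit, stays close to \<open>V n\<close>\<close>
      define B where "B = (\<lambda>i. Q N i \<and> \<bar>blinfun_apply e (R (u i)) - \<Psi> e\<bar> \<le> \<epsilon>)"
      have "eventually (\<lambda>i. dist (blinfun_apply e (R (u i))) (\<Psi> e) < \<epsilon>) F"
        using lim[of e] \<epsilon> by (rule tendstoD)
      then have "eventually (\<lambda>i. \<bar>blinfun_apply e (R (u i)) - \<Psi> e\<bar> \<le> \<epsilon>) F"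
        by (rule eventually_mono) (simp add: dist_real_def)
      then have "eventually B F"
        unfolding B_def using Q by (intro eventually_conj)
      then obtain z where z: "z \<in> H B" "q z \<le> M + \<eta> N"
        using nearly[OF _ \<eta>] by blast
      have zQ: "z \<in> H (Q N)"
        using z(1) H_mono[of B "Q N"] by (auto simp: B_def)
      have "convex (blinfun_apply (e o\<^sub>L R) -` {\<Psi> e - \<epsilon>..\<Psi> e + \<epsilon>})"
        by (intro convex_linear_vimage bounded_linear.linear[OF blinfun.bounded_linear_right]) simp
      then have "H B \<subseteq> blinfun_apply (e o\<^sub>L R) -` {\<Psi> e - \<epsilon>..\<Psi> e + \<epsilon>}"
        unfolding H_def by (intro hull_minimal) (auto simp: B_def abs_le_iff)
      then have ez: "\<bar>blinfun_apply e (R z) - \<Psi> e\<bar> \<le> \<epsilon>"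
        using z(1) by (auto simp: abs_le_iff)
      have "\<bar>blinfun_apply e (R (V n)) - \<Psi> e\<bar> \<le> (norm e + 1) * \<epsilon>" if "N \<le> n" for n
      proof -
        have "\<bar>blinfun_apply e (R (V n) - R z)\<bar> \<le> norm e * norm (R (V n) - R z)"
          using norm_blinfun[of e "R (V n) - R z"] by simp
        also have "\<dots> \<le> norm e * \<epsilon>"
          by (intro mult_left_mono N V'[OF that] zQ z(2)) simp
        finally show ?thesis using ez by (simp add: blinfun.diff_right algebra_simps)
      qed
      then have "eventually (\<lambda>n. \<bar>blinfun_apply e (R (V n)) - \<Psi> e\<bar> \<le> (norm e + 1) * \<epsilon>) sequentially"
        unfolding eventually_sequentially by blast
      moreover have "(\<lambda>n. \<bar>blinfun_apply e (R (V n)) - \<Psi> e\<bar>) \<longlonglongrightarrow> \<bar>blinfun_apply e w - \<Psi> e\<bar>"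
        by (intro tendsto_intros w)
      ultimately show ?thesis
        using tendsto_upperbound by fastforce
    qed
    have "\<bar>blinfun_apply e w - \<Psi> e\<bar> \<le> 0"
    proof (rule field_le_epsilon)
      fix d :: real assume "0 < d"
      then have "0 < d / (norm e + 1)" by (simp add: add_nonneg_pos)
      from bound[OF this] show "\<bar>blinfun_apply e w - \<Psi> e\<bar> \<le> 0 + d"
        using norm_ge_zero[of e] by (simp add: add_nonneg_eq_0_iff)
    qed
    then show ?thesis by simp
  qed
  then show ?thesis by blast
qed

section \<open>Uniform absolute continuity\<close>

lemma cone_functional_0: "cone_functional 0"
  by (simp add: cone_functional_def positive_operator_def)

lemma cone_functional_add: "cone_functional f \<Longrightarrow> cone_functional g \<Longrightarrow> cone_functional (f + g)"
  by (auto simp: cone_functional_def positive_operator_def blinfun.add_left)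

lemma sum_half_powers_le: "(\<Sum>k=n..m. (1/2::real) ^ k) \<le> 2 * (1/2) ^ n"
proof (cases "n \<le> m")
  case True
  then have "(\<Sum>k=n..m. (1/2::real) ^ k) = 2 * (1/2) ^ n - (1/2) ^ m"
    by (induction m rule: dec_induct) (simp_all add: sum.cl_ivl_Suc)
  then show ?thesis by simp
qed simp

text \<open>
  Suppose that no positive functional \<open>\<phi>\<close> controls the functionals in \<open>\<F>\<close> on squares up to \<open>\<epsilon>\<close>. Then
  functionals \<open>f\<^sub>i\<close> in \<open>\<F>\<close> and squares \<open>h\<^sub>i\<^sup>2\<close> can be chosen inductively such that \<open>f\<^sub>i\<close> exceeds \<open>\<epsilon>\<close> at \<open>h\<^sub>i\<^sup>2\<close>,
  while the sum of the earlier functionals is at most \<open>2\<^sup>-\<^sup>i\<close> there. The elements \<open>y n m\<close> are half of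
  the bounded majorants of \<open>h\<^sub>n\<^sup>2, \<dots>, h\<^sub>m\<^sup>2\<close>.
\<close>

lemma gliding_hump:
  fixes \<F> :: "('a::cstar_algebra self_adjoint \<Rightarrow>\<^sub>L real) set"
  assumes pos: "\<And>f. f \<in> \<F> \<Longrightarrow> cone_functional f"
    and fail: "\<And>\<phi> \<delta>. cone_functional \<phi> \<Longrightarrow> 0 < \<delta> \<Longrightarrow>
      \<exists>f\<in>\<F>. \<exists>h. norm h < 1 \<and> blinfun_apply \<phi> (sqr h) \<le> \<delta> \<and> \<epsilon> < blinfun_apply f (sqr h)"
  obtains f y where "\<And>i::nat. f i \<in> \<F>" "\<And>n m. norm (y n m) \<le> 1"
    "\<And>i n m. i < n \<Longrightarrow> blinfun_apply (f i) (y n m) \<le> (1/2) ^ n"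
    "\<And>i n m. n \<le> i \<Longrightarrow> i \<le> m \<Longrightarrow> \<epsilon> / 4 \<le> blinfun_apply (f i) (y n m)"
proof -
  define good where "good = (\<lambda>n (\<phi>, f, h). cone_functional \<phi> \<and> f \<in> \<F> \<and> norm h < 1 \<and>
    blinfun_apply \<phi> (sqr h) \<le> (1/2) ^ n \<and> \<epsilon> < blinfun_apply f (sqr h))"
  define succ where "succ = (\<lambda>(\<phi>, f, h :: 'a self_adjoint) (\<phi>', f' :: 'a self_adjoint \<Rightarrow>\<^sub>L real, h' :: 'a self_adjoint).
    \<phi>' = \<phi> + (f :: 'a self_adjoint \<Rightarrow>\<^sub>L real))"
  have ex: "\<exists>f h. good n (\<phi>, f, h)" if "cone_functional \<phi>" for n \<phi>
    using fail[OF that, of "(1/2) ^ n"] that by (auto simp: good_def)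
  have "\<exists>s. \<forall>n. good n (s n) \<and> succ (s n) (s (Suc n))"
  proof (rule dependent_nat_choice)
    show "\<exists>s. good 0 s" using ex[OF cone_functional_0] by blast
    fix s n assume s: "good n s"
    obtain \<phi> f h where [simp]: "s = (\<phi>, f, h)" by (cases s)
    have "cone_functional (\<phi> + f)"
      using s pos by (intro cone_functional_add) (auto simp: good_def)
    from ex[OF this] obtain f' h' where "good (Suc n) (\<phi> + f, f', h')" by blast
    then show "\<exists>s'. good (Suc n) s' \<and> succ s s'"
      by (intro exI[of _ "(\<phi> + f, f', h')"]) (simp add: succ_def)
  qed
  then obtain s where s: "\<And>n. good n (s n)" "\<And>n. succ (s n) (s (Suc n))" by blast
  define \<phi> where "\<phi> = (\<lambda>n. fst (s n))"
  define f where "f = (\<lambda>n. fst (snd (s n)))"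
  define h where "h = (\<lambda>n. snd (snd (s n)))"
  have s_eq: "s n = (\<phi> n, f n, h n)" for n by (simp add: \<phi>_def f_def h_def)
  have g: "cone_functional (\<phi> n)" "f n \<in> \<F>" "norm (h n) < 1" "\<phi> n (sqr (h n)) \<le> (1/2) ^ n"
    "\<epsilon> < f n (sqr (h n))" for n
    using s(1)[of n] by (auto simp: good_def s_eq)
  have step: "\<phi> (Suc n) = \<phi> n + f n" for n
    using s(2)[of n] by (simp add: succ_def s_eq)
  have f_pos: "0 \<le> f n (sqr v)" for n v
    using cone_functional_sqr[OF pos[OF g(2)]] .
  have f_le: "f i (sqr v) \<le> \<phi> k (sqr v)" if "i < k" for i k v
    using that
  proof (induction k)
    case (Suc k)
    have "0 \<le> \<phi> k (sqr v)" using cone_functional_sqr[OF g(1)] .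
    with Suc show ?case
      using f_pos[of k v] by (cases "i = k") (auto simp: step blinfun.add_left)
  qed simp
  have small: "f i (sqr (h k)) \<le> (1/2) ^ k" if "i < k" for i k
    using f_le[OF that] g(4) order_trans by blast
  have "\<exists>y. norm y \<le> 1 \<and> (\<forall>i<n. f i y \<le> (1/2) ^ n) \<and> (\<forall>i. n \<le> i \<longrightarrow> i \<le> m \<longrightarrow> \<epsilon> / 4 \<le> f i y)" for n m
  proof -
    obtain y where y: "norm y \<le> 2"
      "\<And>f. cone_functional f \<Longrightarrow> f y \<le> (\<Sum>k\<in>{n..m}. f (sqr (h k)))"
      "\<And>f k. cone_functional f \<Longrightarrow> k \<in> {n..m} \<Longrightarrow> f (sqr (h k)) \<le> 2 * f y"
      by (rule sqr_bounded_majorant[of "{n..m}" h]) (use g(3) in auto)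
    show ?thesis
    proof (intro exI[of _ "(1/2) *\<^sub>R y"] conjI allI impI)
      show "norm ((1/2) *\<^sub>R y) \<le> 1" using y(1) by simp
      fix i
      note fi = pos[OF g(2)[of i]]
      show "f i ((1/2) *\<^sub>R y) \<le> (1/2) ^ n" if "i < n"
      proof -
        have "f i y \<le> (\<Sum>k\<in>{n..m}. (1/2) ^ k)"
          by (rule order_trans[OF y(2)[OF fi] sum_mono]) (use that small in auto)
        also have "\<dots> \<le> 2 * (1/2) ^ n" by (rule sum_half_powers_le)
        finally show ?thesis by (simp add: blinfun.scaleR_right)
      qed
      show "\<epsilon> / 4 \<le> f i ((1/2) *\<^sub>R y)" if "n \<le> i" "i \<le> m"
        using y(3)[OF fi, of i] that g(5)[of i] by (simp add: blinfun.scaleR_right)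
    qed
  qed
  then obtain y where "\<And>n m. norm (y n m) \<le> 1 \<and> (\<forall>i<n. f i (y n m) \<le> (1/2) ^ n) \<and>
      (\<forall>i. n \<le> i \<longrightarrow> i \<le> m \<longrightarrow> \<epsilon> / 4 \<le> f i (y n m))"
    by metis
  then show thesis
    using g(2) by (intro that[of f y]) auto
qed

text \<open>The canonical image of a point in the second dual.\<close>

definition evaluation :: "'x::real_normed_vector \<Rightarrow> ('x \<Rightarrow>\<^sub>L real) \<Rightarrow>\<^sub>L real"
  where "evaluation v = blinfun.prod_left v"

lemma evaluation_apply: "blinfun_apply (evaluation v) f = blinfun_apply f v"
  by (simp add: evaluation_def)

lemma norm_evaluation_le: "norm (evaluation v) \<le> norm v"
  by (rule norm_blinfun_bound) (simp_all add: evaluation_apply mult.commute[of "norm v"] norm_blinfun flip: real_norm_def)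

lemma eventually_le_filter: "G \<le> sequentially \<Longrightarrow> (\<And>n::nat. N \<le> n \<Longrightarrow> Q n) \<Longrightarrow> eventually Q G"
  using filter_leD[of G sequentially Q] by (auto simp: eventually_sequentially)

text \<open>
  The sequences of the gliding hump contradict weak compactness by an interchange of limits. Let \<open>g\<close>
  be a weak cluster point of the \<open>f\<^sub>i\<close>, let \<open>E n\<close> in the second dual be a cluster point of \<open>y n m\<close>
  as \<open>m\<close> grows, and \<open>\<eta>\<close> a cluster point of the \<open>E n\<close>. Then \<open>\<eta>\<close> is at most \<open>0\<close> at every \<open>f\<^sub>i\<close>, hence at \<open>g\<close>;
  but \<open>E n\<close> is at least \<open>\<epsilon> / 4\<close> at \<open>g\<close> for all \<open>n\<close>.
\<close>

lemma weakly_compact_dual_absolutely_continuous: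
  fixes S :: "'e::real_normed_vector \<Rightarrow>\<^sub>L ('a::cstar_algebra self_adjoint \<Rightarrow>\<^sub>L real)"
  assumes S: "weakly_compact_operator S" and K: "\<And>x. x \<in> K \<Longrightarrow> norm x \<le> 1"
    and pos: "\<And>x. x \<in> K \<Longrightarrow> cone_functional (S x)" and \<epsilon>: "0 < \<epsilon>"
  shows "\<exists>\<phi> \<delta>. cone_functional \<phi> \<and> 0 < \<delta> \<and>
    (\<forall>x\<in>K. \<forall>h. norm h < 1 \<longrightarrow> blinfun_apply \<phi> (sqr h) \<le> \<delta> \<longrightarrow> blinfun_apply (S x) (sqr h) \<le> \<epsilon>)"
proof (rule ccontr)
  assume neg: "\<not> ?thesis"
  have fail: "\<exists>f\<in>blinfun_apply S ` K. \<exists>h. norm h < 1 \<and> blinfun_apply \<phi> (sqr h) \<le> \<delta> \<and> \<epsilon> < blinfun_apply f (sqr h)"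
    if "cone_functional \<phi>" "0 < \<delta>" for \<phi> \<delta>
    using neg that by (simp add: not_le)
  have pos': "cone_functional f" if "f \<in> blinfun_apply S ` K" for f
    using that pos by blast
  obtain f y where fK: "\<And>i::nat. f i \<in> blinfun_apply S ` K" and ny: "\<And>n m. norm (y n m) \<le> 1"
    and small: "\<And>i n m. i < n \<Longrightarrow> blinfun_apply (f i) (y n m) \<le> (1/2) ^ n"
    and large: "\<And>i n m. n \<le> i \<Longrightarrow> i \<le> m \<Longrightarrow> \<epsilon> / 4 \<le> blinfun_apply (f i) (y n m)"
    by (rule gliding_hump[of "blinfun_apply S ` K" \<epsilon>, OF pos' fail]) blast+
  let ?F = "filtermap f sequentially"
  have "f i \<in> weak_topology closure_of (S ` cball 0 1)" for i
    using fK[of i] K subset_weak_closure[of "S ` cball 0 1"] by fastforce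
  then have "eventually (\<lambda>z. z \<in> weak_topology closure_of (S ` cball 0 1)) ?F"
    by (simp add: eventually_filtermap)
  moreover have "?F \<noteq> bot" by (simp add: filtermap_bot_iff)
  ultimately obtain G g where G: "G \<le> ?F" "G \<noteq> bot"
    "\<And>e :: ('a self_adjoint \<Rightarrow>\<^sub>L real) \<Rightarrow>\<^sub>L real. (e \<longlongrightarrow> e g) G"
    using weakly_compact_refinement[OF S] by metis
  have "\<exists>E :: ('a self_adjoint \<Rightarrow>\<^sub>L real) \<Rightarrow>\<^sub>L real. norm E \<le> 1 \<and> (\<forall>i\<ge>n. \<epsilon> / 4 \<le> blinfun_apply E (f i)) \<and> (\<forall>i<n. blinfun_apply E (f i) \<le> (1/2) ^ n)" for n
  proof -
    have "eventually (\<lambda>m. norm (evaluation (y n m)) \<le> 1) sequentially"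
      using order_trans[OF norm_evaluation_le ny] by simp
    then obtain G' E where G': "G' \<le> sequentially" "G' \<noteq> bot"
      "\<And>z. ((\<lambda>m. evaluation (y n m) z) \<longlongrightarrow> blinfun_apply E z) G'" "norm E \<le> 1"
      by (rule bounded_functionals_refinement[OF sequentially_bot]) blast
    have "\<epsilon> / 4 \<le> blinfun_apply E (f i)" if "n \<le> i" for i
      by (rule tendsto_lowerbound[OF G'(3) eventually_le_filter[OF G'(1), of i] G'(2)])
        (use large that in \<open>auto simp: evaluation_apply\<close>)
    moreover have "blinfun_apply E (f i) \<le> (1/2) ^ n" if "i < n" for i
      by (rule tendsto_upperbound[OF G'(3) eventually_le_filter[OF G'(1), of 0] G'(2)])
        (use small that in \<open>auto simp: evaluation_apply\<close>)
    ultimately show ?thesis using G'(4) by blast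
  qed
  then obtain E :: "nat \<Rightarrow> ('a self_adjoint \<Rightarrow>\<^sub>L real) \<Rightarrow>\<^sub>L real" where nE: "\<And>n. norm (E n) \<le> 1"
    and E_large: "\<And>i n. n \<le> i \<Longrightarrow> \<epsilon> / 4 \<le> blinfun_apply (E n) (f i)"
    and E_small: "\<And>i n. i < n \<Longrightarrow> blinfun_apply (E n) (f i) \<le> (1/2) ^ n"
    by metis
  have "\<epsilon> / 4 \<le> blinfun_apply (E n) g" for n
  proof (rule tendsto_lowerbound[OF G(3) _ G(2)])
    have "eventually (\<lambda>z. \<epsilon> / 4 \<le> blinfun_apply (E n) z) ?F"
      unfolding eventually_filtermap eventually_sequentially using E_large by blast
    then show "eventually (\<lambda>z. \<epsilon> / 4 \<le> blinfun_apply (E n) z) G" by (rule filter_leD[OF G(1)])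
  qed
  note E_g = this
  obtain G' \<eta> where G': "G' \<le> sequentially" "G' \<noteq> bot" "\<And>z. ((\<lambda>n. blinfun_apply (E n) z) \<longlongrightarrow> blinfun_apply \<eta> z) G'"
    by (rule bounded_functionals_refinement[OF sequentially_bot, of E 1]) (use nE in auto)
  have "\<epsilon> / 4 \<le> blinfun_apply \<eta> g"
    by (rule tendsto_lowerbound[OF G'(3) _ G'(2)]) (use E_g in auto)
  moreover have "\<eta> (f i) \<le> 0" for i
  proof (rule tendsto_le[OF G'(2) _ G'(3)])
    show "((\<lambda>n. (1/2::real) ^ n) \<longlongrightarrow> 0) G'"
      by (rule tendsto_mono[OF G'(1)]) (rule LIMSEQ_power_zero, simp)
    show "eventually (\<lambda>n. blinfun_apply (E n) (f i) \<le> (1/2) ^ n) G'"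
      by (rule eventually_le_filter[OF G'(1), of "Suc i"]) (use E_small in auto)
  qed
  then have "eventually (\<lambda>z. \<eta> z \<le> 0) ?F"
    by (simp add: eventually_filtermap)
  then have "blinfun_apply \<eta> g \<le> 0"
    using tendsto_upperbound[OF G(3) filter_leD[OF G(1)] G(2)] by blast
  ultimately show False using \<epsilon> by simp
qed

text \<open>
  The same interchange of limits with the roles exchanged: the cluster points \<open>w n\<close> of \<open>S (y n m)\<close>
  and a cluster point \<open>z\<close> of the \<open>w n\<close> exist by weak compactness, and that of the functionals \<open>e i\<close>
  by the Banach--Alaoglu theorem.
\<close>

lemma weakly_compact_absolutely_continuous:
  fixes S :: "'a::cstar_algebra self_adjoint \<Rightarrow>\<^sub>L 'e::real_normed_vector"
  assumes S: "weakly_compact_operator S" and L: "\<And>e. e \<in> \<L> \<Longrightarrow> norm e \<le> 1"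
    and pos: "\<And>e. e \<in> \<L> \<Longrightarrow> cone_functional (e o\<^sub>L S)" and \<epsilon>: "0 < \<epsilon>"
  shows "\<exists>\<phi> \<delta>. cone_functional \<phi> \<and> 0 < \<delta> \<and>
    (\<forall>e\<in>\<L>. \<forall>h. norm h < 1 \<longrightarrow> blinfun_apply \<phi> (sqr h) \<le> \<delta> \<longrightarrow> blinfun_apply e (S (sqr h)) \<le> \<epsilon>)"
proof (rule ccontr)
  assume neg: "\<not> ?thesis"
  have fail: "\<exists>f\<in>(\<lambda>e. e o\<^sub>L S) ` \<L>. \<exists>h. norm h < 1 \<and> blinfun_apply \<phi> (sqr h) \<le> \<delta> \<and> \<epsilon> < blinfun_apply f (sqr h)"
    if "cone_functional \<phi>" "0 < \<delta>" for \<phi> \<delta>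
    using neg that by (simp add: not_le)
  have pos': "cone_functional f" if "f \<in> (\<lambda>e. e o\<^sub>L S) ` \<L>" for f
    using that pos by blast
  obtain f y where fK: "\<And>i::nat. f i \<in> (\<lambda>e. e o\<^sub>L S) ` \<L>" and ny: "\<And>n m. norm (y n m) \<le> 1"
    and small: "\<And>i n m. i < n \<Longrightarrow> blinfun_apply (f i) (y n m) \<le> (1/2) ^ n"
    and large: "\<And>i n m. n \<le> i \<Longrightarrow> i \<le> m \<Longrightarrow> \<epsilon> / 4 \<le> blinfun_apply (f i) (y n m)"
    by (rule gliding_hump[of "(\<lambda>e. e o\<^sub>L S) ` \<L>" \<epsilon>, OF pos' fail]) blast+
  have "\<exists>e. e \<in> \<L> \<and> f i = e o\<^sub>L S" for i using fK[of i] by blast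
  then obtain e where e: "\<And>i. e i \<in> \<L>" "\<And>i. f i = e i o\<^sub>L S" by metis
  let ?K = "weak_topology closure_of (S ` cball 0 1)"
  have "\<exists>w\<in>?K. (\<forall>i\<ge>n. \<epsilon> / 4 \<le> blinfun_apply (e i) w) \<and> (\<forall>i<n. blinfun_apply (e i) w \<le> (1/2) ^ n)" for n
  proof -
    let ?F = "filtermap (\<lambda>m. S (y n m)) sequentially"
    have "S (y n m) \<in> ?K" for m
      using ny[of n m] subset_weak_closure[of "S ` cball 0 1"] by fastforce
    then have "eventually (\<lambda>z. z \<in> ?K) ?F"
      by (simp add: eventually_filtermap)
    moreover have "?F \<noteq> bot" by (simp add: filtermap_bot_iff)
    ultimately obtain G w where G: "G \<le> ?F" "G \<noteq> bot" "w \<in> ?K" "\<And>e :: 'e \<Rightarrow>\<^sub>L real. (e \<longlongrightarrow> e w) G"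
      using weakly_compact_refinement[OF S] by metis
    have "\<epsilon> / 4 \<le> blinfun_apply (e i) w" if "n \<le> i" for i
    proof (rule tendsto_lowerbound[OF G(4) _ G(2)])
      have "eventually (\<lambda>z. \<epsilon> / 4 \<le> blinfun_apply (e i) z) ?F"
        unfolding eventually_filtermap eventually_sequentially using large[OF that] e(2) by (intro exI[of _ i]) simp
      then show "eventually (\<lambda>z. \<epsilon> / 4 \<le> blinfun_apply (e i) z) G" by (rule filter_leD[OF G(1)])
    qed
    moreover have "blinfun_apply (e i) w \<le> (1/2) ^ n" if "i < n" for i
    proof (rule tendsto_upperbound[OF G(4) _ G(2)])
      have "eventually (\<lambda>z. blinfun_apply (e i) z \<le> (1/2) ^ n) ?F"
        unfolding eventually_filtermap eventually_sequentially using small[OF that] e(2) by simp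
      then show "eventually (\<lambda>z. blinfun_apply (e i) z \<le> (1/2) ^ n) G" by (rule filter_leD[OF G(1)])
    qed
    ultimately show ?thesis using G(3) by blast
  qed
  then obtain w where w: "\<And>n. w n \<in> ?K" "\<And>n i. n \<le> i \<Longrightarrow> \<epsilon> / 4 \<le> blinfun_apply (e i) (w n)" "\<And>n i. i < n \<Longrightarrow> blinfun_apply (e i) (w n) \<le> (1/2) ^ n"
    by metis
  let ?F = "filtermap w sequentially"
  have "eventually (\<lambda>z. z \<in> ?K) ?F" "?F \<noteq> bot"
    using w(1) by (simp_all add: eventually_filtermap filtermap_bot_iff)
  then obtain G z where G: "G \<le> ?F" "G \<noteq> bot" "\<And>e :: 'e \<Rightarrow>\<^sub>L real. (e \<longlongrightarrow> e z) G"
    using weakly_compact_refinement[OF S] by metis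
  obtain G' \<eta> where G': "G' \<le> sequentially" "G' \<noteq> bot" "\<And>z. ((\<lambda>n. blinfun_apply (e n) z) \<longlongrightarrow> blinfun_apply \<eta> z) G'"
    by (rule bounded_functionals_refinement[OF sequentially_bot, of e 1]) (use L e(1) in auto)
  have "\<epsilon> / 4 \<le> blinfun_apply \<eta> (w n)" for n
    by (rule tendsto_lowerbound[OF G'(3) eventually_le_filter[OF G'(1), of n] G'(2)]) (use w(2) in auto)
  then have "eventually (\<lambda>z. \<epsilon> / 4 \<le> blinfun_apply \<eta> z) ?F"
    by (simp add: eventually_filtermap)
  then have "\<epsilon> / 4 \<le> blinfun_apply \<eta> z"
    using tendsto_lowerbound[OF G(3) filter_leD[OF G(1)] G(2)] by blast
  moreover have "blinfun_apply (e i) z \<le> 0" for i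
  proof (rule field_le_epsilon)
    fix d :: real assume d: "0 < d"
    have "(\<lambda>n. (1/2::real) ^ n) \<longlonglongrightarrow> 0" by (rule LIMSEQ_power_zero) simp
    then have "eventually (\<lambda>n. (1/2::real) ^ n < d) sequentially" using d by (rule order_tendstoD)
    then have "eventually (\<lambda>n. blinfun_apply (e i) (w n) \<le> d) sequentially"
      using eventually_gt_at_top[of i]
    proof eventually_elim
      case (elim n)
      then show ?case using w(3)[of i n] by linarith
    qed
    then have "eventually (\<lambda>z. blinfun_apply (e i) z \<le> d) ?F" by (simp add: eventually_filtermap)
    then show "blinfun_apply (e i) z \<le> 0 + d"
      using tendsto_upperbound[OF G(3) filter_leD[OF G(1)] G(2)] by simp
  qed
  then have "blinfun_apply \<eta> z \<le> 0"
    by (intro tendsto_upperbound[OF G'(3) _ G'(2)]) simp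
  ultimately show False using \<epsilon> by simp
qed

text \<open>A weighted sum of controlling functionals for all \<open>\<epsilon> = 1 / (n + 1)\<close> works for all \<open>\<epsilon>\<close> at once.\<close>

lemma common_cone_functional:
  fixes c :: "'a::cstar_algebra self_adjoint \<Rightarrow> real"
  assumes "\<And>\<epsilon>. 0 < \<epsilon> \<Longrightarrow> \<exists>\<phi> \<delta>. cone_functional \<phi> \<and> 0 < \<delta> \<and>
    (\<forall>h. norm h < 1 \<longrightarrow> blinfun_apply \<phi> (sqr h) \<le> \<delta> \<longrightarrow> c h \<le> \<epsilon>)"
  obtains \<phi> where "cone_functional \<phi>"
    "\<And>\<epsilon>. 0 < \<epsilon> \<Longrightarrow> \<exists>\<delta>>0. \<forall>h. norm h < 1 \<longrightarrow> blinfun_apply \<phi> (sqr h) \<le> \<delta> \<longrightarrow> c h \<le> \<epsilon>"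
proof -
  have "\<exists>\<phi> \<delta>. cone_functional \<phi> \<and> 0 < \<delta> \<and>
    (\<forall>h. norm h < 1 \<longrightarrow> blinfun_apply \<phi> (sqr h) \<le> \<delta> \<longrightarrow> c h \<le> inverse (real (Suc n)))" for n
    by (rule assms) simp
  then obtain \<phi> \<delta> where \<phi>: "\<And>n. cone_functional (\<phi> n)" and \<delta>: "\<And>n. 0 < \<delta> n"
    and c: "\<And>n h. norm h < 1 \<Longrightarrow> blinfun_apply (\<phi> n) (sqr h) \<le> \<delta> n \<Longrightarrow> c h \<le> inverse (real (Suc n))"
    by metis
  define a where "a = (\<lambda>n. (1/2) ^ n / (1 + norm (\<phi> n)))"
  have a: "0 < a n" for n by (simp add: a_def add_pos_nonneg)
  have norm_le: "norm (a n *\<^sub>R \<phi> n) \<le> (1/2) ^ n" for n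
  proof -
    have "norm (\<phi> n) / (1 + norm (\<phi> n)) \<le> 1"
      by (simp add: add_pos_nonneg)
    then have "(1/2) ^ n * (norm (\<phi> n) / (1 + norm (\<phi> n))) \<le> (1/2) ^ n * 1"
      by (intro mult_left_mono) auto
    then show ?thesis by (simp add: a_def)
  qed
  have "summable (\<lambda>n. a n *\<^sub>R \<phi> n)"
    by (rule summable_comparison_test'[of "\<lambda>n. (1/2::real) ^ n" 0]) (use norm_le in \<open>auto intro: summable_geometric\<close>)
  note sm = this
  define \<psi> where "\<psi> = (\<Sum>n. a n *\<^sub>R \<phi> n)"
  have sums: "(\<lambda>n. a n * blinfun_apply (\<phi> n) v) sums blinfun_apply \<psi> v" for v
    using bounded_linear.sums[OF blinfun.bounded_linear_left summable_sums[OF sm], of v]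
    by (simp add: \<psi>_def blinfun.scaleR_left)
  have \<phi>_pos: "0 \<le> blinfun_apply (\<phi> n) v" if "v \<in> self_adjoint_cone" for n v
    using \<phi>[of n] that by (simp add: cone_functional_def positive_operator_def)
  have "cone_functional \<psi>"
    unfolding cone_functional_def positive_operator_def
  proof
    fix v :: "'a self_adjoint" assume v: "v \<in> self_adjoint_cone"
    have "0 \<le> a n * blinfun_apply (\<phi> n) v" for n
      using a[of n] \<phi>_pos[OF v, of n] by simp
    then show "blinfun_apply \<psi> v \<in> {0..}"
      using sums_le[OF _ sums_zero sums[of v]] by simp
  qed
  moreover have "\<exists>\<delta>>0. \<forall>h. norm h < 1 \<longrightarrow> blinfun_apply \<psi> (sqr h) \<le> \<delta> \<longrightarrow> c h \<le> \<epsilon>" if \<epsilon>: "0 < \<epsilon>" for \<epsilon>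
  proof -
    obtain n where n: "inverse (real (Suc n)) < \<epsilon>"
      using reals_Archimedean[OF \<epsilon>] by blast
    have "c h \<le> \<epsilon>" if h: "norm h < 1" "blinfun_apply \<psi> (sqr h) \<le> a n * \<delta> n" for h
    proof -
      have nn: "0 \<le> a k * blinfun_apply (\<phi> k) (sqr h)" for k
        using a[of k] \<phi>_pos[OF sqr_in_cone, of k h] by simp
      have "a n * blinfun_apply (\<phi> n) (sqr h) \<le> blinfun_apply \<psi> (sqr h)"
        using sum_le_suminf[OF sums_summable[OF sums], of "{n}" "sqr h"] nn sums_unique[OF sums[of "sqr h"]]
        by simp
      with h(2) have "a n * blinfun_apply (\<phi> n) (sqr h) \<le> a n * \<delta> n" by linarith
      then have "blinfun_apply (\<phi> n) (sqr h) \<le> \<delta> n"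
        using a[of n] by simp
      from c[OF h(1) this] n show ?thesis by linarith
    qed
    then show ?thesis using a[of n] \<delta>[of n] by (intro exI[of _ "a n * \<delta> n"]) auto
  qed
  ultimately show thesis by (rule that)
qed

lemma cone_functional_parallelogram:
  "blinfun_apply \<phi> (sqr (v + w)) + blinfun_apply \<phi> (sqr (v - w)) = 2 * blinfun_apply \<phi> (sqr v) + 2 * blinfun_apply \<phi> (sqr w)"
  for \<phi> :: "'a::cstar_algebra self_adjoint \<Rightarrow>\<^sub>L real"
  by (simp add: sqr_add sqr_diff blinfun.add_right blinfun.diff_right)

lemma functional_sqr_le: "norm v \<le> 1 \<Longrightarrow> blinfun_apply \<phi> (sqr v) \<le> norm \<phi>" for \<phi> :: "'a::cstar_algebra self_adjoint \<Rightarrow>\<^sub>L real"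
proof -
  assume v: "norm v \<le> 1"
  have "norm (sqr v) \<le> 1"
    using norm_jordan_le[of v v] v mult_mono[of "norm v" 1 "norm v" 1] by simp
  then have "norm \<phi> * norm (sqr v) \<le> norm \<phi>" by (simp add: mult_left_le)
  then show ?thesis using norm_blinfun[of \<phi> "sqr v"] by simp
qed

section \<open>Domination for operators on a C*-algebra\<close>

text \<open>
  For positive \<open>e\<close> the functionals \<open>e \<circ> S\<close> are positive, and they determine the norm of \<open>S\<close> on
  squares up to a constant, hence bound that of \<open>T\<close>. The resulting estimate in terms of \<open>\<phi>\<close>
  passes from squares to all elements, and \<open>v \<mapsto> \<phi> (v\<^sup>2)\<close> obeys the parallelogram law.
\<close>

lemma domination_from_self_adjoint:
  fixes P :: "'e::banach set" and S T :: "'a::cstar_algebra self_adjoint \<Rightarrow>\<^sub>L 'e"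
  assumes P: "convex_cone P" "normal_cone P"
    and T: "positive_operator self_adjoint_cone P T" and TS: "operator_le self_adjoint_cone P T S"
    and S: "weakly_compact_operator S"
  shows "weakly_compact_operator T"
proof -
  obtain C where C: "1 \<le> C" and mono: "\<And>a b. a \<in> P \<Longrightarrow> b - a \<in> P \<Longrightarrow> norm a \<le> C * norm b"
    and norming: "\<And>a. a \<in> P \<Longrightarrow> \<exists>e :: 'e \<Rightarrow>\<^sub>L real. norm e \<le> 1 \<and> (\<forall>b\<in>P. 0 \<le> blinfun_apply e b) \<and> norm a \<le> C * blinfun_apply e a"
    by (rule normal_cone_positive_functionals[OF P]) blast
  have TP: "T v \<in> P" and STP: "S v - T v \<in> P" if "v \<in> self_adjoint_cone" for v
    using T TS that by (simp_all add: operator_le_def positive_operator_def blinfun.diff_left)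
  have SP: "S v \<in> P" if "v \<in> self_adjoint_cone" for v
    using convex_cone_add[OF P(1) TP[OF that] STP[OF that]] by simp
  define \<L> where "\<L> = {e :: 'e \<Rightarrow>\<^sub>L real. norm e \<le> 1 \<and> (\<forall>b\<in>P. 0 \<le> blinfun_apply e b)}"
  have "\<exists>\<phi> \<delta>. cone_functional \<phi> \<and> 0 < \<delta> \<and>
    (\<forall>h. norm h < 1 \<longrightarrow> blinfun_apply \<phi> (sqr h) \<le> \<delta> \<longrightarrow> norm (T (sqr h)) \<le> \<epsilon>)" if \<epsilon>: "0 < \<epsilon>" for \<epsilon>
  proof -
    have "\<exists>\<phi> \<delta>. cone_functional \<phi> \<and> 0 < \<delta> \<and>
        (\<forall>e\<in>\<L>. \<forall>h. norm h < 1 \<longrightarrow> blinfun_apply \<phi> (sqr h) \<le> \<delta> \<longrightarrow> blinfun_apply e (S (sqr h)) \<le> \<epsilon> / (C * C))"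
    proof (rule weakly_compact_absolutely_continuous[OF S])
      show "0 < \<epsilon> / (C * C)" using \<epsilon> C by simp
      show "cone_functional (e o\<^sub>L S)" if "e \<in> \<L>" for e
        using that SP by (simp add: cone_functional_def positive_operator_def \<L>_def)
    qed (simp add: \<L>_def)
    then obtain \<phi> \<delta> where \<phi>: "cone_functional \<phi>" "0 < \<delta>" and
      *: "\<And>e h. e \<in> \<L> \<Longrightarrow> norm h < 1 \<Longrightarrow> blinfun_apply \<phi> (sqr h) \<le> \<delta> \<Longrightarrow> blinfun_apply e (S (sqr h)) \<le> \<epsilon> / (C * C)"
      by blast
    have "norm (T (sqr h)) \<le> \<epsilon>" if h: "norm h < 1" "blinfun_apply \<phi> (sqr h) \<le> \<delta>" for h
    proof -
      obtain e where e: "e \<in> \<L>" "norm (S (sqr h)) \<le> C * blinfun_apply e (S (sqr h))"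
        using norming[OF SP[OF sqr_in_cone]] by (auto simp: \<L>_def)
      have "norm (T (sqr h)) \<le> C * norm (S (sqr h))"
        by (intro mono TP STP sqr_in_cone)
      also have "\<dots> \<le> C * (C * (\<epsilon> / (C * C)))"
        using C by (intro mult_left_mono order_trans[OF e(2)] *[OF e(1) h]) auto
      also have "\<dots> = \<epsilon>" using C by simp
      finally show ?thesis .
    qed
    with \<phi> show ?thesis by blast
  qed
  then obtain \<phi> where \<phi>: "cone_functional \<phi>" and
    T_sqr: "\<And>\<epsilon>. 0 < \<epsilon> \<Longrightarrow> \<exists>\<delta>>0. \<forall>h. norm h < 1 \<longrightarrow> blinfun_apply \<phi> (sqr h) \<le> \<delta> \<longrightarrow> norm (T (sqr h)) \<le> \<epsilon>"
    by (rule common_cone_functional[of "\<lambda>h. norm (T (sqr h))"]) blast+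
  have T_small: "\<exists>\<delta>>0. \<forall>v. norm v \<le> 1 \<longrightarrow> blinfun_apply \<phi> (sqr v) \<le> \<delta> \<longrightarrow> norm (T v) \<le> \<epsilon>" if \<epsilon>: "0 < \<epsilon>" for \<epsilon>
  proof -
    obtain \<delta> where \<delta>: "0 < \<delta>" "\<And>h. norm h < 1 \<Longrightarrow> blinfun_apply \<phi> (sqr h) \<le> \<delta> \<Longrightarrow> norm (T (sqr h)) \<le> \<epsilon> / 16"
      using T_sqr[of "\<epsilon> / 16"] \<epsilon> by auto
    define k where "k = norm T + 1"
    have k: "0 < k" "norm T \<le> k" by (simp_all add: k_def add_nonneg_pos)
    define t where "t = \<epsilon> / (4 * k)"
    have t: "0 < t" using \<epsilon> k by (simp add: t_def)
    have "2 * t * norm T \<le> 2 * t * k" using t k by simp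
    also have "\<dots> = \<epsilon> / 2" using k by (simp add: t_def)
    finally have tT: "2 * t * norm T \<le> \<epsilon> / 2" .

    have r: "0 < 1 + 1 / t\<^sup>2" by (simp add: add_pos_nonneg)
    have "norm (T v) \<le> \<epsilon>" if "norm v \<le> 1" "blinfun_apply \<phi> (sqr v) \<le> \<delta> / (1 + 1 / t\<^sup>2)" for v
    proof -
      have "(1 + 1 / t\<^sup>2) * blinfun_apply \<phi> (sqr v) \<le> \<delta>"
        using that(2) r by (simp only: pos_le_divide_eq mult.commute)
      from bound_from_squares[OF \<phi> \<delta>(2) that(1) t this] tT show ?thesis by simp
    qed
    then show ?thesis using \<delta>(1) r by (intro exI[of _ "\<delta> / (1 + 1 / t\<^sup>2)"]) auto
  qed
  show ?thesis
  proof (rule weakly_compactI)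
    fix F and \<Psi> :: "('e \<Rightarrow>\<^sub>L real) \<Rightarrow> real"
    assume F: "F \<noteq> bot" "eventually (\<lambda>x::'a self_adjoint. norm x \<le> 1) F"
      and \<Psi>: "\<And>e. ((\<lambda>x. blinfun_apply e (T x)) \<longlongrightarrow> \<Psi> e) F"
    show "\<exists>w. \<forall>e. \<Psi> e = blinfun_apply e w"
    proof (rule parallelogram_weak_limit[where q = "\<lambda>v. blinfun_apply \<phi> (sqr v)" and u = "\<lambda>x. x" and R = T and c = "norm \<phi>"])
      show "blinfun_apply \<phi> (sqr ((1 / 2) *\<^sub>R v)) = blinfun_apply \<phi> (sqr v) / 4" for v
        by (simp add: sqr_scaleR blinfun.scaleR_right)
    qed (fact cone_functional_sqr[OF \<phi>] cone_functional_parallelogram functional_sqr_le T_small F \<Psi>)+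
  qed
qed

section \<open>Domination for operators into a dual\<close>

text \<open>The operator that sends \<open>v\<close> to the functional \<open>w \<mapsto> \<phi> ((v w + w v) / 2)\<close>.\<close>

definition jordan_functional :: "('a::cstar_algebra self_adjoint \<Rightarrow>\<^sub>L real) \<Rightarrow> 'a self_adjoint \<Rightarrow>\<^sub>L ('a self_adjoint \<Rightarrow>\<^sub>L real)"
  where "jordan_functional \<phi> = Blinfun (\<lambda>v. \<phi> o\<^sub>L jordan.prod_right v)"

lemma jordan_functional_apply: "blinfun_apply (blinfun_apply (jordan_functional \<phi>) v) w = blinfun_apply \<phi> (jordan v w)"
proof -
  have "bounded_linear (\<lambda>v. \<phi> o\<^sub>L jordan.prod_right v)"
    by (intro bounded_linear_compose[OF bounded_bilinear.bounded_linear_right[OF bounded_bilinear_blinfun_compose]]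
        jordan.bounded_linear_prod_right)
  then show ?thesis
    by (simp add: jordan_functional_def bounded_linear_Blinfun_apply)
qed

lemma norm_functional_le:
  fixes f :: "'x::real_normed_vector \<Rightarrow>\<^sub>L real"
  assumes "\<And>w. norm w \<le> 1 \<Longrightarrow> blinfun_apply f w \<le> b"
  shows "norm f \<le> b"
proof (rule norm_blinfun_bound)
  show "0 \<le> b" using assms[of 0] by (simp add: blinfun.zero_right)
  fix w :: 'x
  show "norm (blinfun_apply f w) \<le> b * norm w"
  proof (cases "w = 0")
    case False
    define z where "z = (1 / norm w) *\<^sub>R w"
    have z: "norm z \<le> 1" "w = norm w *\<^sub>R z" using False by (simp_all add: z_def)
    have "\<bar>blinfun_apply f z\<bar> \<le> b"
      using assms[of z] assms[of "- z"] z(1) by (simp add: blinfun.minus_right abs_le_iff)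
    then have "norm w * \<bar>blinfun_apply f z\<bar> \<le> norm w * b" by (intro mult_left_mono) auto
    moreover have "norm (blinfun_apply f w) = norm w * \<bar>blinfun_apply f z\<bar>"
      by (subst z(2)) (simp add: blinfun.scaleR_right abs_mult)
    ultimately show ?thesis by (simp add: mult.commute)
  qed (simp add: blinfun.zero_right)
qed

text \<open>The Cauchy--Schwarz inequality in additive form.\<close>

lemma norm_jordan_functional_le:
  assumes \<phi>: "cone_functional \<phi>" and c: "0 < c"
  shows "norm (blinfun_apply (jordan_functional \<phi>) v) \<le> c * blinfun_apply \<phi> (sqr v) + norm \<phi> / c"
proof (rule norm_functional_le)
  fix w :: "'a self_adjoint" assume w: "norm w \<le> 1"
  have "0 \<le> blinfun_apply \<phi> (sqr (c *\<^sub>R v - w))"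
    by (rule cone_functional_sqr[OF \<phi>])
  then have "2 * c * blinfun_apply \<phi> (jordan v w) \<le> c * c * blinfun_apply \<phi> (sqr v) + norm \<phi>"
    using functional_sqr_le[OF w, of \<phi>]
    by (simp add: sqr_diff jordan.scaleR_left jordan.scaleR_right blinfun.add_right blinfun.diff_right blinfun.scaleR_right)
  then have "2 * blinfun_apply \<phi> (jordan v w) \<le> c * blinfun_apply \<phi> (sqr v) + norm \<phi> / c"
    using c by (simp add: field_simps)
  moreover have "0 \<le> c * blinfun_apply \<phi> (sqr v) + norm \<phi> / c"
    using c cone_functional_sqr[OF \<phi>, of v] by simp
  ultimately show "blinfun_apply (blinfun_apply (jordan_functional \<phi>) v) w \<le> c * blinfun_apply \<phi> (sqr v) + norm \<phi> / c"
    by (simp add: jordan_functional_apply)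
qed

text \<open>
  A functional that is small where \<open>\<phi> (v\<^sup>2)\<close> is small is close in norm to \<open>\<kappa>\<close> times the image of the
  unit ball under this operator, with \<open>\<kappa>\<close> depending only on \<open>\<delta>\<close> and the norm bound. The element \<open>u\<close> is
  an almost maximal point of \<open>J v = 2 f v - \<kappa> \<phi> (v\<^sup>2)\<close> on the unit ball. Comparison with \<open>0\<close> shows
  that \<open>\<phi> (u\<^sup>2)\<close> is at most \<open>\<delta>\<close>, so \<open>f u\<close> is small, and variation of \<open>u\<close> in the direction \<open>w - u\<close> bounds
  the difference of the functionals at \<open>w\<close>.
\<close>

lemma approximate_jordan_functional:
  fixes f :: "'a::cstar_algebra self_adjoint \<Rightarrow>\<^sub>L real"
  assumes \<phi>: "cone_functional \<phi>" and \<epsilon>: "0 < \<epsilon>" and fC: "norm f \<le> C"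
    and f: "\<And>v. norm v \<le> 1 \<Longrightarrow> blinfun_apply \<phi> (sqr v) \<le> \<delta> \<Longrightarrow> blinfun_apply f v \<le> \<epsilon>"
    and \<kappa>: "0 < \<kappa>" "2 * C + 1 \<le> \<kappa> * \<delta>"
  shows "\<exists>u. norm u \<le> 1 \<and> norm (f - \<kappa> *\<^sub>R blinfun_apply (jordan_functional \<phi>) u) \<le> 2 * \<epsilon>"
proof -
  define J where "J = (\<lambda>v. 2 * blinfun_apply f v - \<kappa> * blinfun_apply \<phi> (sqr v))"
  have f_le: "blinfun_apply f v \<le> C" if "norm v \<le> 1" for v
  proof -
    have "0 \<le> C" using fC norm_ge_zero[of f] by linarith
    then show ?thesis
      using norm_blinfun[of f v] that fC mult_mono[of "norm f" C "norm v" 1] by simp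
  qed
  have J_le: "J v \<le> 2 * C" if "norm v \<le> 1" for v
    using f_le[OF that] mult_nonneg_nonneg[OF less_imp_le[OF \<kappa>(1)] cone_functional_sqr[OF \<phi>, of v]]
    unfolding J_def by linarith
  define s where "s = min 1 (\<epsilon> / (4 * \<kappa> * norm \<phi> + 1))"
  have d: "0 < 4 * \<kappa> * norm \<phi> + 1" using \<kappa>(1) by (simp add: add_nonneg_pos)
  have s: "0 < s" "s \<le> 1" using \<epsilon> d by (simp_all add: s_def)
  have "s * (4 * \<kappa> * norm \<phi>) \<le> s * (4 * \<kappa> * norm \<phi> + 1)" using s by simp
  also have "\<dots> \<le> \<epsilon> / (4 * \<kappa> * norm \<phi> + 1) * (4 * \<kappa> * norm \<phi> + 1)"
    using d by (intro mult_right_mono) (auto simp: s_def)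
  also have "\<dots> = \<epsilon>" using d by simp
  finally have s_phi: "s * (4 * \<kappa> * norm \<phi>) \<le> \<epsilon>" .
  define \<eta> where "\<eta> = min 1 (s * \<epsilon>)"
  have \<eta>: "0 < \<eta>" "\<eta> \<le> 1" "\<eta> \<le> s * \<epsilon>" using s \<epsilon> by (auto simp: \<eta>_def)
  obtain u where u: "norm u \<le> 1" and max: "\<And>v. norm v \<le> 1 \<Longrightarrow> J v \<le> J u + \<eta>"
  proof -
    have bdd: "bdd_above (J ` cball 0 1)" using J_le by (intro bdd_aboveI2[of _ _ "2 * C"]) auto
    let ?M = "SUP v\<in>cball 0 1. J v"
    have "?M - \<eta> < ?M" using \<eta>(1) by simp
    then obtain u where u: "u \<in> cball 0 1" "?M - \<eta> < J u"
      using less_cSUP_iff[OF _ bdd, of "?M - \<eta>"] by auto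
    have "J v \<le> J u + \<eta>" if v: "norm v \<le> 1" for v
    proof -
      have "J v \<le> ?M" using v by (intro cSUP_upper bdd) auto
      then show ?thesis using u(2) by linarith
    qed
    with u(1) show thesis by (intro that[of u]) auto
  qed
  let ?g = "f - \<kappa> *\<^sub>R blinfun_apply (jordan_functional \<phi>) u"
  have g: "blinfun_apply ?g w = blinfun_apply f w - \<kappa> * blinfun_apply \<phi> (jordan u w)" for w
    by (simp add: blinfun.diff_left blinfun.scaleR_left jordan_functional_apply)
  have "J 0 = 0" by (simp add: J_def blinfun.zero_right jordan.zero_left)
  then have "0 \<le> J u + \<eta>" using max[of 0] by simp
  then have "\<kappa> * blinfun_apply \<phi> (sqr u) \<le> 2 * C + 1"
    using f_le[OF u] \<eta>(2) unfolding J_def by linarith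
  then have "\<kappa> * blinfun_apply \<phi> (sqr u) \<le> \<kappa> * \<delta>" using \<kappa>(2) by linarith
  then have "blinfun_apply \<phi> (sqr u) \<le> \<delta>" using \<kappa>(1) by simp
  from f[OF u this] have gu: "blinfun_apply ?g u \<le> \<epsilon>"
    using mult_nonneg_nonneg[OF less_imp_le[OF \<kappa>(1)] cone_functional_sqr[OF \<phi>, of u]]
    unfolding g by linarith
  have "norm ?g \<le> 2 * \<epsilon>"
  proof (rule norm_functional_le)
    fix w :: "'a self_adjoint" assume w: "norm w \<le> 1"
    let ?d = "w - u"
    have "u + s *\<^sub>R ?d = (1 - s) *\<^sub>R u + s *\<^sub>R w" by (simp add: algebra_simps)
    also have "norm \<dots> \<le> (1 - s) * norm u + s * norm w"
      using s by (intro norm_triangle_le) auto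
    also have "\<dots> \<le> (1 - s) * 1 + s * 1"
      using s u w by (intro add_mono mult_left_mono) auto
    finally have "J (u + s *\<^sub>R ?d) \<le> J u + \<eta>" by (intro max) simp
    moreover have "J (u + s *\<^sub>R ?d) = J u + 2 * s * blinfun_apply ?g ?d - s * s * (\<kappa> * blinfun_apply \<phi> (sqr ?d))"
      unfolding g J_def sqr_add[of u "s *\<^sub>R ?d"] jordan.scaleR_left jordan.scaleR_right
      by (simp add: blinfun.add_right blinfun.scaleR_right algebra_simps del: scaleR_right_diff_distrib)
    ultimately have 1: "2 * s * blinfun_apply ?g ?d \<le> s * \<epsilon> + s * s * (\<kappa> * blinfun_apply \<phi> (sqr ?d))"
      using \<eta>(3) by linarith
    have "blinfun_apply \<phi> (sqr ?d) \<le> 4 * norm \<phi>"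
    proof -
      have "norm ((1/2) *\<^sub>R ?d) \<le> 1" using norm_triangle_ineq4[of w u] u w by simp
      from functional_sqr_le[OF this, of \<phi>] show ?thesis by (simp add: sqr_scaleR blinfun.scaleR_right)
    qed
    then have "s * (\<kappa> * blinfun_apply \<phi> (sqr ?d)) \<le> s * (\<kappa> * (4 * norm \<phi>))"
      using s \<kappa>(1) by (intro mult_left_mono) auto
    also have "\<dots> \<le> \<epsilon>" using s_phi by (simp add: algebra_simps)
    finally have "s * (s * (\<kappa> * blinfun_apply \<phi> (sqr ?d))) \<le> s * \<epsilon>"
      using s by (intro mult_left_mono) auto
    with 1 have "s * (2 * blinfun_apply ?g ?d) \<le> s * (2 * \<epsilon>)"
      by (simp add: algebra_simps)
    then have "blinfun_apply ?g ?d \<le> \<epsilon>" using s by simp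
    with gu show "blinfun_apply ?g w \<le> 2 * \<epsilon>"
      unfolding blinfun.diff_right[of ?g w u] by linarith
  qed
  with u show ?thesis by blast
qed

lemma norming_evaluations:
  fixes y :: "'x::real_normed_vector \<Rightarrow>\<^sub>L real"
  assumes c: "0 \<le> c" and y: "\<And>e :: ('x \<Rightarrow>\<^sub>L real) \<Rightarrow>\<^sub>L real. \<bar>blinfun_apply e y\<bar> \<le> c * norm e"
  shows "norm y \<le> c"
proof (rule norm_functional_le)
  fix w :: 'x assume w: "norm w \<le> 1"
  have "blinfun_apply y w \<le> c * norm (evaluation w)"
    using y[of "evaluation w"] by (simp add: evaluation_apply)
  also have "\<dots> \<le> c * 1"
    using c w norm_evaluation_le[of w] by (intro mult_left_mono) auto
  finally show "blinfun_apply y w \<le> c" by simp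
qed

text \<open>
  On \<open>P\<close> the functionals \<open>T x\<close> inherit the uniform absolute continuity of the \<open>S x\<close>, and by density
  the estimate extends to all \<open>x\<close> in the unit ball. Up to \<open>\<epsilon>\<close>, the image of the ball under \<open>T\<close> then lies
  in the image of a ball under a multiple of \<^term>\<open>jordan_functional \<phi>\<close>, which is weakly compact by
  the parallelogram criterion.
\<close>

lemma domination_into_dual:
  fixes P :: "'e::banach set" and S T :: "'e \<Rightarrow>\<^sub>L ('a::cstar_algebra self_adjoint \<Rightarrow>\<^sub>L real)"
  assumes P: "convex_cone P" "generating_cone P"
    and T: "\<And>x. x \<in> P \<Longrightarrow> cone_functional (T x)"
    and TS: "\<And>x. x \<in> P \<Longrightarrow> cone_functional (S x - T x)"
    and S: "weakly_compact_operator S"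
  shows "weakly_compact_operator T"
proof -
  obtain r where r: "0 < r"
    "cball 0 r \<subseteq> closure {a - b | a b. a \<in> P \<and> b \<in> P \<and> norm a \<le> 1 \<and> norm b \<le> 1}"
    by (rule generating_cone_dense_ball[OF P]) blast
  have SP: "cone_functional (S x)" if "x \<in> P" for x
    using cone_functional_add[OF T[OF that] TS[OF that]] by simp
  have T_norm: "norm (T x) \<le> norm T" if "norm x \<le> 1" for x
    using norm_blinfun[of T x] that mult_left_le[of "norm x" "norm T"] by simp
  have T_small: "\<exists>\<phi> \<delta>. cone_functional \<phi> \<and> 0 < \<delta> \<and> (\<forall>x v. norm x \<le> 1 \<longrightarrow> norm v \<le> 1 \<longrightarrow>
      blinfun_apply \<phi> (sqr v) \<le> \<delta> \<longrightarrow> blinfun_apply (T x) v \<le> \<epsilon>)" if \<epsilon>: "0 < \<epsilon>" for \<epsilon>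
  proof -
    define \<epsilon>' where "\<epsilon>' = r * \<epsilon> / 32"
    have \<epsilon>': "0 < \<epsilon>'" using r(1) \<epsilon> by (simp add: \<epsilon>'_def)
    define k where "k = norm T + 1"
    have k: "0 < k" "norm T \<le> k" by (simp_all add: k_def add_nonneg_pos)
    define t where "t = r * \<epsilon> / (8 * k)"
    have t: "0 < t" using r(1) \<epsilon> k by (simp add: t_def)
    have "4 * t * norm T \<le> 4 * t * k" using t k by simp
    also have "\<dots> = r * \<epsilon> / 2" using k by (simp add: t_def)
    finally have tT: "4 * t * norm T \<le> r * \<epsilon> / 2" .
    have "\<exists>\<phi> \<delta>. cone_functional \<phi> \<and> 0 < \<delta> \<and> (\<forall>x\<in>P \<inter> cball 0 1. \<forall>h. norm h < 1 \<longrightarrow>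
        blinfun_apply \<phi> (sqr h) \<le> \<delta> \<longrightarrow> blinfun_apply (S x) (sqr h) \<le> \<epsilon>')"
      by (rule weakly_compact_dual_absolutely_continuous[OF S _ _ \<epsilon>']) (use SP in auto)
    then obtain \<phi> \<delta> where \<phi>: "cone_functional \<phi>" and \<delta>: "0 < \<delta>" and
      S_sqr: "\<And>x h. x \<in> P \<Longrightarrow> norm x \<le> 1 \<Longrightarrow> norm h < 1 \<Longrightarrow> blinfun_apply \<phi> (sqr h) \<le> \<delta> \<Longrightarrow>
        blinfun_apply (S x) (sqr h) \<le> \<epsilon>'"
      by auto
    have T_sqr: "norm (blinfun_apply (T x) (sqr h)) \<le> \<epsilon>'"
      if "x \<in> P" "norm x \<le> 1" "norm h < 1" "blinfun_apply \<phi> (sqr h) \<le> \<delta>" for x h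
      using S_sqr[OF that] cone_functional_sqr[OF T[OF that(1)], of h] cone_functional_sqr[OF TS[OF that(1)], of h]
      by (simp add: blinfun.diff_left)
    have q: "0 < 1 + 1 / t\<^sup>2" by (simp add: add_pos_nonneg)
    have "blinfun_apply (T x) v \<le> \<epsilon>"
      if x: "norm x \<le> 1" and v: "norm v \<le> 1" "blinfun_apply \<phi> (sqr v) \<le> \<delta> / (1 + 1 / t\<^sup>2)" for x v
    proof -
      let ?b = "8 * \<epsilon>' + 2 * t * norm T"
      let ?D = "{a - b | a b. a \<in> P \<and> b \<in> P \<and> norm a \<le> 1 \<and> norm b \<le> 1}"
      have v2: "(1 + 1 / t\<^sup>2) * blinfun_apply \<phi> (sqr v) \<le> \<delta>"
        using v(2) q by (simp only: pos_le_divide_eq mult.commute)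
      have Ta: "\<bar>blinfun_apply (T a) v\<bar> \<le> ?b" if a: "a \<in> P" "norm a \<le> 1" for a
      proof -
        have "norm (blinfun_apply (T a) v) \<le> 8 * \<epsilon>' + 2 * t * norm (T a)"
          by (rule bound_from_squares[OF \<phi> T_sqr[OF a] v(1) t v2])
        also have "\<dots> \<le> ?b"
          using t T_norm[OF a(2)] by simp
        finally show ?thesis by simp
      qed
      have "?D \<subseteq> {z. \<bar>blinfun_apply (T z) v\<bar> \<le> 2 * ?b}"
      proof clarify
        fix a b assume "a \<in> P" "b \<in> P" "norm a \<le> 1" "norm b \<le> 1"
        then show "\<bar>blinfun_apply (T (a - b)) v\<bar> \<le> 2 * ?b"
          using Ta[of a] Ta[of b] by (simp add: blinfun.diff_right blinfun.diff_left)
      qed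
      moreover have "closed {z. \<bar>blinfun_apply (T z) v\<bar> \<le> 2 * ?b}"
        by (intro closed_Collect_le continuous_intros)
      ultimately have "closure ?D \<subseteq> {z. \<bar>blinfun_apply (T z) v\<bar> \<le> 2 * ?b}"
        by (rule closure_minimal)
      moreover have "r *\<^sub>R x \<in> closure ?D"
        using r x by (intro subsetD[OF r(2)]) (simp add: mult_left_le)
      ultimately have "\<bar>blinfun_apply (T (r *\<^sub>R x)) v\<bar> \<le> 2 * ?b"
        by blast
      then have "r * blinfun_apply (T x) v \<le> 16 * \<epsilon>' + 4 * t * norm T"
        by (simp add: blinfun.scaleR_right blinfun.scaleR_left)
      also have "\<dots> \<le> r * \<epsilon>"
      proof -
        have "16 * \<epsilon>' = r * \<epsilon> / 2" by (simp add: \<epsilon>'_def)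
        with tT show ?thesis by linarith
      qed
      finally show ?thesis using r(1) by simp
    qed
    then show ?thesis using \<phi> \<delta> q by (intro exI[of _ \<phi>] exI[of _ "\<delta> / (1 + 1 / t\<^sup>2)"]) auto
  qed
  show ?thesis
  proof (rule weakly_compactI)
    fix F and \<Psi> :: "(('a self_adjoint \<Rightarrow>\<^sub>L real) \<Rightarrow>\<^sub>L real) \<Rightarrow> real"
    assume F: "F \<noteq> bot" "eventually (\<lambda>x::'e. norm x \<le> 1) F"
      and \<Psi>: "\<And>e. ((\<lambda>x. blinfun_apply e (T x)) \<longlongrightarrow> \<Psi> e) F"
    show "\<exists>w. \<forall>e. \<Psi> e = blinfun_apply e w"
    proof (rule evaluation_limit[OF norming_evaluations])
      fix \<epsilon> :: real assume \<epsilon>: "0 < \<epsilon>"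
      obtain \<phi> \<delta> where \<phi>: "cone_functional \<phi>" and \<delta>: "0 < \<delta>"
        and small: "\<And>x v. norm x \<le> 1 \<Longrightarrow> norm v \<le> 1 \<Longrightarrow> blinfun_apply \<phi> (sqr v) \<le> \<delta> \<Longrightarrow> blinfun_apply (T x) v \<le> \<epsilon> / 2"
        using T_small[of "\<epsilon> / 2"] \<epsilon> by auto
      define \<kappa> where "\<kappa> = (2 * norm T + 1) / \<delta>"
      have \<kappa>: "0 < \<kappa>" "2 * norm T + 1 \<le> \<kappa> * \<delta>"
        using \<delta> by (simp_all add: \<kappa>_def add_nonneg_pos)
      define R where "R = \<kappa> *\<^sub>R jordan_functional \<phi>"
      have "\<exists>u. norm x \<le> 1 \<longrightarrow> norm u \<le> 1 \<and> norm (T x - R u) \<le> \<epsilon>" for x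
        using approximate_jordan_functional[OF \<phi> _ T_norm small \<kappa>, of x] \<epsilon>
        by (auto simp: R_def blinfun.scaleR_left)
      then obtain u where u: "\<And>x. norm x \<le> 1 \<Longrightarrow> norm (u x) \<le> 1"
        "\<And>x. norm x \<le> 1 \<Longrightarrow> norm (T x - R (u x)) \<le> \<epsilon>"
        by metis
      have "eventually (\<lambda>x. \<forall>e :: ('a self_adjoint \<Rightarrow>\<^sub>L real) \<Rightarrow>\<^sub>L real. \<bar>blinfun_apply e (R (u x))\<bar> \<le> norm e * norm R) F"
        using F(2)
      proof (rule eventually_mono, intro allI)
        fix x :: 'e and e :: "('a self_adjoint \<Rightarrow>\<^sub>L real) \<Rightarrow>\<^sub>L real" assume x: "norm x \<le> 1"
        have "norm (R (u x)) \<le> norm R"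
          using norm_blinfun[of R "u x"] u(1)[OF x] mult_left_le[of "norm (u x)" "norm R"] by simp
        then have "norm e * norm (R (u x)) \<le> norm e * norm R" by (rule mult_left_mono) simp
        then show "\<bar>blinfun_apply e (R (u x))\<bar> \<le> norm e * norm R"
          using norm_blinfun[of e "R (u x)"] by simp
      qed
      from pointwise_refinement[OF F(1) this]
      obtain G \<Psi>' where G: "G \<le> F" "G \<noteq> bot"
        "\<And>e :: ('a self_adjoint \<Rightarrow>\<^sub>L real) \<Rightarrow>\<^sub>L real. ((\<lambda>x. blinfun_apply e (R (u x))) \<longlongrightarrow> \<Psi>' e) G"
        by blast
      have FG: "eventually (\<lambda>x. norm x \<le> 1) G" by (rule filter_leD[OF G(1) F(2)])
      have "\<exists>w. \<forall>e. \<Psi>' e = blinfun_apply e w"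
      proof (rule parallelogram_weak_limit[where q = "\<lambda>v. blinfun_apply \<phi> (sqr v)" and c = "norm \<phi>"])
        show "blinfun_apply \<phi> (sqr ((1 / 2) *\<^sub>R v)) = blinfun_apply \<phi> (sqr v) / 4" for v
          by (simp add: sqr_scaleR blinfun.scaleR_right)
        show "eventually (\<lambda>x. norm (u x) \<le> 1) G"
          using FG by (rule eventually_mono) (rule u(1))
        fix d :: real assume d: "0 < d"
        define c where "c = 2 * \<kappa> * norm \<phi> / d + 1"
        have c: "0 < c" "2 * \<kappa> * norm \<phi> \<le> c * d"
        proof -
          have "0 \<le> 2 * \<kappa> * norm \<phi> / d" using \<kappa>(1) d by simp
          then show "0 < c" by (simp add: c_def)
          show "2 * \<kappa> * norm \<phi> \<le> c * d" using d by (simp add: c_def distrib_right)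
        qed
        have "norm (R v) \<le> d" if "blinfun_apply \<phi> (sqr v) \<le> d / (2 * \<kappa> * c)" for v
        proof -
          have "norm (R v) = \<kappa> * norm (blinfun_apply (jordan_functional \<phi>) v)"
            using \<kappa>(1) by (simp add: R_def blinfun.scaleR_left)
          also have "\<dots> \<le> \<kappa> * (c * blinfun_apply \<phi> (sqr v) + norm \<phi> / c)"
            using \<kappa>(1) by (intro mult_left_mono norm_jordan_functional_le[OF \<phi> c(1)]) simp
          also have "\<dots> \<le> \<kappa> * (c * (d / (2 * \<kappa> * c)) + norm \<phi> / c)"
            using \<kappa>(1) c(1) that by (intro mult_left_mono add_right_mono) auto
          also have "\<dots> = d / 2 + \<kappa> * norm \<phi> / c"
            using \<kappa>(1) c(1) by (simp add: field_simps)
          also have "\<kappa> * norm \<phi> / c \<le> d / 2"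
            using c by (simp add: field_simps)
          finally show ?thesis by simp
        qed
        then show "\<exists>\<delta>>0. \<forall>v. norm v \<le> 1 \<longrightarrow> blinfun_apply \<phi> (sqr v) \<le> \<delta> \<longrightarrow> norm (R v) \<le> d"
          using \<kappa>(1) c(1) d by (intro exI[of _ "d / (2 * \<kappa> * c)"]) auto
      qed (fact cone_functional_sqr[OF \<phi>] cone_functional_parallelogram functional_sqr_le G)+
      then obtain w where w: "\<And>e. \<Psi>' e = blinfun_apply e w" by blast
      have "\<bar>\<Psi> e - blinfun_apply e w\<bar> \<le> \<epsilon> * norm e" for e
      proof -
        have "((\<lambda>x. \<bar>blinfun_apply e (T x) - blinfun_apply e (R (u x))\<bar>) \<longlongrightarrow> \<bar>\<Psi> e - \<Psi>' e\<bar>) G"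
          by (intro tendsto_intros tendsto_mono[OF G(1) \<Psi>] G(3))
        moreover have "eventually (\<lambda>x. \<bar>blinfun_apply e (T x) - blinfun_apply e (R (u x))\<bar> \<le> \<epsilon> * norm e) G"
          using FG
        proof (rule eventually_mono)
          fix x :: 'e assume x: "norm x \<le> 1"
          have "norm e * norm (T x - R (u x)) \<le> norm e * \<epsilon>"
            using u(2)[OF x] by (intro mult_left_mono) auto
          then show "\<bar>blinfun_apply e (T x) - blinfun_apply e (R (u x))\<bar> \<le> \<epsilon> * norm e"
            using norm_blinfun[of e "T x - R (u x)"] by (simp add: blinfun.diff_right mult.commute)
        qed
        ultimately have "\<bar>\<Psi> e - \<Psi>' e\<bar> \<le> \<epsilon> * norm e"
          using G(2) by (rule tendsto_upperbound)
        then show ?thesis by (simp add: w)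
      qed
      then show "\<exists>w. \<forall>e. \<bar>\<Psi> e - blinfun_apply e w\<bar> \<le> \<epsilon> * norm e" by blast
    qed
  qed
qed

section \<open>The hermitian dual as the dual of the self-adjoint part\<close>

lemma bounded_linear_sa_elem: "bounded_linear (sa_elem :: 'a::cstar_algebra self_adjoint \<Rightarrow> 'a)"
  by (rule bounded_linear_intro[of _ 1])
    (simp_all add: plus_self_adjoint.rep_eq scaleR_self_adjoint.rep_eq norm_self_adjoint.rep_eq)

text \<open>
  A hermitian functional is real on self-adjoint elements. Taking the real part makes the
  restriction real-valued by type.
\<close>

definition restrict_functional :: "'a::cstar_algebra hermitian_dual \<Rightarrow> 'a self_adjoint \<Rightarrow>\<^sub>L real"
  where "restrict_functional f = Blinfun (\<lambda>v. Re (blinfun_apply (functional f) (sa_elem v)))"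

lemma restrict_functional_apply:
  "blinfun_apply (restrict_functional f) v = Re (blinfun_apply (functional f) (sa_elem v))"
proof -
  have "bounded_linear (\<lambda>v. Re (blinfun_apply (functional f) (sa_elem v)))"
    by (intro bounded_linear_compose[OF bounded_linear_Re] bounded_linear_compose[OF blinfun.bounded_linear_right]
        bounded_linear_sa_elem)
  then show ?thesis by (simp add: restrict_functional_def bounded_linear_Blinfun_apply)
qed

lemma bounded_linear_restrict_functional:
  "bounded_linear (restrict_functional :: 'a::cstar_algebra hermitian_dual \<Rightarrow> _)"
proof (rule bounded_linear_intro[of _ 1])
  fix f g :: "'a hermitian_dual" and c :: real
  show "restrict_functional (f + g) = restrict_functional f + restrict_functional g"
    by (rule blinfun_eqI) (simp add: restrict_functional_apply plus_hermitian_dual.rep_eq blinfun.add_left)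
  show "restrict_functional (c *\<^sub>R f) = c *\<^sub>R restrict_functional f"
    by (rule blinfun_eqI) (simp add: restrict_functional_apply scaleR_hermitian_dual.rep_eq blinfun.scaleR_left)
  have "norm (restrict_functional f) \<le> norm f"
  proof (rule norm_blinfun_bound)
    fix v :: "'a self_adjoint"
    have "\<bar>Re (blinfun_apply (functional f) (sa_elem v))\<bar> \<le> norm (blinfun_apply (functional f) (sa_elem v))"
      by (rule abs_Re_le_cmod)
    also have "\<dots> \<le> norm f * norm v"
      using norm_blinfun[of "functional f" "sa_elem v"]
      by (simp add: norm_hermitian_dual.rep_eq norm_self_adjoint.rep_eq)
    finally show "norm (blinfun_apply (restrict_functional f) v) \<le> norm f * norm v"
      by (simp add: restrict_functional_apply)
  qed simp
  then show "norm (restrict_functional f) \<le> norm f * 1" by simp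
qed

text \<open>
  The complex-linear extension; the self-adjoint imaginary part of \<open>a\<close> is the real part of \<open>- \<i> a\<close>.
\<close>

definition complexify :: "('a::cstar_algebra self_adjoint \<Rightarrow>\<^sub>L real) \<Rightarrow> 'a \<Rightarrow> complex"
  where "complexify g a = Complex (blinfun_apply g (real_part a)) (blinfun_apply g (real_part (- \<i> *\<^sub>C a)))"

lemmas linear_real_part = bounded_linear.linear[OF bounded_linear_real_part]

lemma real_part_star: "real_part (star a) = real_part a"
  by transfer (simp add: star_star add.commute)

lemma scaleC_uminus_left: "(- c) *\<^sub>C a = - (c *\<^sub>C (a::'a::complex_normed_vector))"
  by (metis add.right_inverse add_eq_0_iff scaleC_add_left scaleC_of_real of_real_0 scaleR_zero_left)

lemma scaleC_scaleR: "c *\<^sub>C r *\<^sub>R a = r *\<^sub>R c *\<^sub>C (a::'a::complex_normed_vector)"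
  by (simp add: scaleC_scaleC mult.commute flip: scaleC_of_real)

lemma complexify_add: "complexify g (a + b) = complexify g a + complexify g b"
  by (simp add: complexify_def scaleC_add_right linear_add[OF linear_real_part] blinfun.add_right complex_eq_iff)

lemma complexify_scaleR: "complexify g (r *\<^sub>R a) = r *\<^sub>R complexify g a"
  by (simp add: complexify_def scaleC_scaleR linear_scale[OF linear_real_part] blinfun.scaleR_right complex_eq_iff)

lemma complexify_i: "complexify g (\<i> *\<^sub>C a) = \<i> * complexify g a"
proof -
  have "- \<i> *\<^sub>C \<i> *\<^sub>C a = a"
    using scaleC_of_real[of 1 a] by (simp add: scaleC_scaleC)
  then show ?thesis
    by (simp add: complexify_def complex_eq_iff scaleC_uminus_left linear_neg[OF linear_real_part] blinfun.minus_right)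
qed

lemma complexify_scaleC: "complexify g (c *\<^sub>C a) = c * complexify g a"
proof -
  have "c *\<^sub>C a = Re c *\<^sub>R a + Im c *\<^sub>R (\<i> *\<^sub>C a)"
  proof -
    have "c = complex_of_real (Re c) + complex_of_real (Im c) * \<i>"
      by (simp add: complex_eq_iff)
    then have "c *\<^sub>C a = (complex_of_real (Re c) + complex_of_real (Im c) * \<i>) *\<^sub>C a"
      by (rule arg_cong)
    then show ?thesis
      by (simp only: scaleC_add_left scaleC_of_real flip: scaleC_scaleC)
  qed
  then have "complexify g (c *\<^sub>C a) = Re c *\<^sub>R complexify g a + Im c *\<^sub>R (\<i> * complexify g a)"
    by (simp only: complexify_add complexify_scaleR complexify_i)
  then show ?thesis
    by (simp add: complex_eq_iff)
qed

lemma complexify_star: "complexify g (star a) = cnj (complexify g a)"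
proof -
  have "real_part (- \<i> *\<^sub>C star a) = real_part (star (\<i> *\<^sub>C a))"
    by (simp add: star_scaleC)
  also have "\<dots> = - real_part (- \<i> *\<^sub>C a)"
    by (simp add: real_part_star scaleC_uminus_left linear_neg[OF linear_real_part])
  finally show ?thesis
    by (simp add: complexify_def complex_eq_iff real_part_star blinfun.minus_right)
qed

lemma norm_complexify_le: "norm (complexify g a) \<le> 2 * norm g * norm a"
proof -
  have "\<bar>blinfun_apply g (real_part b)\<bar> \<le> norm g * norm b" for b
    using norm_blinfun[of g "real_part b"] mult_left_mono[OF norm_real_part_le[of b] norm_ge_zero[of g]] by simp
  from this[of a] this[of "- \<i> *\<^sub>C a"] show ?thesis
    using cmod_le[of "complexify g a"] by (simp add: complexify_def norm_scaleC)
qed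

lemma bounded_linear_complexify: "bounded_linear (complexify g)"
  by (rule bounded_linear_intro[of _ "2 * norm g"])
    (use norm_complexify_le[of g] in \<open>simp_all add: complexify_add complexify_scaleR mult.commute\<close>)

text \<open>The inverse of \<^const>\<open>restrict_functional\<close>.\<close>

definition extend_functional :: "('a::cstar_algebra self_adjoint \<Rightarrow>\<^sub>L real) \<Rightarrow> 'a hermitian_dual"
  where "extend_functional g = Abs_hermitian_dual (Blinfun (complexify g))"

lemma functional_extend_functional: "blinfun_apply (functional (extend_functional g)) a = complexify g a"
  unfolding extend_functional_def
  by (subst Abs_hermitian_dual_inverse)
    (simp_all add: bounded_linear_Blinfun_apply[OF bounded_linear_complexify] complexify_scaleC complexify_star)

lemma hermitian_dual_eqI: "(\<And>a. blinfun_apply (functional f) a = blinfun_apply (functional g) a) \<Longrightarrow> f = g"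
  by (metis blinfun_eqI functional_inject)

lemma bounded_linear_extend_functional:
  "bounded_linear (extend_functional :: ('a::cstar_algebra self_adjoint \<Rightarrow>\<^sub>L real) \<Rightarrow> _)"
proof (rule bounded_linear_intro[of _ 2])
  fix f g :: "'a self_adjoint \<Rightarrow>\<^sub>L real" and c :: real
  show "extend_functional (f + g) = extend_functional f + extend_functional g"
    by (rule hermitian_dual_eqI)
      (simp add: functional_extend_functional plus_hermitian_dual.rep_eq blinfun.add_left complexify_def complex_eq_iff)
  show "extend_functional (c *\<^sub>R f) = c *\<^sub>R extend_functional f"
    by (rule hermitian_dual_eqI)
      (simp add: functional_extend_functional scaleR_hermitian_dual.rep_eq blinfun.scaleR_left complexify_def complex_eq_iff)
  have "norm (functional (extend_functional f)) \<le> 2 * norm f"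
    by (rule norm_blinfun_bound) (simp_all add: functional_extend_functional norm_complexify_le)
  then show "norm (extend_functional f) \<le> norm f * 2"
    by (simp add: norm_hermitian_dual.rep_eq mult.commute)
qed

lemma real_part_decomposition:
  "sa_elem (real_part a) + \<i> *\<^sub>C sa_elem (real_part (- \<i> *\<^sub>C a)) = (a::'a::cstar_algebra)"
proof -
  have "\<i> *\<^sub>C (- \<i> *\<^sub>C a + star (- \<i> *\<^sub>C a)) = 1 *\<^sub>R a + (- 1) *\<^sub>R star a"
    by (simp add: scaleC_add_right star_scaleC scaleC_scaleC flip: scaleC_of_real)
  then show ?thesis
    by (simp add: real_part.rep_eq scaleC_scaleR flip: scaleR_add_right scaleR_2)
qed

lemma extend_restrict_functional: "extend_functional (restrict_functional f) = f"
proof (rule hermitian_dual_eqI)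
  fix a :: 'a
  let ?f = "blinfun_apply (functional f)"
  have f: "?f (c *\<^sub>C x) = c * ?f x" "?f (star x) = cnj (?f x)" for c x
    using functional[of f] by auto
  have real: "complex_of_real (Re (?f (sa_elem v))) = ?f (sa_elem v)" for v
    using f(2)[of "sa_elem v"] sa_elem[of v] by (simp add: complex_eq_iff)
  have "?f a = ?f (sa_elem (real_part a)) + \<i> * ?f (sa_elem (real_part (- \<i> *\<^sub>C a)))"
    by (subst real_part_decomposition[symmetric]) (simp only: blinfun.add_right f(1))
  then show "blinfun_apply (functional (extend_functional (restrict_functional f))) a = ?f a"
    by (simp add: functional_extend_functional complexify_def restrict_functional_apply Complex_eq real)
qed

lemma cone_functional_restrict_functional:
  assumes "f \<in> positive_functionals"
  shows "cone_functional (restrict_functional f)"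
  using assms
  by (auto simp: cone_functional_def positive_operator_def restrict_functional_apply positive_functionals_def
      self_adjoint_cone_def elim!: nonneg_Reals_cases)

section \<open>The domination theorem\<close>

theorem theorem2p5p1:
  fixes P :: "'e::banach set"
    and S1 T1 :: "'e \<Rightarrow>\<^sub>L 'a::cstar_algebra hermitian_dual"
    and S2 T2 :: "'a self_adjoint \<Rightarrow>\<^sub>L 'e"
  assumes "ordered_banach_space P"
  shows "(generating_cone P \<and>
          positive_operator P positive_functionals T1 \<and>
          operator_le P positive_functionals T1 S1 \<and>
          weakly_compact_operator S1 \<longrightarrow>
          weakly_compact_operator T1) \<and>
         (normal_cone P \<and>
          positive_operator self_adjoint_cone P T2 \<and>
          operator_le self_adjoint_cone P T2 S2 \<and>
          weakly_compact_operator S2 \<longrightarrow>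
          weakly_compact_operator T2)"
proof (intro conjI impI; elim conjE)
  have P: "convex_cone P" using assms by (simp add: ordered_banach_space_def)
  show "weakly_compact_operator T2"
    if "normal_cone P" "positive_operator self_adjoint_cone P T2"
      "operator_le self_adjoint_cone P T2 S2" "weakly_compact_operator S2"
    by (rule domination_from_self_adjoint[OF P that])
  assume gen: "generating_cone P" and T: "positive_operator P positive_functionals T1"
    and TS: "operator_le P positive_functionals T1 S1" and S: "weakly_compact_operator S1"
  define J where "J = Blinfun (restrict_functional :: 'a hermitian_dual \<Rightarrow> _)"
  define I where "I = Blinfun (extend_functional :: _ \<Rightarrow> 'a hermitian_dual)"
  have J: "blinfun_apply J f = restrict_functional f" for f
    by (simp add: J_def bounded_linear_Blinfun_apply[OF bounded_linear_restrict_functional])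
  have I: "blinfun_apply I g = extend_functional g" for g
    by (simp add: I_def bounded_linear_Blinfun_apply[OF bounded_linear_extend_functional])
  have "weakly_compact_operator (J o\<^sub>L T1)"
  proof (rule domination_into_dual[OF P gen _ _ weakly_compact_operator_compose[OF S, of J]])
    fix x assume x: "x \<in> P"
    show "cone_functional (blinfun_apply (J o\<^sub>L T1) x)"
      using T x by (simp add: J positive_operator_def cone_functional_restrict_functional)
    have "cone_functional (blinfun_apply J (blinfun_apply (S1 - T1) x))"
      using TS x by (simp add: J positive_operator_def operator_le_def cone_functional_restrict_functional)
    then show "cone_functional (blinfun_apply (J o\<^sub>L S1) x - blinfun_apply (J o\<^sub>L T1) x)"
      by (simp add: blinfun.diff_left blinfun.diff_right)
  qed
  then have "weakly_compact_operator (I o\<^sub>L (J o\<^sub>L T1))"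
    by (rule weakly_compact_operator_compose)
  moreover have "I o\<^sub>L (J o\<^sub>L T1) = T1"
    by (rule blinfun_eqI) (simp add: I J extend_restrict_functional)
  ultimately show "weakly_compact_operator T1" by simp
qed

end
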